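(* Let $0\le a\le b$ be integers and let $g_{b,a}(u)$ be the formal series $$g_{b,a}(u)=(-1)^a\Big(\frac12\Big)^b+(-1)^b\sum_{k>0}\frac{q^{(b-a)k}u^k}{(1-q^k)^b}+(-1)^b\sum_{k<0}\frac{q^{(b-a)k}u^k}{(1-q^k)^b},$$ with the convention $g_{0,0}=1$. Then: (i) The series $g_{b,a}(u)$ is locally absolutely convergent in the region $|q|^a<|u|<|q|^{a-b}$, and thus defines a holomorphic function there. It analytically continues to a meromorphic function on $\mathbb{C}^*$ whose only possible poles are at $u=q^m$, $m\in\mathbb{Z}$. (ii) The analytic continuation satisfies $$g_{b,a}\in\mathbb{C}\Big[\Big\{\frac{\theta^{(k)}}{\theta}\Big\}_{0\le k\le b+1}\Big].$$ In particular, $g_{b,a}$ is a quasi-elliptic function of mixed weight, with leading weight $b$. Furthermore, for fixed $b$, the leading part of $g_{b,a}$ is independent of $a$.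
   Context: $\tau$ is in the upper half-plane, $q=e^{2\pi i\tau}$, $u=e^z$, and $$\theta(z)=\frac{\sum_{m\in\mathbb{Z}}(-1)^m q^{\frac12(m+\frac12)^2}e^{(m+\frac12)z}}{\sum_{m\in\mathbb{Z}}(-1)^m (m+\frac12)q^{\frac12(m+\frac12)^2}}$$ is the odd Jacobi theta function with $\theta'(0)=1$; $\theta^{(k)}$ is the $k$-th derivative in $z$, and $\frac{\theta^{(k)}}{\theta}$ is regarded as a meromorphic function of $u=e^z\in\mathbb{C}^*$. In the first membership of (ii), $q$ is fixed, so the complex coefficients may depend on $q$. For even $m\geq 2$ let $\mathbb{G}_m=\frac12(m-1)!\sum_{\lambda\in\Lambda_\tau\setminus\{0\}}\lambda^{-m}$ with $\Lambda_\tau=2\pi i\mathbb{Z}\oplus2\pi i\tau\mathbb{Z}$ (Eisenstein summation, over the $2\pi i$ direction first, for $m=2$). Let $\mathrm{QE}=\mathbb{C}[\mathbb{G}_2,\mathbb{G}_4,\mathbb{G}_6][\{\theta^{(k)}/\theta\}_{k\ge1}]$ be the ring of quasi-elliptic functions (functions of $(z,\tau)$), graded by giving $\theta^{(k)}/\theta$ degree (weight) $k$ and $\mathbb{G}_m$ degree $m$. An element $f\in\mathrm{QE}$ whose highest-degree nonzero homogeneous component has degree $m$ is called quasi-elliptic of mixed weight with leading weight $m$; that highest component is its leading part. *)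

theory Defs
  imports "HOL-Complex_Analysis.Complex_Analysis"
begin

section \<open>Theta function, period lattice and Eisenstein series\<close>

definition qpar :: "complex \<Rightarrow> complex" where
  "qpar \<tau> = exp (2 * of_real pi * \<i> * \<tau>)"

text \<open>Since \<open>q = exp (2 \<pi> \<i> \<tau>)\<close>, the power \<open>q\<close> to the \<open>(m + 1/2)\<^sup>2 / 2\<close>
  means \<open>exp (\<pi> \<i> \<tau> (m + 1/2)\<^sup>2)\<close>.\<close>

definition theta :: "complex \<Rightarrow> complex \<Rightarrow> complex" where
  "theta \<tau> z =
     (\<Sum>\<^sub>\<infinity>m::int. (-1) powi m * exp (of_real pi * \<i> * \<tau> * (of_int m + 1/2)\<^sup>2)
                  * exp ((of_int m + 1/2) * z)) /
     (\<Sum>\<^sub>\<infinity>m::int. (-1) powi m * (of_int m + 1/2)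
                  * exp (of_real pi * \<i> * \<tau> * (of_int m + 1/2)\<^sup>2))"

definition theta_quot :: "nat \<Rightarrow> complex \<Rightarrow> complex \<Rightarrow> complex" where
  "theta_quot k \<tau> z = (deriv ^^ k) (theta \<tau>) z / theta \<tau> z"

definition period :: "complex \<Rightarrow> int \<Rightarrow> int \<Rightarrow> complex" where
  "period \<tau> m n = 2 * of_real pi * \<i> * of_int m + 2 * of_real pi * \<i> * \<tau> * of_int n"

definition period_lattice :: "complex \<Rightarrow> complex set" where
  "period_lattice \<tau> = {period \<tau> m n | m n. True}"

text \<open>For \<open>k = 2\<close> the lattice sum is not absolutely convergent; for each \<open>n\<close> the
  sum over \<open>m\<close> (the \<open>2 \<pi> \<i>\<close> direction) is taken first. Both of the iterated sums converge
  absolutely.\<close>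

definition eisenstein_G :: "nat \<Rightarrow> complex \<Rightarrow> complex" where
  "eisenstein_G k \<tau> = 1/2 * fact (k - 1) *
     (if k = 2
      then (\<Sum>\<^sub>\<infinity>n::int. \<Sum>\<^sub>\<infinity>m\<in>{m::int. (m, n) \<noteq> (0, 0)}. 1 / period \<tau> m n ^ 2)
      else (\<Sum>\<^sub>\<infinity>\<omega>\<in>period_lattice \<tau> - {0}. 1 / \<omega> ^ k))"

section \<open>Generated algebras of functions\<close>

inductive_set generated_algebra :: "('x \<Rightarrow> complex) set \<Rightarrow> ('x \<Rightarrow> complex) set"
  for B :: "('x \<Rightarrow> complex) set" where
  const: "(\<lambda>_. c) \<in> generated_algebra B"
| gen: "f \<in> B \<Longrightarrow> f \<in> generated_algebra B"
| add: "f \<in> generated_algebra B \<Longrightarrow> g \<in> generated_algebra B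
         \<Longrightarrow> (\<lambda>x. f x + g x) \<in> generated_algebra B"
| mult: "f \<in> generated_algebra B \<Longrightarrow> g \<in> generated_algebra B
         \<Longrightarrow> (\<lambda>x. f x * g x) \<in> generated_algebra B"

text \<open>For a set \<open>B\<close> of generators tagged with positive degrees, \<open>homogeneous B d f\<close> says that
  \<open>f\<close> is a \<open>\<complex>\<close>-linear combination of products of generators of total degree \<open>d\<close>.\<close>

inductive homogeneous :: "(nat \<times> ('x \<Rightarrow> complex)) set \<Rightarrow> nat \<Rightarrow> ('x \<Rightarrow> complex) \<Rightarrow> bool"
  for B :: "(nat \<times> ('x \<Rightarrow> complex)) set" where
  const: "homogeneous B 0 (\<lambda>_. c)"
| gen: "(d, f) \<in> B \<Longrightarrow> homogeneous B d f"
| add: "homogeneous B d f \<Longrightarrow> homogeneous B d g \<Longrightarrow> homogeneous B d (\<lambda>x. f x + g x)"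
| mult: "homogeneous B d f \<Longrightarrow> homogeneous B e g \<Longrightarrow> homogeneous B (d + e) (\<lambda>x. f x * g x)"

section \<open>Quasi-elliptic functions\<close>

text \<open>Quasi-elliptic functions are functions of the pair \<open>(z, \<tau>)\<close>. As they may have poles
  at \<open>z \<in> period_lattice \<tau>\<close> (the zeros of \<open>theta \<tau>\<close>), where the values of the HOL functions
  below carry no meaning, all identities between them are imposed on \<open>qe_domain\<close> only.\<close>

definition qe_domain :: "(complex \<times> complex) set" where
  "qe_domain = {(z, \<tau>). Im \<tau> > 0 \<and> z \<notin> period_lattice \<tau>}"

definition qe_gens :: "(nat \<times> (complex \<times> complex \<Rightarrow> complex)) set" where
  "qe_gens = {(m, \<lambda>(z, \<tau>). eisenstein_G m \<tau>) | m. m \<in> {2, 4, 6}} \<union>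
             {(k, \<lambda>(z, \<tau>). theta_quot k \<tau> z) | k. k \<ge> 1}"

definition quasi_elliptic :: "(complex \<times> complex \<Rightarrow> complex) \<Rightarrow> bool" where
  "quasi_elliptic f \<longleftrightarrow> (\<exists>P \<in> generated_algebra (snd ` qe_gens). \<forall>x\<in>qe_domain. f x = P x)"

text \<open>\<open>c d\<close> is the homogeneous component of \<open>f\<close> of degree \<open>d\<close>; all components of degree
  above \<open>w\<close> vanish, and the one of degree \<open>w\<close> is the nonzero function \<open>L\<close>. The components are
  determined by \<open>f\<close> (as functions on \<open>qe_domain\<close>), because the quasi-modular
  transformation behaviour separates the weights.\<close>

definition has_leading_part ::
    "(complex \<times> complex \<Rightarrow> complex) \<Rightarrow> nat \<Rightarrow> (complex \<times> complex \<Rightarrow> complex) \<Rightarrow> bool" where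
  "has_leading_part f w L \<longleftrightarrow>
     (\<exists>c. (\<forall>d\<le>w. homogeneous qe_gens d (c d)) \<and>
          (\<forall>x\<in>qe_domain. f x = (\<Sum>d\<le>w. c d x)) \<and>
          (\<forall>x\<in>qe_domain. L x = c w x) \<and>
          (\<exists>x\<in>qe_domain. L x \<noteq> 0))"

section \<open>The series and its analytic continuation\<close>

text \<open>The \<open>k\<close>-th term of the formal series; the case \<open>b = 0\<close> is the convention that
  this series is the constant 1.\<close>

definition g_term :: "nat \<Rightarrow> nat \<Rightarrow> complex \<Rightarrow> int \<Rightarrow> complex \<Rightarrow> complex" where
  "g_term b a q k u =
     (if b = 0 then (if k = 0 then 1 else 0)
      else if k = 0 then (-1) ^ a * (1/2) ^ b
      else (-1) ^ b * (q powi ((int b - int a) * k) * u powi k / (1 - q powi k) ^ b))"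

definition g_series :: "nat \<Rightarrow> nat \<Rightarrow> complex \<Rightarrow> complex \<Rightarrow> complex" where
  "g_series b a q u = (\<Sum>\<^sub>\<infinity>k::int. g_term b a q k u)"

definition g_region :: "nat \<Rightarrow> nat \<Rightarrow> complex \<Rightarrow> complex set" where
  "g_region b a q = {u. norm q ^ a < norm u \<and> norm u < norm q powi (int a - int b)}"

definition locally_absolutely_convergent_on ::
    "('i \<Rightarrow> complex \<Rightarrow> complex) \<Rightarrow> complex set \<Rightarrow> bool" where
  "locally_absolutely_convergent_on f S \<longleftrightarrow>
     (\<forall>x\<in>S. \<exists>U M. open U \<and> x \<in> U \<and> M summable_on (UNIV :: 'i set) \<and>
        (\<forall>k. \<forall>u\<in>U \<inter> S. norm (f k u) \<le> M k))"

text \<open>\<open>F\<close> is the continuation to \<open>\<complex>\<^sup>*\<close>, holomorphic outside the powers of \<open>q\<close>.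
  For \<open>b = 0\<close> the region is empty, so the convention that the series is 1 has to be
  imposed directly.\<close>

definition g_continuation :: "nat \<Rightarrow> nat \<Rightarrow> complex \<Rightarrow> (complex \<Rightarrow> complex) \<Rightarrow> bool" where
  "g_continuation b a q F \<longleftrightarrow>
     F meromorphic_on (- {0}) \<and>
     F holomorphic_on (- {0} - range (\<lambda>m::int. q powi m)) \<and>
     (\<forall>u\<in>g_region b a q. F u = g_series b a q u) \<and>
     (b = 0 \<longrightarrow> (\<forall>u. u \<noteq> 0 \<longrightarrow> F u = 1))"

end

theory Submission
  imports Defs
begin

text \<open>Let \<open>h\<^bsub>j\<^esub>(u) = \<Sum>k\<noteq>0. q\<^bsup>jk\<^esup> u\<^sup>k / (1 - q\<^sup>k)\<^bsup>j+1\<^esup>\<close>; up to a sign and a constant, \<open>g\<^bsub>b,a\<^esub>(u)\<close> is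
  \<open>h\<^bsub>b-1\<^esub>(q\<^bsup>1-a\<^esup> u)\<close>. The Kronecker function \<open>\<theta>(z + w) / (\<theta>(z) \<theta>(w))\<close> is multiplied by \<open>e\<^bsup>-w\<^esup>\<close> under
  \<open>z \<mapsto> z + 2 \<pi> \<i> \<tau>\<close>, so its Taylor coefficients in \<open>s = e\<^sup>w - 1\<close> satisfy the same recursion under
  \<open>u \<mapsto> q u\<close> as the \<open>h\<^bsub>j\<^esub>\<close>. By Liouville's theorem on the annulus \<open>|q| < |u| < 1/|q|\<close> the two agree up to
  sign. The expansion in \<open>w\<close> has coefficients \<open>\<theta>\<^bsup>(i)\<^esup>(z) / \<theta>(z)\<close> times the Taylor coefficients of
  \<open>w / \<theta>(w)\<close>, and the change of variables from \<open>w\<close> to \<open>s\<close> only adds terms of lower weight.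

  For the coefficients of \<open>\<theta>\<close> at \<open>0\<close> neither \<open>G\<^sub>4\<close> nor \<open>G\<^sub>6\<close> is needed: the addition formula
  \<open>\<theta>(z + w) \<theta>(z - w) / \<theta>(z)\<^sup>2 = \<theta>'(w)\<^sup>2 - \<theta>(w) \<theta>''(w) - e(z) \<theta>(w)\<^sup>2\<close> determines all of them recursively as
  homogeneous polynomials in the \<open>\<theta>\<^bsup>(k)\<^esup>(z) / \<theta>(z)\<close> and the third one, which is \<open>- G\<^sub>2\<close>.\<close>

section \<open>Series of holomorphic functions and a Liouville theorem on annuli\<close>

text \<open>The Liouville argument leaves an additive constant at every level j. If the two sides at
  level j add up to a constant, their sum at level j + 1 changes under u \<mapsto> q u by minus that
  constant, and single-valuedness in u forces it to be 0. So each step of the induction settles the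
  constant of the level before. It starts from j = 0, where both sides are explicit through the
  logarithmic derivative of the product formula.

  The variable s = e^w - 1 is chosen because multiplication by e^w = 1 + s couples only two
  neighbouring coefficients. Replacing u by q^(1-a) u costs a factor e^((a-1)w), whose constant term
  is 1: therefore a influences only the components of weight below b.

  The recursion for the Taylor coefficients t_n of \<theta> at 0 multiplies t_(k+1) by (k + 1)(2 -
  k). It breaks down exactly at k = 2, so the third coefficient is computed separately, by comparing
  the q-expansion of \<theta>'''(0) with that of the Eisenstein-summed lattice sum; this is where
  G_2 enters.\<close>

lemma locally_absolutely_convergent_onD:
  assumes "locally_absolutely_convergent_on f S" "open S" "z \<in> S"
  obtains r M where "r > 0" "cball z r \<subseteq> S" "M summable_on UNIV"
    "\<And>k u. u \<in> cball z r \<Longrightarrow> norm (f k u) \<le> M k"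
proof -
  obtain U M where U: "open U" "z \<in> U" "M summable_on UNIV" "\<forall>k. \<forall>u\<in>U \<inter> S. norm (f k u) \<le> M k"
    using bspec[OF assms(1)[unfolded locally_absolutely_convergent_on_def] assms(3)] by blast
  have "open (U \<inter> S)" "z \<in> U \<inter> S" using U assms by auto
  then obtain r where r: "r > 0" "cball z r \<subseteq> U \<inter> S"
    using open_contains_cball[of "U \<inter> S"] by blast
  show ?thesis
    by (rule that[of r M]) (use U r in blast)+
qed

lemma locally_absolutely_convergent_on_summable:
  assumes "locally_absolutely_convergent_on f S" "z \<in> S"
  shows "(\<lambda>k. f k z) summable_on UNIV"
proof -
  obtain U M where U: "open U" "z \<in> U" "M summable_on UNIV" "\<forall>k. \<forall>u\<in>U \<inter> S. norm (f k u) \<le> M k"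
    using bspec[OF assms(1)[unfolded locally_absolutely_convergent_on_def] assms(2)] by blast
  have "(\<lambda>k. norm (f k z)) summable_on UNIV"
    by (rule summable_on_comparison_test[OF U(3)]) (use U assms in auto)
  then show ?thesis by (rule abs_summable_summable)
qed

lemma locally_absolutely_convergent_on_uniform_limit:
  assumes "locally_absolutely_convergent_on f S" "open S" "z \<in> S"
  obtains r where "r > 0" "cball z r \<subseteq> S"
    "uniform_limit (cball z r) (\<lambda>X u. \<Sum>k\<in>X. f k u) (\<lambda>u. \<Sum>\<^sub>\<infinity>k. f k u) (finite_subsets_at_top UNIV)"
proof -
  from locally_absolutely_convergent_onD[OF assms] obtain r M where *: "r > 0" "cball z r \<subseteq> S"
    "M summable_on UNIV" "\<And>k u. u \<in> cball z r \<Longrightarrow> norm (f k u) \<le> M k" by blast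
  show ?thesis
    by (rule that[OF *(1,2)], rule Weierstrass_m_test_general[where M = M]) (use * in auto)
qed

lemma locally_absolutely_convergent_on_holomorphic:
  assumes lac: "locally_absolutely_convergent_on f S" and S: "open S"
    and hol: "\<And>k. f k holomorphic_on S"
  shows "(\<lambda>u. \<Sum>\<^sub>\<infinity>k. f k u) holomorphic_on S"
  unfolding holomorphic_on_open[OF S]
proof
  fix z assume z: "z \<in> S"
  obtain r where r: "r > 0" "cball z r \<subseteq> S"
    "uniform_limit (cball z r) (\<lambda>X u. \<Sum>k\<in>X. f k u) (\<lambda>u. \<Sum>\<^sub>\<infinity>k. f k u) (finite_subsets_at_top UNIV)"
    using locally_absolutely_convergent_on_uniform_limit[OF lac S z] by blast
  have "(\<lambda>u. \<Sum>\<^sub>\<infinity>k. f k u) holomorphic_on ball z r"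
  proof (rule holomorphic_uniform_limit[OF _ r(3)])
    have "(\<lambda>u. \<Sum>k\<in>X. f k u) holomorphic_on cball z r" for X
      by (intro holomorphic_on_sum holomorphic_on_subset[OF hol r(2)])
    then show "\<forall>\<^sub>F X in finite_subsets_at_top UNIV. continuous_on (cball z r) (\<lambda>u. \<Sum>k\<in>X. f k u)
        \<and> (\<lambda>u. \<Sum>k\<in>X. f k u) holomorphic_on ball z r"
      by (intro always_eventually allI conjI holomorphic_on_imp_continuous_on)
         (auto intro: holomorphic_on_subset[OF _ ball_subset_cball])
  qed auto
  then show "\<exists>f'. ((\<lambda>u. \<Sum>\<^sub>\<infinity>k. f k u) has_field_derivative f') (at z)"
    using r(1) by (auto simp: holomorphic_on_open)
qed

lemma higher_deriv_sum_series:
  assumes lac: "locally_absolutely_convergent_on f S" and S: "open S"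
    and hol: "\<And>k. f k holomorphic_on S" and z: "z \<in> S"
  shows "((\<lambda>k. (deriv ^^ i) (f k) z) has_sum (deriv ^^ i) (\<lambda>u. \<Sum>\<^sub>\<infinity>k. f k u) z) UNIV"
proof -
  obtain r where r: "r > 0" "cball z r \<subseteq> S"
    "uniform_limit (cball z r) (\<lambda>X u. \<Sum>k\<in>X. f k u) (\<lambda>u. \<Sum>\<^sub>\<infinity>k. f k u) (finite_subsets_at_top UNIV)"
    using locally_absolutely_convergent_on_uniform_limit[OF lac S z] by blast
  have bS: "ball z r \<subseteq> S" using r by auto
  have "((\<lambda>X. (deriv ^^ i) (\<lambda>u. \<Sum>k\<in>X. f k u) z) \<longlongrightarrow> (deriv ^^ i) (\<lambda>u. \<Sum>\<^sub>\<infinity>k. f k u) z)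
      (finite_subsets_at_top UNIV)"
  proof (rule higher_deriv_complex_uniform_limit)
    show "uniform_limit (ball z r) (\<lambda>X u. \<Sum>k\<in>X. f k u) (\<lambda>u. \<Sum>\<^sub>\<infinity>k. f k u) (finite_subsets_at_top UNIV)"
      by (rule uniform_limit_on_subset[OF r(3)]) auto
    show "\<forall>\<^sub>F X in finite_subsets_at_top UNIV. (\<lambda>u. \<Sum>k\<in>X. f k u) holomorphic_on ball z r"
      by (intro always_eventually allI holomorphic_on_sum holomorphic_on_subset[OF hol bS])
  qed (use r in auto)
  moreover have "(deriv ^^ i) (\<lambda>u. \<Sum>k\<in>X. f k u) z = (\<Sum>k\<in>X. (deriv ^^ i) (f k) z)" if "finite X" for X
    using that
  proof (induction X)
    case empty
    have "(deriv ^^ i) (\<lambda>u. 0::complex) = (\<lambda>u. 0)" by (induction i) auto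
    then show ?case by simp
  next
    case (insert x X)
    have "(deriv ^^ i) (\<lambda>u. f x u + (\<Sum>k\<in>X. f k u)) z =
        (deriv ^^ i) (f x) z + (deriv ^^ i) (\<lambda>u. \<Sum>k\<in>X. f k u) z"
      by (rule higher_deriv_add[where S = S]) (use z S hol in \<open>auto intro: holomorphic_on_sum\<close>)
    then show ?case using insert by simp
  qed
  ultimately show ?thesis
    unfolding has_sum_def
    by (elim Lim_transform_eventually) (auto simp: eventually_finite_subsets_at_top)
qed

text \<open>The operator u d/du removes the additive constant and commutes with u \<mapsto> q u, so
  \<open>D\<close> is invariant and attains its maximum modulus on a compact fundamental annulus;
  hence it is a constant \<alpha>. Then g' = \<alpha>/u has a single-valued primitive, which forces
  \<alpha> = 0. The limit hypothesis makes the point 1 a removable singularity.\<close>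

lemma annulus_additive_const:
  fixes q c :: complex and f :: "complex \<Rightarrow> complex"
  assumes q: "q \<noteq> 0" "norm q < 1"
    and hol: "f holomorphic_on {u. norm q < norm u \<and> norm u < 1 / norm q} - {1}"
    and lim: "((\<lambda>u. (u - 1) * f u) \<longlongrightarrow> 0) (at 1)"
    and shift: "\<And>u. 1 < norm u \<Longrightarrow> norm u < 1 / norm q \<Longrightarrow> f (q * u) = f u + c"
  obtains \<beta> where "c = 0" "\<And>u. norm q < norm u \<Longrightarrow> norm u < 1 / norm q \<Longrightarrow> u \<noteq> 1 \<Longrightarrow> f u = \<beta>"
proof -
  define A where "A = {u::complex. norm q < norm u \<and> norm u < 1 / norm q}"
  have nq: "0 < norm q" "1 < 1 / norm q" using q by (auto simp: field_simps)
  have A: "open A" unfolding A_def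
    by (intro open_Collect_conj open_Collect_less continuous_intros)
  have cA: "connected A"
    using connected_annulus(1)[of "norm q" "0::complex" "1 / norm q"] unfolding A_def by simp
  have one: "1 \<in> A" using q nq by (auto simp: A_def)
  obtain g where g: "g holomorphic_on A" "\<And>u. u \<in> A - {1} \<Longrightarrow> g u = f u"
    using holomorphic_on_extend_lim[OF hol[folded A_def]] lim one A by (auto simp: interior_open)
  have qu: "norm q < norm (q * u)" "norm (q * u) < 1" if "1 < norm u" "norm u < 1 / norm q" for u
    using that nq mult_strict_left_mono[OF that(1) nq(1)] by (auto simp: norm_mult field_simps)
  have inA: "u \<in> A" "q * u \<in> A" "u \<noteq> 1" "q * u \<noteq> 1" if "1 < norm u" "norm u < 1 / norm q" for u
  proof -
    show "u \<in> A" "q * u \<in> A" using that qu[OF that] nq q unfolding A_def by (intro CollectI conjI; linarith)+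
    show "u \<noteq> 1" "q * u \<noteq> 1" using that(1) qu(2)[OF that] by (metis less_irrefl norm_one)+
  qed
  have gshift: "g (q * u) = g u + c" if "1 < norm u" "norm u < 1 / norm q" for u
    using shift[OF that] inA[OF that] g(2) by simp
  define D where "D = (\<lambda>u. u * deriv g u)"
  have D: "D holomorphic_on A"
    unfolding D_def by (intro holomorphic_intros g A holomorphic_deriv)
  have Dshift: "D (q * u) = D u" if u: "1 < norm u" "norm u < 1 / norm q" for u
  proof -
    note uA = inA(1,2)[OF u]
    have op: "open {u::complex. 1 < norm u \<and> norm u < 1 / norm q}"
      by (intro open_Collect_conj open_Collect_less continuous_intros)
    have ev: "\<forall>\<^sub>F w in nhds u. g (q * w) = g w + c"
      by (rule eventually_mono[OF eventually_nhds_in_open[OF op]]) (use u gshift in auto)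
    have gd: "(g has_field_derivative deriv g w) (at w)" if "w \<in> A" for w
      using holomorphic_derivI[OF g(1) A that] .
    have "((\<lambda>w. g (q * w)) has_field_derivative deriv g (q * u) * q) (at u)"
      by (rule DERIV_chain2[where f = g and g = "\<lambda>w. q * w", OF gd[OF uA(2)]]) (auto intro!: derivative_eq_intros)
    moreover have "((\<lambda>w. g w + c) has_field_derivative deriv g u) (at u)"
      using gd[OF uA(1)] by (auto intro!: derivative_eq_intros)
    ultimately have "deriv g (q * u) * q = deriv g u"
      using ev DERIV_cong_ev[OF refl ev refl] DERIV_unique by blast
    then show ?thesis by (simp add: D_def mult_ac)
  qed
  \<comment> \<open>With r^2 = |q| the closed annulus between r and 1/r has radius ratio 1/|q|, so
    one multiplication or division by q moves every other point of \<open>A\<close> into it.\<close>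
  define r where "r = sqrt (norm q)"
  have r: "0 < r" "r < 1" "r * r = norm q" using q by (auto simp: r_def)
  have rq: "norm q < r" "1 / r < 1 / norm q" "norm q / r = r" "r / norm q = 1 / r"
  proof -
    show 1: "norm q < r" using mult_strict_left_mono[OF r(2,1)] r(3) by simp
    show "1 / r < 1 / norm q" using frac_less2[of 1 1 "norm q" r] 1 nq r by auto
  qed (use r in \<open>auto simp flip: r(3)\<close>)
  have r1: "1 / r > 1" using r by simp
  define K where "K = {u::complex. r \<le> norm u \<and> norm u \<le> 1 / r}"
  have "compact K"
  proof -
    have "K = cball 0 (1 / r) - ball 0 r" by (auto simp: K_def)
    then show ?thesis by (simp add: compact_diff)
  qed
  have KA: "K \<subseteq> A" using r rq by (auto simp: K_def A_def simp del: divide_less_cancel)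
  have "1 \<in> K" using r by (auto simp: K_def)
  then obtain u0 where u0: "u0 \<in> K" "\<And>u. u \<in> K \<Longrightarrow> norm (D u) \<le> norm (D u0)"
    using continuous_attains_sup[OF \<open>compact K\<close>, of "\<lambda>u. norm (D u)"]
      continuous_on_norm[OF continuous_on_subset[OF holomorphic_on_imp_continuous_on[OF D] KA]]
    by blast
  have max: "norm (D u) \<le> norm (D u0)" if u: "u \<in> A" for u
  proof -
    consider "u \<in> K" | "norm u < r" | "norm u > 1 / r" by (force simp: K_def)
    then show ?thesis
    proof cases
      case 1 then show ?thesis by (rule u0)
    next
      case 2
      have n: "norm (u / q) = norm u / norm q" by (simp add: norm_divide)
      have "norm u / norm q > 1" using u nq(1) by (simp add: A_def less_divide_eq)
      moreover have "norm u / norm q < 1 / r"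
        using divide_strict_right_mono[OF 2 nq(1)] rq by simp
      ultimately have "u / q \<in> K" "D (q * (u / q)) = D (u / q)"
        using r(1,2) rq by (simp add: K_def n, intro Dshift) (unfold n, linarith+)
      then show ?thesis using u0(2)[of "u / q"] q by simp
    next
      case 3
      have n: "norm (q * u) = norm q * norm u" by (simp add: norm_mult)
      have "norm q * norm u < 1" using u nq by (auto simp: A_def field_simps)
      moreover have "norm q * norm u > r"
        using mult_strict_left_mono[OF 3 nq(1)] rq by simp
      moreover have "norm u > 1" using 3 r1 by linarith
      ultimately have "q * u \<in> K" "D (q * u) = D u"
        using r1 rq u by (auto simp: K_def n A_def intro!: Dshift)
      then show ?thesis using u0(2)[of "q * u"] by simp
    qed
  qed
  have "D constant_on A"
    by (rule maximum_modulus_principle[OF D A cA A order_refl, of u0]) (use u0 KA max in auto)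
  then obtain \<alpha> where \<alpha>: "\<And>u. u \<in> A \<Longrightarrow> D u = \<alpha>" by (auto simp: constant_on_def)
  have dg: "deriv g u = \<alpha> / u" if "u \<in> A" for u
    using \<alpha>[OF that] that nq by (auto simp: D_def A_def field_simps)
  have circ: "path_image (circlepath 0 1) \<subseteq> A"
    using nq by (auto simp: A_def q)
  \<comment> \<open>The integral of g' over the unit circle is 0 because g is a primitive on
    \<open>A\<close>, whereas \<alpha>/u integrates to 2 pi i \<alpha>.\<close>
  have "(deriv g has_contour_integral 0) (circlepath 0 1)"
    by (rule Cauchy_theorem_primitive[where f = g and S = A])
       (use circ holomorphic_derivI[OF g(1) A] in \<open>auto simp: has_field_derivative_at_within\<close>)
  moreover have "((\<lambda>u. \<alpha> / (u - 0)) has_contour_integral (2 * of_real pi * \<i> * \<alpha>)) (circlepath 0 1)"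
    by (rule Cauchy_integral_circlepath_simple) auto
  then have "(deriv g has_contour_integral (2 * of_real pi * \<i> * \<alpha>)) (circlepath 0 1)"
    by (rule has_contour_integral_eq) (use circ dg in auto)
  ultimately have "2 * of_real pi * \<i> * \<alpha> = 0"
    using has_contour_integral_unique by blast
  then have "\<And>u. u \<in> A \<Longrightarrow> deriv g u = 0" using dg by simp
  then have "g constant_on A"
    using has_field_derivative_0_imp_constant_on[of A g] holomorphic_derivI[OF g(1) A] A cA by metis
  then obtain \<beta> where \<beta>: "\<And>u. u \<in> A \<Longrightarrow> g u = \<beta>" by (auto simp: constant_on_def)
  \<comment> \<open>A sample point with 1 < |u| < 1/|q|, at which the shift exhibits
    \<open>c\<close> as a difference of two values of a constant function.\<close>
  define u1 where "u1 = complex_of_real (1 / r)"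
  have "norm u1 = 1 / r" using r by (simp add: u1_def norm_divide)
  then have u1: "1 < norm u1" "norm u1 < 1 / norm q" using r rq by auto
  then have "c = 0" using gshift[OF u1] inA(1,2)[OF u1] \<beta> by simp
  then show ?thesis using that[of \<beta>] \<beta> g(2) by (auto simp: A_def)
qed

text \<open>\<open>Ln\<close> jumps across the negative real axis, but \<open>f\<close> depends on
  \<open>exp z\<close> only. Near u0 the branch \<open>Ln (u / u0) + Ln u0\<close> may be used
  instead, which is holomorphic at u0 even on the cut.\<close>

lemma holomorphic_on_comp_Ln:
  fixes f :: "complex \<Rightarrow> complex"
  assumes hol: "f holomorphic_on (exp -` U)" and U: "open U" "0 \<notin> U"
    and per: "\<And>z w. exp z = exp w \<Longrightarrow> f z = f w"
  shows "(\<lambda>u. f (Ln u)) holomorphic_on U"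
  unfolding holomorphic_on_open[OF U(1)]
proof
  fix u0 assume u0: "u0 \<in> U"
  then have nz: "u0 \<noteq> 0" using U by auto
  define g where "g = (\<lambda>u. Ln (u / u0) + Ln u0)"
  have eg: "exp (g u) = u" if "u \<noteq> 0" for u using that nz by (simp add: g_def exp_add)
  have oV: "open (exp -` U :: complex set)" using U(1) by (intro open_vimage continuous_intros)
  have g0: "g u0 \<in> exp -` U" using eg[OF nz] u0 by simp
  have "(g has_field_derivative inverse (u0/u0) * (1 / u0)) (at u0)"
    unfolding g_def using nz by (auto intro!: derivative_eq_intros)
  moreover obtain f' where "(f has_field_derivative f') (at (g u0))"
    using hol g0 oV by (auto simp: holomorphic_on_open)
  ultimately have "((\<lambda>u. f (g u)) has_field_derivative f' * (inverse (u0/u0) * (1 / u0))) (at u0)"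
    by (rule DERIV_chain2[rotated])
  moreover have ev: "\<forall>\<^sub>F u in nhds u0. f (g u) = f (Ln u)"
  proof (rule eventually_mono[OF eventually_nhds_in_open[OF U(1) u0]])
    fix u assume "u \<in> U"
    then have "u \<noteq> 0" using U by auto
    then show "f (g u) = f (Ln u)" by (intro per) (simp add: eg)
  qed
  ultimately have "((\<lambda>u. f (Ln u)) has_field_derivative f' * (inverse (u0/u0) * (1 / u0))) (at u0)"
    using DERIV_cong_ev[OF refl ev refl] by simp
  then show "\<exists>f'. ((\<lambda>u. f (Ln u)) has_field_derivative f') (at u0)" ..
qed

lemma summable_on_power_abs_int:
  fixes r :: real
  assumes "0 \<le> r" "r < 1"
  shows "(\<lambda>k::int. r ^ nat \<bar>k\<bar>) summable_on UNIV"
proof -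
  have geo: "(\<lambda>n::nat. r ^ n) summable_on UNIV"
    using assms by (intro norm_summable_imp_summable_on) (simp add: norm_power summable_geometric)
  have "(\<lambda>k::int. r ^ nat \<bar>k\<bar>) summable_on (int ` UNIV)"
    by (subst summable_on_reindex) (simp_all add: o_def geo)
  moreover have "(\<lambda>k::int. r ^ nat \<bar>k\<bar>) summable_on ((\<lambda>n. - int n) ` UNIV)"
    by (subst summable_on_reindex) (simp_all add: o_def geo inj_on_def)
  ultimately have "(\<lambda>k::int. r ^ nat \<bar>k\<bar>) summable_on (int ` UNIV \<union> (\<lambda>n. - int n) ` UNIV)"
    by (rule summable_on_union)
  moreover have "x \<in> int ` UNIV \<union> (\<lambda>n. - int n) ` UNIV" for x :: int
    by (cases x rule: int_cases2) auto
  then have "int ` UNIV \<union> (\<lambda>n. - int n) ` UNIV = (UNIV :: int set)" by blast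
  ultimately show ?thesis by simp
qed

text \<open>The codomain of \<open>f\<close> is arbitrary: the lemma is also applied to the
  predicate \<open>theta \<tau> z = 0\<close>, which is periodic although \<theta> itself is only
  quasi-periodic.\<close>

lemma periodic_int_shift:
  fixes p :: complex
  assumes "\<And>z. f (z + p) = f z"
  shows "f (z + of_int n * p) = f z"
proof (induction n rule: int_induct[of _ 0])
  case (step1 i)
  then show ?case using assms[of "z + of_int i * p"] by (simp add: algebra_simps)
next
  case (step2 i)
  then show ?case using assms[of "z + of_int (i - 1) * p"] by (simp add: algebra_simps)
qed simp

lemma exp_eq_imp_periodic_eq:
  assumes "\<And>z. f (z + 2 * of_real pi * \<i>) = f z" and "exp z = exp w"
  shows "f z = f w"
proof -
  obtain n :: int where "z = w + (of_int (2 * n) * pi) * \<i>" using assms(2) by (auto simp: exp_eq)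
  then have "z = w + of_int n * (2 * of_real pi * \<i>)" by simp
  then show ?thesis using periodic_int_shift[of f "2 * of_real pi * \<i>" w n] assms(1) by simp
qed

abbreviation tau_period :: "complex \<Rightarrow> complex" where
  "tau_period \<tau> \<equiv> 2 * of_real pi * \<i> * \<tau>"

lemma norm_qpar: "norm (qpar \<tau>) = exp (- (2 * pi * Im \<tau>))"
  by (simp add: qpar_def)

text \<open>The annulus lemma in the coordinate z = log u. Since Re z = log |u| and |q| = exp (-2 pi
  Im \<tau>), the strip is the preimage of the annulus, and adding 2 pi i \<tau> is multiplication
  by q.\<close>

lemma strip_additive_const:
  fixes f :: "complex \<Rightarrow> complex"
  assumes im: "Im \<tau> > 0"
    and hol: "f holomorphic_on {z. \<bar>Re z\<bar> < 2 * pi * Im \<tau> \<and> exp z \<noteq> 1}"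
    and per: "\<And>z. f (z + 2 * of_real pi * \<i>) = f z"
    and lim: "((\<lambda>z. z * f z) \<longlongrightarrow> 0) (at 0)"
    and shift: "\<And>z. 0 < Re z \<Longrightarrow> Re z < 2 * pi * Im \<tau> \<Longrightarrow> f (z + 2 * of_real pi * \<i> * \<tau>) = f z + c"
  obtains \<beta> where "c = 0" "\<And>z. \<bar>Re z\<bar> < 2 * pi * Im \<tau> \<Longrightarrow> exp z \<noteq> 1 \<Longrightarrow> f z = \<beta>"
proof -
  define q where "q = qpar \<tau>"
  define W where "W = 2 * pi * Im \<tau>"
  have W: "W > 0" using im by (simp add: W_def)
  have nq: "norm q = exp (- W)" "1 / norm q = exp W"
    by (simp_all add: q_def norm_qpar W_def exp_minus inverse_eq_divide)
  have q: "q \<noteq> 0" "norm q < 1" using W nq by auto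
  note peq = exp_eq_imp_periodic_eq[of f, OF per]
  define A where "A = {u::complex. norm q < norm u \<and> norm u < 1 / norm q} - {1}"
  have oA: "open A" unfolding A_def
    by (intro open_Diff open_Collect_conj open_Collect_less continuous_intros closed_singleton)
  have A0: "0 \<notin> A" by (auto simp: A_def nq)
  have vA: "exp -` A = {z. \<bar>Re z\<bar> < W \<and> exp z \<noteq> 1}"
    unfolding A_def nq(2) unfolding nq(1) by (auto simp: abs_less_iff)
  have 1: "(\<lambda>u. f (Ln u)) holomorphic_on A"
    by (rule holomorphic_on_comp_Ln[OF _ oA A0 peq]) (use hol in \<open>auto simp: vA W_def\<close>)
  \<comment> \<open>The growth conditions in z at 0 and in u at 1 agree because Ln u / (u - 1) tends
    to 1.\<close>
  have 2: "((\<lambda>u. (u - 1) * f (Ln u)) \<longlongrightarrow> 0) (at 1)"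
  proof -
    have "(Ln has_field_derivative inverse 1) (at 1)" by (rule has_field_derivative_Ln) auto
    then have d: "((\<lambda>u. Ln u / (u - 1)) \<longlongrightarrow> 1) (at 1)" by (simp add: has_field_derivative_iff)
    have nz: "\<forall>\<^sub>F u in at 1. u \<noteq> 1 \<and> Ln u \<noteq> 0"
    proof -
      have "\<forall>\<^sub>F u in at 1. u \<in> - {0} - {1::complex}"
        by (rule eventually_at_in_open) (auto simp: open_Compl)
      then show ?thesis
      proof eventually_elim
        case (elim u)
        then show ?case using exp_Ln[of u] by (cases "Ln u = 0") auto
      qed
    qed
    have "(Ln \<longlongrightarrow> Ln 1) (at 1)" by (intro tendsto_intros) auto
    then have "filterlim Ln (at 0) (at 1)"
      by (auto simp: filterlim_at intro!: eventually_mono[OF nz])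
    from filterlim_compose[OF lim this] have "((\<lambda>u. Ln u * f (Ln u)) \<longlongrightarrow> 0) (at 1)" .
    from tendsto_mult[OF tendsto_inverse[OF d] this]
    have "((\<lambda>u. inverse (Ln u / (u - 1)) * (Ln u * f (Ln u))) \<longlongrightarrow> 0) (at 1)" by simp
    then show ?thesis
      by (rule Lim_transform_eventually) (auto intro!: eventually_mono[OF nz])
  qed
  have 3: "f (Ln (q * u)) = f (Ln u) + c" if "1 < norm u" "norm u < 1 / norm q" for u
  proof -
    have u0: "u \<noteq> 0" using that by auto
    have "exp (Ln (q * u)) = exp (Ln u + 2 * of_real pi * \<i> * \<tau>)"
      using u0 q by (simp add: exp_add q_def qpar_def)
    then have "f (Ln (q * u)) = f (Ln u + 2 * of_real pi * \<i> * \<tau>)" by (rule peq)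
    also have "\<dots> = f (Ln u) + c"
    proof (rule shift)
      show "0 < Re (Ln u)" using that u0 by simp
      have "ln (norm u) < ln (exp W)" using that u0 unfolding nq(2) by (subst ln_less_cancel_iff) auto
      then show "Re (Ln u) < 2 * pi * Im \<tau>" using u0 by (simp add: W_def)
    qed
    finally show ?thesis .
  qed
  obtain \<beta> where c: "c = 0" and \<beta>: "\<And>u. norm q < norm u \<Longrightarrow> norm u < 1 / norm q \<Longrightarrow> u \<noteq> 1 \<Longrightarrow> f (Ln u) = \<beta>"
    using annulus_additive_const[OF q 1[unfolded A_def] 2 3] by blast
  have "f z = \<beta>" if "\<bar>Re z\<bar> < 2 * pi * Im \<tau>" "exp z \<noteq> 1" for z
    using \<beta>[of "exp z", unfolded nq(2), unfolded nq(1)] that peq[of "Ln (exp z)" z]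
    by (simp add: W_def abs_less_iff)
  with c that show ?thesis by blast
qed

section \<open>Sums over the integers, geometric series and bounds for Lambert denominators\<close>

lemma has_sum_int_splitI:
  fixes f :: "int \<Rightarrow> complex"
  assumes "((\<lambda>n::nat. f (int n)) has_sum a) UNIV" "((\<lambda>n::nat. f (- int n - 1)) has_sum b) UNIV"
  shows "(f has_sum (a + b)) UNIV"
proof -
  have "(f has_sum a) (range int)" using assms(1) by (subst has_sum_reindex) (auto simp: o_def)
  moreover have "(f has_sum b) (range (\<lambda>n::nat. - int n - 1))"
    using assms(2) by (subst has_sum_reindex) (auto simp: o_def inj_on_def)
  ultimately have "(f has_sum (a + b)) (range int \<union> range (\<lambda>n::nat. - int n - 1))"
    by (rule has_sum_Un_disjoint) auto
  moreover have "x \<in> range int \<union> range (\<lambda>n::nat. - int n - 1)" for x :: int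
    by (cases x rule: int_cases) auto
  then have "range int \<union> range (\<lambda>n::nat. - int n - 1) = (UNIV :: int set)" by blast
  ultimately show ?thesis by simp
qed

lemma infsum_int_split:
  fixes f :: "int \<Rightarrow> complex"
  assumes "f summable_on UNIV"
  shows "(\<lambda>n::nat. f (int n)) summable_on UNIV" "(\<lambda>n::nat. f (- int n - 1)) summable_on UNIV"
    "(\<Sum>\<^sub>\<infinity>k. f k) = (\<Sum>\<^sub>\<infinity>n::nat. f (int n)) + (\<Sum>\<^sub>\<infinity>n::nat. f (- int n - 1))"
proof -
  have inj: "inj (\<lambda>n::nat. - int n - 1)" by (auto simp: inj_on_def)
  have "f summable_on range int" "f summable_on range (\<lambda>n::nat. - int n - 1)"
    using assms by (auto intro: summable_on_subset_banach)
  then show "(\<lambda>n::nat. f (int n)) summable_on UNIV" "(\<lambda>n::nat. f (- int n - 1)) summable_on UNIV"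
    by (simp_all add: summable_on_reindex inj o_def)
  then show "(\<Sum>\<^sub>\<infinity>k. f k) = (\<Sum>\<^sub>\<infinity>n::nat. f (int n)) + (\<Sum>\<^sub>\<infinity>n::nat. f (- int n - 1))"
    by (intro infsumI has_sum_int_splitI has_sum_infsum)
qed

text \<open>The term n = 0 is set to 0 to match Lambert terms, which vanish there because 1 - q^0 =
  0 and x / 0 = 0.\<close>

lemma has_sum_geometric_from_1:
  fixes x :: complex
  assumes "norm x < 1"
  shows "((\<lambda>n. if n = 0 then 0 else x ^ n) has_sum (x / (1 - x))) UNIV"
proof (rule norm_summable_imp_has_sum)
  have "(\<lambda>n. x * x ^ n) sums (x * (1 / (1 - x)))"
    by (intro sums_mult geometric_sums assms)
  then have "(\<lambda>n. if Suc n = 0 then 0 else x ^ Suc n) sums (x / (1 - x) - 0)" by simp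
  then show "(\<lambda>n. if n = 0 then 0 else x ^ n) sums (x / (1 - x))"
    by (subst (asm) sums_Suc_iff) simp
  show "summable (\<lambda>n. norm (if n = 0 then 0 else x ^ n))"
    by (rule summable_comparison_test'[OF summable_geometric[of "norm x"]])
       (use assms in \<open>auto simp: norm_power\<close>)
qed

lemma one_minus_power_bound:
  fixes q :: complex
  assumes "norm q < 1" "n > 0"
  shows "1 - norm q \<le> norm (1 - q ^ n)" "q ^ n \<noteq> 1"
proof -
  have "norm q ^ n \<le> norm q ^ 1" using assms by (intro power_decreasing) auto
  moreover have "1 - norm (q ^ n) \<le> norm (1 - q ^ n)" using norm_triangle_ineq2[of 1 "q ^ n"] by simp
  ultimately show "1 - norm q \<le> norm (1 - q ^ n)" by (simp add: norm_power)
  then show "q ^ n \<noteq> 1" using assms by auto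
qed

section \<open>The theta series and its product formula\<close>

definition theta_term :: "complex \<Rightarrow> int \<Rightarrow> complex \<Rightarrow> complex" where
  "theta_term \<tau> m z = (-1) powi m * exp (of_real pi * \<i> * \<tau> * (of_int m + 1/2)\<^sup>2)
     * exp ((of_int m + 1/2) * z)"

definition theta_num :: "complex \<Rightarrow> complex \<Rightarrow> complex" where
  "theta_num \<tau> z = (\<Sum>\<^sub>\<infinity>m. theta_term \<tau> m z)"

definition theta_den :: "complex \<Rightarrow> complex" where
  "theta_den \<tau> = (\<Sum>\<^sub>\<infinity>m::int. (-1) powi m * (of_int m + 1/2)
     * exp (of_real pi * \<i> * \<tau> * (of_int m + 1/2)\<^sup>2))"

lemma theta_eq_quotient: "theta \<tau> z = theta_num \<tau> z / theta_den \<tau>"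
  by (simp add: theta_def theta_num_def theta_term_def theta_den_def)

text \<open>With c = pi Im \<tau> and x = m + 1/2 the term has modulus at most exp (R |x| - c x^2).
  Completing the square with R + 1 in place of R leaves a spare exp (-|x|), which becomes the
  geometric factor in |m|; passing from |x| to |m| costs the 1/2.\<close>

lemma norm_theta_term_le:
  assumes im: "Im \<tau> > 0" and z: "norm z \<le> R"
  shows "norm (theta_term \<tau> m z)
    \<le> exp ((R + 1)\<^sup>2 / (4 * (pi * Im \<tau>)) + 1/2) * exp (-1) ^ nat \<bar>m\<bar>"
proof -
  define c where "c = pi * Im \<tau>"
  define x where "x = real_of_int m + 1/2"
  have c: "c > 0" using im by (simp add: c_def)
  have x: "of_int m + 1/2 = complex_of_real x" by (simp add: x_def)
  have "norm (theta_term \<tau> m z) = exp (- (c * x\<^sup>2)) * exp (x * Re z)"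
    unfolding theta_term_def x
    by (simp add: norm_mult norm_power_int c_def flip: of_real_power)
  also have "\<dots> = exp (x * Re z - c * x\<^sup>2)" by (simp flip: exp_add)
  also have "\<dots> \<le> exp (((R + 1)\<^sup>2 / (4 * c) + 1/2) - of_int \<bar>m\<bar>)"
  proof -
    have "\<bar>x * Re z\<bar> \<le> \<bar>x\<bar> * R"
      unfolding abs_mult by (intro mult_left_mono order_trans[OF abs_Re_le_cmod z]) auto
    moreover have "\<bar>x\<bar> * R - c * x\<^sup>2 \<le> (R + 1)\<^sup>2 / (4 * c) - \<bar>x\<bar>"
    proof -
      have "0 \<le> (2 * c * \<bar>x\<bar> - (R + 1))\<^sup>2" by simp
      also have "\<dots> = 4 * c * ((R + 1)\<^sup>2 / (4 * c) - \<bar>x\<bar> - (\<bar>x\<bar> * R - c * x\<^sup>2))"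
        using c by (simp add: field_simps power2_eq_square)
      finally show ?thesis using c by (simp add: zero_le_mult_iff)
    qed
    moreover have "of_int \<bar>m\<bar> \<le> \<bar>x\<bar> + 1/2" by (auto simp: x_def)
    ultimately show ?thesis by simp
  qed
  also have "exp (((R + 1)\<^sup>2 / (4 * c) + 1/2) - of_int \<bar>m\<bar>)
      = exp ((R + 1)\<^sup>2 / (4 * c) + 1/2) * exp (-1) ^ nat \<bar>m\<bar>"
  proof -
    have "exp (-1) ^ nat \<bar>m\<bar> = exp (- real_of_int \<bar>m\<bar>)" by (simp flip: exp_of_nat_mult)
    then show ?thesis by (simp flip: exp_add)
  qed
  finally show ?thesis by (simp add: c_def)
qed

lemma theta_term_locally_absolutely_convergent:
  assumes "Im \<tau> > 0"
  shows "locally_absolutely_convergent_on (theta_term \<tau>) UNIV"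
  unfolding locally_absolutely_convergent_on_def
proof (intro ballI exI conjI allI)
  fix x u :: complex and k
  show "x \<in> ball 0 (norm x + 1)" by simp
  show "(\<lambda>m. exp ((norm x + 1 + 1)\<^sup>2 / (4 * (pi * Im \<tau>)) + 1/2) * exp (-1) ^ nat \<bar>m\<bar>)
      summable_on (UNIV :: int set)"
    by (intro summable_on_cmult_right summable_on_power_abs_int) auto
  assume "u \<in> ball 0 (norm x + 1) \<inter> UNIV"
  then show "norm (theta_term \<tau> k u)
      \<le> exp ((norm x + 1 + 1)\<^sup>2 / (4 * (pi * Im \<tau>)) + 1/2) * exp (-1) ^ nat \<bar>k\<bar>"
    by (intro norm_theta_term_le assms) auto
qed auto

lemma theta_term_holomorphic: "theta_term \<tau> m holomorphic_on A"
  unfolding theta_term_def by (intro holomorphic_intros)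

lemma theta_term_summable:
  assumes "Im \<tau> > 0"
  shows "(\<lambda>m. theta_term \<tau> m z) summable_on UNIV"
  using locally_absolutely_convergent_on_summable[OF theta_term_locally_absolutely_convergent[OF assms]]
  by simp

lemma theta_num_holomorphic:
  assumes "Im \<tau> > 0"
  shows "theta_num \<tau> holomorphic_on A"
proof -
  have "theta_num \<tau> holomorphic_on UNIV"
    unfolding theta_num_def
    by (rule locally_absolutely_convergent_on_holomorphic[OF theta_term_locally_absolutely_convergent[OF assms]])
       (auto intro: theta_term_holomorphic)
  then show ?thesis by (rule holomorphic_on_subset) simp
qed

lemma deriv_theta_num_0:
  assumes "Im \<tau> > 0"
  shows "deriv (theta_num \<tau>) 0 = theta_den \<tau>"
proof -
  have "deriv (theta_term \<tau> m) 0 = (-1) powi m * (of_int m + 1/2)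
      * exp (of_real pi * \<i> * \<tau> * (of_int m + 1/2)\<^sup>2)" for m
    unfolding theta_term_def by (rule DERIV_imp_deriv) (auto intro!: derivative_eq_intros)
  moreover have "((\<lambda>m. (deriv ^^ 1) (theta_term \<tau> m) 0) has_sum (deriv ^^ 1) (theta_num \<tau>) 0) UNIV"
    unfolding theta_num_def
    by (rule higher_deriv_sum_series[OF theta_term_locally_absolutely_convergent[OF assms]])
       (auto intro: theta_term_holomorphic)
  ultimately show ?thesis unfolding theta_den_def by (simp add: infsumI)
qed

lemma theta_term_uminus: "theta_term \<tau> (- m - 1) z = - theta_term \<tau> m (- z)"
proof -
  have "(-1) powi (- m - 1) = - ((-1) powi m :: complex)"
    by (auto simp: power_int_minus_left)
  moreover have "of_int (- m - 1) + 1/2 = - (of_int m + 1/2 :: complex)" by simp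
  ultimately show ?thesis unfolding theta_term_def
    by (simp only: power2_minus mult_minus_left mult_minus_right)
qed

lemma theta_num_uminus: "theta_num \<tau> (- z) = - theta_num \<tau> z"
proof -
  have "bij_betw (\<lambda>m::int. - m - 1) UNIV UNIV"
    by (rule bij_betwI[where g = "\<lambda>m. - m - 1"]) auto
  from infsum_reindex_bij_betw[OF this, of "\<lambda>m. theta_term \<tau> m z"]
  have "- (\<Sum>\<^sub>\<infinity>m. theta_term \<tau> m (- z)) = (\<Sum>\<^sub>\<infinity>m. theta_term \<tau> m z)"
    by (simp add: theta_term_uminus infsum_uminus)
  then show ?thesis unfolding theta_num_def by (metis minus_minus)
qed

lemma theta_num_add_2pi: "theta_num \<tau> (z + 2 * of_real pi * \<i>) = - theta_num \<tau> z"
proof -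
  have "exp ((of_int m + 1/2) * (z + 2 * of_real pi * \<i>)) = - exp ((of_int m + 1/2) * z)" for m :: int
  proof -
    have "(of_int m + 1/2) * (z + 2 * of_real pi * \<i>)
      = (of_int m + 1/2) * z + (2 * of_int m * of_real pi * \<i> + of_real pi * \<i>)"
      by (simp add: algebra_simps)
    moreover have "exp (2 * of_int m * of_real pi * \<i> :: complex) = 1"
      using exp_integer_2pi[of "of_int m"] by (simp add: mult_ac)
    ultimately show ?thesis by (simp add: exp_add)
  qed
  then have "theta_term \<tau> m (z + 2 * of_real pi * \<i>) = - theta_term \<tau> m z" for m
    by (simp add: theta_term_def)
  then show ?thesis unfolding theta_num_def by (simp add: infsum_uminus)
qed

text \<open>Since (m + 1/2)^2 + 2 (m + 1/2) = (m + 3/2)^2 - 1, the shift turns each term into its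
  successor up to a common factor; the minus sign is that of (-1)^m.\<close>

lemma theta_num_add_tau:
  "theta_num \<tau> (z + tau_period \<tau>) = - exp (- of_real pi * \<i> * \<tau>) * exp (- z) * theta_num \<tau> z"
proof -
  have "theta_term \<tau> m (z + tau_period \<tau>)
      = - exp (- of_real pi * \<i> * \<tau>) * exp (- z) * theta_term \<tau> (m + 1) z" for m
  proof -
    have "of_real pi * \<i> * \<tau> * (of_int m + 1/2)\<^sup>2 + (of_int m + 1/2) * (z + tau_period \<tau>)
      = - of_real pi * \<i> * \<tau> + (- z) + of_real pi * \<i> * \<tau> * (of_int (m + 1) + 1/2)\<^sup>2
        + (of_int (m + 1) + 1/2) * z"
      by (simp add: algebra_simps power2_eq_square)
    then have "exp (of_real pi * \<i> * \<tau> * (of_int m + 1/2)\<^sup>2) * exp ((of_int m + 1/2) * (z + tau_period \<tau>))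
      = exp (- of_real pi * \<i> * \<tau>) * exp (- z) * (exp (of_real pi * \<i> * \<tau> * (of_int (m + 1) + 1/2)\<^sup>2)
        * exp ((of_int (m + 1) + 1/2) * z))"
      by (simp only: flip: exp_add) (simp add: add_ac)
    moreover have "(-1) powi m = - ((-1) powi (m + 1) :: complex)"
      by (simp add: power_int_add)
    ultimately show ?thesis unfolding theta_term_def by (simp add: mult_ac)
  qed
  moreover have "bij_betw (\<lambda>m::int. m + 1) UNIV UNIV"
    by (rule bij_betwI[where g = "\<lambda>m. m - 1"]) auto
  from infsum_reindex_bij_betw[OF this, of "\<lambda>m. theta_term \<tau> m z"]
  have "(\<Sum>\<^sub>\<infinity>m. theta_term \<tau> (m + 1) z) = theta_num \<tau> z" by (simp add: theta_num_def)
  ultimately show ?thesis unfolding theta_num_def by (simp add: infsum_cmult_right' infsum_uminus)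
qed

text \<open>Otherwise \<open>f(u) = \<Sum>n\<ge>0. (-1)\<^sup>n q^((n+1/2)\<^sup>2/2) u\<^sup>n\<close> would be an entire function with
  \<open>f(u) = f(1/u)/u\<close>, hence tending to \<open>0\<close> at infinity, hence zero, but \<open>f(0) \<noteq> 0\<close>.\<close>

lemma theta_num_nonzero:
  assumes im: "Im \<tau> > 0"
  shows "\<exists>z. theta_num \<tau> z \<noteq> 0"
proof (rule ccontr)
  assume "\<not> ?thesis"
  then have zero: "theta_num \<tau> z = 0" for z by simp
  define c where "c = (\<lambda>n::nat. (-1) ^ n * exp (of_real pi * \<i> * \<tau> * (of_nat n + 1/2)\<^sup>2))"
  define f where "f = (\<lambda>u. \<Sum>\<^sub>\<infinity>n. c n * u ^ n)"
  have term1: "c n * exp z ^ n = exp (- z / 2) * theta_term \<tau> (int n) z" for n z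
  proof -
    have "exp (- z / 2) * exp ((of_nat n + 1/2) * z) = exp (of_nat n * z)"
      by (simp add: algebra_simps flip: exp_add)
    then have "exp (- z / 2) * exp ((of_nat n + 1/2) * z) = exp z ^ n"
      by (simp add: exp_of_nat_mult)
    then show ?thesis by (simp add: c_def theta_term_def mult_ac)
  qed
  have lac: "locally_absolutely_convergent_on (\<lambda>n u. c n * u ^ n) UNIV"
    unfolding locally_absolutely_convergent_on_def
  proof (intro ballI exI conjI allI)
    fix x u :: complex and k
    \<comment> \<open>On the ball |u| is at most exp R, so the nonnegative half of the theta series
      at z = R majorizes the power series.\<close>
    define R where "R = complex_of_real (ln (norm x + 1))"
    have eR: "exp R = complex_of_real (norm x + 1)"
      unfolding R_def exp_of_real by (subst exp_ln) (simp_all add: add_nonneg_pos)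
    show "x \<in> ball 0 (norm x + 1)" by simp
    have "(\<lambda>n. c n * exp R ^ n) summable_on UNIV"
      unfolding term1
      by (intro summable_on_cmult_right infsum_int_split(1)[OF theta_term_summable[OF im]])
    then show "(\<lambda>n. norm (c n * exp R ^ n)) summable_on UNIV"
      by (simp add: summable_on_iff_abs_summable_on_complex)
    assume "u \<in> ball 0 (norm x + 1) \<inter> UNIV"
    then have "norm u \<le> norm (exp R)" unfolding eR by simp
    then show "norm (c k * u ^ k) \<le> norm (c k * exp R ^ k)"
      by (simp add: norm_mult norm_power mult_left_mono power_mono)
  qed auto
  have f: "f holomorphic_on UNIV" unfolding f_def
    by (rule locally_absolutely_convergent_on_holomorphic[OF lac]) (auto intro!: holomorphic_intros)
  \<comment> \<open>For u = exp z the two halves of the theta series are exp (z/2) f(u) and, by the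
    reflection m \<mapsto> -m - 1, -exp (-z/2) f(1/u). Their sum is assumed to vanish.\<close>
  have sym: "f u = f (1 / u) / u" if "u \<noteq> 0" for u
  proof -
    define z where "z = Ln u"
    have z: "u = exp z" "1 / u = exp (- z)" using that by (auto simp: z_def exp_minus inverse_eq_divide)
    have fe: "f (exp w) = exp (- w / 2) * (\<Sum>\<^sub>\<infinity>n. theta_term \<tau> (int n) w)" for w
      unfolding f_def term1 by (rule infsum_cmult_right')
    have "0 = (\<Sum>\<^sub>\<infinity>n. theta_term \<tau> (int n) z) + (\<Sum>\<^sub>\<infinity>n. theta_term \<tau> (- int n - 1) z)"
      using infsum_int_split(3)[OF theta_term_summable[OF im], of z] zero[of z] by (simp add: theta_num_def)
    also have "\<dots> = (\<Sum>\<^sub>\<infinity>n. theta_term \<tau> (int n) z) - (\<Sum>\<^sub>\<infinity>n. theta_term \<tau> (int n) (- z))"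
      by (simp add: theta_term_uminus infsum_uminus)
    finally have "f (exp z) = exp (- z / 2) * (exp (- z / 2) * f (exp (- z)))"
      by (simp add: fe flip: exp_add)
    then show ?thesis
      unfolding z(1) by (simp add: exp_minus inverse_eq_divide flip: exp_add)
  qed
  have "((\<lambda>u. f (inverse u) * inverse u) \<longlongrightarrow> f 0 * 0) at_infinity"
  proof (rule tendsto_mult)
    have "isCont f 0"
      using holomorphic_on_imp_continuous_on[OF f] by (simp add: continuous_on_eq_continuous_at)
    then have "((\<lambda>u. f (inverse u)) \<longlongrightarrow> f 0) at_infinity"
      by (rule isCont_tendsto_compose[OF _ tendsto_inverse_0])
    then show "((\<lambda>u. f (inverse u)) \<longlongrightarrow> f 0) at_infinity" .
  qed (rule tendsto_inverse_0)
  then have "((\<lambda>u. f (inverse u) * inverse u) \<longlongrightarrow> 0) at_infinity" by simp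
  moreover have "\<forall>\<^sub>F u in at_infinity. f (inverse u) * inverse u = f u"
    using eventually_not_equal_at_infinity[of "0::complex"]
  proof eventually_elim
    case (elim u)
    then show ?case using sym[OF elim] by (simp add: divide_inverse)
  qed
  ultimately have "(f \<longlongrightarrow> 0) at_infinity" by (rule Lim_transform_eventually)
  then have "f 0 = 0" using Liouville_weak_0[OF f] by blast
  moreover have "f 0 = (\<Sum>\<^sub>\<infinity>n\<in>{0}. c n)"
    unfolding f_def by (rule infsum_cong_neutral) auto
  ultimately show False by (simp add: c_def)
qed

text \<open>\<open>log_sigma \<tau> z\<close> is minus the logarithm of the product of all \<open>(1 - q\<^sup>n u) (1 - q\<^sup>n / u)\<close>, \<open>n \<ge> 1\<close>,
  expanded as a Lambert series in the strip \<open>|q| < |u| < 1/|q|\<close>. The term with \<open>k = 0\<close> is \<open>0\<close>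
  because \<open>x / 0 = 0\<close>.\<close>

definition log_sigma_term :: "complex \<Rightarrow> nat \<Rightarrow> complex \<Rightarrow> complex" where
  "log_sigma_term \<tau> k z = (exp (of_nat k * z) + exp (- (of_nat k * z))) * (qpar \<tau> ^ k / (of_nat k * (1 - qpar \<tau> ^ k)))"

definition log_sigma :: "complex \<Rightarrow> complex \<Rightarrow> complex" where
  "log_sigma \<tau> z = (\<Sum>\<^sub>\<infinity>k. log_sigma_term \<tau> k z)"

lemma qpar_nontrivial:
  assumes "Im \<tau> > 0" "k > 0"
  shows "norm (qpar \<tau>) < 1" "qpar \<tau> \<noteq> 0" "1 - norm (qpar \<tau>) \<le> norm (1 - qpar \<tau> ^ k)" "qpar \<tau> ^ k \<noteq> 1"
proof -
  show 1: "norm (qpar \<tau>) < 1" using assms by (simp add: norm_qpar)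
  show "qpar \<tau> \<noteq> 0" by (simp add: qpar_def)
  show "1 - norm (qpar \<tau>) \<le> norm (1 - qpar \<tau> ^ k)" "qpar \<tau> ^ k \<noteq> 1"
    by (rule one_minus_power_bound[OF 1 assms(2)])+
qed

lemma norm_log_sigma_term_le:
  assumes im: "Im \<tau> > 0" and r: "\<bar>Re z\<bar> \<le> r"
  shows "norm (log_sigma_term \<tau> k z) \<le> 2 / (1 - norm (qpar \<tau>)) * exp (r - 2 * pi * Im \<tau>) ^ k"
proof (cases "k = 0")
  case False
  let ?q = "qpar \<tau>"
  have q: "norm ?q < 1" "1 - norm ?q \<le> norm (1 - ?q ^ k)" using qpar_nontrivial[OF im, of k] False by auto
  have "\<bar>Re (of_nat k * z)\<bar> \<le> of_nat k * r" using r by (simp add: abs_mult mult_left_mono)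
  then have "norm (exp (of_nat k * z)) \<le> exp (of_nat k * r)" "norm (exp (- (of_nat k * z))) \<le> exp (of_nat k * r)"
    by auto
  then have "norm (exp (of_nat k * z) + exp (- (of_nat k * z))) \<le> 2 * exp (of_nat k * r)"
    using norm_triangle_ineq[of "exp (of_nat k * z)" "exp (- (of_nat k * z))"] by linarith
  moreover have "norm (?q ^ k / (of_nat k * (1 - ?q ^ k))) \<le> norm ?q ^ k / (1 * (1 - norm ?q))"
    unfolding norm_divide norm_mult norm_power using q False by (intro divide_left_mono mult_mono mult_pos_pos divide_mono) (auto simp: mult_pos_pos)
  ultimately have "norm (log_sigma_term \<tau> k z) \<le> 2 * exp (of_nat k * r) * (norm ?q ^ k / (1 * (1 - norm ?q)))"
    unfolding log_sigma_term_def norm_mult[of "exp _ + _"] by (intro mult_mono) auto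
  also have "\<dots> = 2 / (1 - norm ?q) * (exp r * norm ?q) ^ k"
    by (simp add: power_mult_distrib exp_of_nat_mult)
  also have "exp r * norm ?q = exp (r - 2 * pi * Im \<tau>)" by (simp add: norm_qpar flip: exp_add)
  finally show ?thesis .
qed (use qpar_nontrivial(1)[OF im, of 1] in \<open>simp add: log_sigma_term_def\<close>)

lemma open_strip: "open {z. \<bar>Re z\<bar> < W}"
  by (intro open_Collect_less continuous_intros)

lemma log_sigma_locally_absolutely_convergent:
  assumes im: "Im \<tau> > 0"
  shows "locally_absolutely_convergent_on (log_sigma_term \<tau>) {z. \<bar>Re z\<bar> < 2 * pi * Im \<tau>}"
  unfolding locally_absolutely_convergent_on_def
proof (intro ballI exI conjI allI)
  fix x u :: complex and k
  assume x: "x \<in> {z. \<bar>Re z\<bar> < 2 * pi * Im \<tau>}"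
  define r where "r = (\<bar>Re x\<bar> + 2 * pi * Im \<tau>) / 2"
  have r: "\<bar>Re x\<bar> < r" "r < 2 * pi * Im \<tau>" using x by (auto simp: r_def)
  show "open {z. \<bar>Re z\<bar> < r}" by (rule open_strip)
  show "x \<in> {z. \<bar>Re z\<bar> < r}" using r by simp
  show "(\<lambda>k. 2 / (1 - norm (qpar \<tau>)) * exp (r - 2 * pi * Im \<tau>) ^ k) summable_on (UNIV :: nat set)"
    using r by (intro summable_on_cmult_right norm_summable_imp_summable_on)
      (simp add: norm_power summable_geometric)
  assume "u \<in> {z. \<bar>Re z\<bar> < r} \<inter> {z. \<bar>Re z\<bar> < 2 * pi * Im \<tau>}"
  then show "norm (log_sigma_term \<tau> k u) \<le> 2 / (1 - norm (qpar \<tau>)) * exp (r - 2 * pi * Im \<tau>) ^ k"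
    by (intro norm_log_sigma_term_le im) auto
qed

lemma log_sigma_term_holomorphic: "log_sigma_term \<tau> k holomorphic_on A"
  unfolding log_sigma_term_def by (intro holomorphic_intros)

lemma log_sigma_holomorphic:
  assumes "Im \<tau> > 0"
  shows "log_sigma \<tau> holomorphic_on {z. \<bar>Re z\<bar> < 2 * pi * Im \<tau>}"
  unfolding log_sigma_def
  by (rule locally_absolutely_convergent_on_holomorphic
      [OF log_sigma_locally_absolutely_convergent[OF assms] open_strip log_sigma_term_holomorphic])

lemma log_sigma_add_2pi: "log_sigma \<tau> (z + 2 * of_real pi * \<i>) = log_sigma \<tau> z"
proof -
  have *: "exp (of_nat k * (w + 2 * of_real pi * \<i>)) = exp (of_nat k * w)" for k w
  proof -
    have "exp (of_nat k * (w + 2 * of_real pi * \<i>)) = exp (of_nat k * w) * exp (2 * of_nat k * of_real pi * \<i>)"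
      by (simp add: distrib_left exp_add mult_ac)
    also have "exp (2 * of_nat k * of_real pi * \<i>) = (1 :: complex)"
      using exp_integer_2pi[of "of_nat k"] by (simp add: mult_ac)
    finally show ?thesis by simp
  qed
  then show ?thesis by (simp add: log_sigma_def log_sigma_term_def exp_minus)
qed

lemma has_sum_Ln_1_minus:
  fixes x :: complex
  assumes "norm x < 1"
  shows "((\<lambda>k. x ^ k / of_nat k) has_sum (- Ln (1 - x))) UNIV"
proof (rule norm_summable_imp_has_sum)
  have *: "(- (1::complex)) ^ Suc n / of_nat n * (- x) ^ n = - (x ^ n / of_nat n)" for n
    by (simp flip: power_mult_distrib)
  have "(\<lambda>n. (- 1) ^ Suc n / of_nat n * (- x) ^ n) sums ln (1 + (- x))"
    using assms by (intro Ln_series) simp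
  then have "(\<lambda>n. - (x ^ n / of_nat n)) sums Ln (1 - x)"
    unfolding * by simp
  from sums_minus[OF this] show "(\<lambda>n. x ^ n / of_nat n) sums - Ln (1 - x)" by simp
  show "summable (\<lambda>n. norm (x ^ n / of_nat n))"
  proof (rule summable_comparison_test')
    show "summable (\<lambda>n. norm x ^ n)" using assms by (simp add: summable_geometric)
    show "norm (norm (x ^ n / of_nat n)) \<le> norm x ^ n" if "n \<ge> 1" for n
      using that by (simp add: norm_divide norm_power divide_le_eq mult_le_cancel_left1)
  qed
qed

text \<open>In the product, u \<mapsto> q u loses the factor 1 - q u and gains 1 - 1/u. On the
  series side each term changes by (u^(-k) - (q u)^k) / k, and both logarithmic series converge
  because |q u| < 1 < |u|.\<close>

lemma log_sigma_add_tau: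
  assumes im: "Im \<tau> > 0" and z: "0 < Re z" "Re z < 2 * pi * Im \<tau>"
  shows "log_sigma \<tau> (z + tau_period \<tau>)
    = log_sigma \<tau> z + Ln (1 - qpar \<tau> * exp z) - Ln (1 - exp (- z))"
proof -
  let ?p = "tau_period \<tau>" and ?q = "qpar \<tau>"
  have sum: "((\<lambda>k. log_sigma_term \<tau> k w) has_sum log_sigma \<tau> w) UNIV" if "\<bar>Re w\<bar> < 2 * pi * Im \<tau>" for w
    unfolding log_sigma_def
    using locally_absolutely_convergent_on_summable[OF log_sigma_locally_absolutely_convergent[OF im], of w] that
    by (intro has_sum_infsum) auto
  have "norm (?q * exp z) < 1" using z by (simp add: norm_mult norm_qpar flip: exp_add)
  note S1 = has_sum_Ln_1_minus[OF this]
  have "norm (exp (- z)) < 1" using z by simp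
  note S2 = has_sum_Ln_1_minus[OF this]
  have S0: "((\<lambda>k. log_sigma_term \<tau> k z) has_sum log_sigma \<tau> z) UNIV" using z by (intro sum) auto
  have "((\<lambda>k. log_sigma_term \<tau> k z + (- ((?q * exp z) ^ k / of_nat k)) + exp (- z) ^ k / of_nat k) has_sum
      (log_sigma \<tau> z + (- (- Ln (1 - ?q * exp z))) + (- Ln (1 - exp (- z))))) UNIV"
    by (intro has_sum_add has_sum_uminusI S0 S1 S2)
  moreover have "log_sigma_term \<tau> k z + (- ((?q * exp z) ^ k / of_nat k)) + exp (- z) ^ k / of_nat k
      = log_sigma_term \<tau> k (z + ?p)" for k
  proof (cases "k = 0")
    case False
    define E where "E = exp (of_nat k * z)"
    define Q where "Q = ?q ^ k"
    have nz: "E \<noteq> 0" "Q \<noteq> 0" "1 - Q \<noteq> 0" "of_nat k \<noteq> (0::complex)"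
      using qpar_nontrivial[OF im, of k] False by (auto simp: E_def Q_def)
    have e1: "exp (of_nat k * (z + ?p)) = E * Q"
      by (simp add: E_def Q_def qpar_def distrib_left exp_add exp_of_nat_mult)
    then have e: "exp (of_nat k * (z + ?p)) = E * Q" "exp (- (of_nat k * (z + ?p))) = 1 / (E * Q)"
      "exp (- (of_nat k * z)) = 1 / E" "exp (- z) ^ k = 1 / E" "(?q * exp z) ^ k = Q * E"
      by (simp_all add: E_def Q_def exp_minus inverse_eq_divide
          exp_of_nat_mult power_mult_distrib power_divide)
    show ?thesis unfolding log_sigma_term_def e unfolding E_def[symmetric] Q_def[symmetric]
      using nz by (simp add: divide_simps) (simp add: algebra_simps)
  qed (simp add: log_sigma_term_def)
  ultimately have "((\<lambda>k. log_sigma_term \<tau> k (z + ?p)) has_sum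
      (log_sigma \<tau> z + (- (- Ln (1 - ?q * exp z))) + (- Ln (1 - exp (- z))))) UNIV" by simp
  moreover have "((\<lambda>k. log_sigma_term \<tau> k (z + ?p)) has_sum log_sigma \<tau> (z + ?p)) UNIV"
    using z by (intro sum) auto
  ultimately show ?thesis by (auto dest: has_sum_unique)
qed

lemma exp_half_diff: "exp (z / 2) - exp (- z / 2) = exp (- z / 2) * (exp z - 1 :: complex)"
  by (simp add: algebra_simps flip: exp_add)

lemma theta_num_eq_0: "exp z = 1 \<Longrightarrow> theta_num \<tau> z = 0"
proof -
  assume "exp z = 1"
  then have "(theta_num \<tau> z = 0) = (theta_num \<tau> 0 = 0)"
    using exp_eq_imp_periodic_eq[of "\<lambda>z. theta_num \<tau> z = 0" z 0] by (simp add: theta_num_add_2pi)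
  moreover have "theta_num \<tau> 0 = 0" using theta_num_uminus[of \<tau> 0] by simp
  ultimately show ?thesis by simp
qed

text \<open>Jacobi's triple product up to a constant. Both sides have the same multipliers under the
  two periods, so Liouville's theorem on the strip, with additive constant 0, makes the quotient
  constant. The value of C can stay unknown because \<open>theta_den\<close> cancels it.\<close>

lemma theta_num_eq_sigma:
  assumes im: "Im \<tau> > 0"
  obtains C where "C \<noteq> 0" "\<And>z. \<bar>Re z\<bar> < 2 * pi * Im \<tau> \<Longrightarrow>
    theta_num \<tau> z = C * ((exp (z / 2) - exp (- z / 2)) * exp (- log_sigma \<tau> z))"
proof -
  define W where "W = 2 * pi * Im \<tau>"
  have W: "W > 0" using im by (simp add: W_def)
  define s where "s = (\<lambda>z. (exp (z / 2) - exp (- z / 2)) * exp (- log_sigma \<tau> z))"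
  have s0: "s z = 0 \<longleftrightarrow> exp z = 1" for z unfolding s_def exp_half_diff by simp
  have hols: "s holomorphic_on {z. \<bar>Re z\<bar> < W}"
    unfolding s_def W_def by (intro holomorphic_intros log_sigma_holomorphic im) auto
  have half: "exp ((z + 2 * of_real pi * \<i>) / 2) = - exp (z / 2)"
    "exp (- (z + 2 * of_real pi * \<i>) / 2) = - exp (- z / 2)" for z :: complex
    by (simp_all add: add_divide_distrib diff_divide_distrib exp_add exp_diff)
  have 1: "(\<lambda>z. theta_num \<tau> z / s z) holomorphic_on {z. \<bar>Re z\<bar> < 2 * pi * Im \<tau> \<and> exp z \<noteq> 1}"
    by (intro holomorphic_on_divide theta_num_holomorphic im holomorphic_on_subset[OF hols])
       (auto simp: s0 W_def)
  have 2: "theta_num \<tau> (z + 2 * of_real pi * \<i>) / s (z + 2 * of_real pi * \<i>) = theta_num \<tau> z / s z" for z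
  proof -
    have "s (z + 2 * of_real pi * \<i>) = - s z"
      unfolding s_def half log_sigma_add_2pi by (simp add: algebra_simps)
    then show ?thesis by (simp add: theta_num_add_2pi)
  qed
  have ds: "(s has_field_derivative exp (- log_sigma \<tau> 0)) (at 0)"
  proof -
    have "(log_sigma \<tau> has_field_derivative deriv (log_sigma \<tau>) 0) (at 0)"
      using W by (intro holomorphic_derivI[OF log_sigma_holomorphic[OF im] open_strip]) (simp add: W_def)
    then show ?thesis unfolding s_def
      by (auto intro!: derivative_eq_intros)
  qed
  \<comment> \<open>The numerator vanishes at 0 and \<open>s\<close> has a simple zero there, so
    dividing by s(z)/z instead of s(z) gives the limit 0.\<close>
  have 3: "((\<lambda>z. z * (theta_num \<tau> z / s z)) \<longlongrightarrow> 0) (at 0)"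
  proof -
    have "((\<lambda>z. (s z - s 0) / (z - 0)) \<longlongrightarrow> exp (- log_sigma \<tau> 0)) (at 0)"
      using ds by (simp add: has_field_derivative_iff)
    then have "((\<lambda>z. inverse (s z / z)) \<longlongrightarrow> inverse (exp (- log_sigma \<tau> 0))) (at 0)"
      using s0[of 0] by (intro tendsto_inverse) simp_all
    moreover have "(theta_num \<tau> \<longlongrightarrow> theta_num \<tau> 0) (at 0)"
      using holomorphic_on_imp_continuous_on[OF theta_num_holomorphic[OF im, of UNIV]]
      by (simp add: continuous_on_eq_continuous_at isCont_def)
    ultimately have "((\<lambda>z. theta_num \<tau> z * inverse (s z / z)) \<longlongrightarrow> theta_num \<tau> 0 * inverse (exp (- log_sigma \<tau> 0))) (at 0)"
      by (intro tendsto_mult)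
    then show ?thesis by (simp add: theta_num_eq_0 field_simps)
  qed
  have 4: "theta_num \<tau> (z + tau_period \<tau>) / s (z + tau_period \<tau>) = theta_num \<tau> z / s z + 0"
    if z: "0 < Re z" "Re z < 2 * pi * Im \<tau>" for z
  proof -
    let ?p = "tau_period \<tau>"
    have nz: "1 - qpar \<tau> * exp z \<noteq> 0" "1 - exp (- z) \<noteq> 0"
    proof -
      have a: "norm (qpar \<tau> * exp z) < 1" using z by (simp add: norm_mult norm_qpar flip: exp_add)
      have b: "norm (exp (- z)) < 1" using z by simp
      show "1 - qpar \<tau> * exp z \<noteq> 0" "1 - exp (- z) \<noteq> 0"
        using a b by (metis eq_iff_diff_eq_0 norm_one less_irrefl)+
    qed
    have a: "exp ((z + ?p) / 2) - exp (- (z + ?p) / 2)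
        = - exp (- z / 2) * exp (- of_real pi * \<i> * \<tau>) * (1 - qpar \<tau> * exp z)"
    proof -
      have "exp (- (z + ?p) / 2) = exp (- z / 2) * exp (- of_real pi * \<i> * \<tau>)"
        by (simp add: add_divide_distrib diff_divide_distrib algebra_simps flip: exp_add)
      moreover have "exp (z + ?p) = qpar \<tau> * exp z" by (simp add: qpar_def exp_add)
      ultimately show ?thesis unfolding exp_half_diff by (simp add: algebra_simps)
    qed
    have b: "exp (- log_sigma \<tau> (z + ?p)) = exp (- log_sigma \<tau> z) * (1 - exp (- z)) / (1 - qpar \<tau> * exp z)"
      unfolding log_sigma_add_tau[OF im z] using nz by (simp add: exp_add exp_diff exp_minus field_simps)
    have "s (z + ?p) = - exp (- of_real pi * \<i> * \<tau>) * (exp (- z / 2) * (1 - exp (- z))) * exp (- log_sigma \<tau> z)"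
      unfolding s_def a b using nz by simp
    also have "exp (- z / 2) * (1 - exp (- z)) = exp (- z) * (exp (z / 2) - exp (- z / 2))"
      by (simp add: algebra_simps flip: exp_add)
    finally have "s (z + ?p) = - exp (- of_real pi * \<i> * \<tau>) * exp (- z) * s z"
      by (simp add: s_def)
    then show ?thesis by (simp add: theta_num_add_tau)
  qed
  obtain C where C: "\<And>z. \<bar>Re z\<bar> < W \<Longrightarrow> exp z \<noteq> 1 \<Longrightarrow> theta_num \<tau> z / s z = C"
    using strip_additive_const[OF im 1 2 3 4] unfolding W_def by blast
  have eq: "theta_num \<tau> z = C * s z" if "\<bar>Re z\<bar> < W" for z
    using C[OF that] s0[of z] theta_num_eq_0[of z \<tau>] by (cases "exp z = 1") (auto simp: field_simps)
  have "C \<noteq> 0"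
  proof
    assume "C = 0"
    then have z: "theta_num \<tau> z = 0" if "z \<in> {z. \<bar>Re z\<bar> < W}" for z using eq that by simp
    have "theta_num \<tau> z = 0" for z
      by (rule analytic_continuation_open[OF open_strip[of W] open_UNIV _ connected_UNIV _ theta_num_holomorphic[OF im] _ z])
         (use W in \<open>auto intro!: exI[of _ 0]\<close>)
    then show False using theta_num_nonzero[OF im] by blast
  qed
  then show ?thesis using that eq unfolding s_def W_def by blast
qed

text \<open>Comparing derivatives at 0 in the product formula gives \<open>theta_den\<close> = C exp
  (- \<open>log_sigma \<tau> 0\<close>). It is therefore nonzero, and C cancels from the normalized
  \<theta>.\<close>

lemma
  assumes im: "Im \<tau> > 0"
  shows theta_den_nonzero: "theta_den \<tau> \<noteq> 0"
    and theta_eq_log_sigma: "\<bar>Re z\<bar> < 2 * pi * Im \<tau> \<Longrightarrow>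
      theta \<tau> z = (exp (z / 2) - exp (- z / 2)) * exp (log_sigma \<tau> 0 - log_sigma \<tau> z)"
proof -
  obtain C where C: "C \<noteq> 0" "\<And>z. \<bar>Re z\<bar> < 2 * pi * Im \<tau> \<Longrightarrow>
      theta_num \<tau> z = C * ((exp (z / 2) - exp (- z / 2)) * exp (- log_sigma \<tau> z))"
    using theta_num_eq_sigma[OF im] by blast
  have "(log_sigma \<tau> has_field_derivative deriv (log_sigma \<tau>) 0) (at 0)"
    using im by (intro holomorphic_derivI[OF log_sigma_holomorphic[OF im] open_strip]) simp
  then have "((\<lambda>z. C * ((exp (z / 2) - exp (- z / 2)) * exp (- log_sigma \<tau> z)))
      has_field_derivative C * exp (- log_sigma \<tau> 0)) (at 0)"
    by (auto intro!: derivative_eq_intros)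
  then have "(theta_num \<tau> has_field_derivative C * exp (- log_sigma \<tau> 0)) (at 0)"
    by (rule has_field_derivative_transform_within_open[OF _ open_strip[of "2 * pi * Im \<tau>"]]) (use im C in auto)
  then have den: "theta_den \<tau> = C * exp (- log_sigma \<tau> 0)"
    using deriv_theta_num_0[OF im] DERIV_imp_deriv by metis
  then show "theta_den \<tau> \<noteq> 0" using C by simp
  show "theta \<tau> z = (exp (z / 2) - exp (- z / 2)) * exp (log_sigma \<tau> 0 - log_sigma \<tau> z)"
    if "\<bar>Re z\<bar> < 2 * pi * Im \<tau>"
    unfolding theta_eq_quotient den C(2)[OF that] using C(1) by (simp add: exp_diff exp_minus field_simps)
qed

section \<open>Symmetries, quasi-periods and zeros of the normalized theta function\<close>

lemma theta_holomorphic: "Im \<tau> > 0 \<Longrightarrow> theta \<tau> holomorphic_on A"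
  unfolding theta_eq_quotient[abs_def]
  by (intro holomorphic_intros theta_num_holomorphic theta_den_nonzero)

lemma theta_uminus: "theta \<tau> (- z) = - theta \<tau> z"
  by (simp add: theta_eq_quotient theta_num_uminus)

lemma theta_0 [simp]: "theta \<tau> 0 = 0"
  using theta_uminus[of \<tau> 0] by simp

lemma theta_add_2pi: "theta \<tau> (z + 2 * of_real pi * \<i>) = - theta \<tau> z"
  by (simp add: theta_eq_quotient theta_num_add_2pi)

lemma theta_add_tau:
  "theta \<tau> (z + tau_period \<tau>) = - exp (- of_real pi * \<i> * \<tau>) * exp (- z) * theta \<tau> z"
  by (simp add: theta_eq_quotient theta_num_add_tau)

lemma deriv_theta_0: "Im \<tau> > 0 \<Longrightarrow> deriv (theta \<tau>) 0 = 1"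
proof -
  assume im: "Im \<tau> > 0"
  have "(theta_num \<tau> has_field_derivative theta_den \<tau>) (at 0)"
    using holomorphic_derivI[OF theta_num_holomorphic[OF im] open_UNIV, of 0] deriv_theta_num_0[OF im] by simp
  then have "(theta \<tau> has_field_derivative theta_den \<tau> / theta_den \<tau>) (at 0)"
    unfolding theta_eq_quotient[abs_def] by (rule DERIV_cdivide)
  then show ?thesis using theta_den_nonzero[OF im] by (simp add: DERIV_imp_deriv)
qed

text \<open>A translation by a multiple of 2 pi i \<tau> preserves zeros and brings z into the
  strip, where the exponential factor of the product formula has no zeros and only exp z = 1
  remains.\<close>

lemma theta_eq_0_iff:
  assumes im: "Im \<tau> > 0"
  shows "theta \<tau> z = 0 \<longleftrightarrow> z \<in> period_lattice \<tau>"
proof -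
  define W where "W = 2 * pi * Im \<tau>"
  have W: "W > 0" using im by (simp add: W_def)
  let ?p = "tau_period \<tau>"
  \<comment> \<open>The period 2 pi i \<tau> has real part -W, so adding it n times puts the real
    part into [0, W).\<close>
  define n where "n = \<lfloor>Re z / W\<rfloor>"
  define z' where "z' = z + of_int n * ?p"
  have "Re z' = Re z - n * W" by (simp add: z'_def W_def)
  moreover have "n * W \<le> Re z" "Re z < (n + 1) * W"
    using floor_divide_lower[OF W, of "Re z"] floor_divide_upper[OF W, of "Re z"] unfolding n_def by simp_all
  ultimately have z': "\<bar>Re z'\<bar> < W" using W by (auto simp: algebra_simps)
  have "(theta \<tau> z' = 0) = (theta \<tau> z = 0)"
    unfolding z'_def by (rule periodic_int_shift[of "\<lambda>z. theta \<tau> z = 0"]) (simp add: theta_add_tau)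
  moreover have "theta \<tau> z' = 0 \<longleftrightarrow> exp z' = 1"
    using theta_eq_log_sigma[OF im, of z', unfolded exp_half_diff] z' by (simp add: W_def)
  moreover have "exp z' = 1 \<longleftrightarrow> z \<in> period_lattice \<tau>"
  proof
    assume "exp z' = 1"
    then obtain m :: int where "z' = 0 + (of_int (2 * m) * pi) * \<i>" using exp_eq[of z' 0] by auto
    then have "z = period \<tau> m (- n)" by (simp add: z'_def period_def algebra_simps)
    then show "z \<in> period_lattice \<tau>" by (auto simp: period_lattice_def)
  next
    assume "z \<in> period_lattice \<tau>"
    then obtain m k where k: "z = period \<tau> m k" by (auto simp: period_lattice_def)
    then have eq: "z' = 0 + of_int m * (2 * of_real pi * \<i>) + of_int (k + n) * ?p"
      by (simp add: z'_def period_def algebra_simps)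
    have re: "Re (of_int j * w) = of_int j * Re w" for j :: int and w by simp
    have "Re z' = of_int (k + n) * (- W)"
      unfolding eq plus_complex.sel re by (simp add: W_def)
    then have "real_of_int \<bar>k + n\<bar> * W < 1 * W" using z' W by (simp add: abs_mult del: of_int_add)
    then have "real_of_int \<bar>k + n\<bar> < 1" using W by (simp only: mult_less_cancel_right_pos)
    then have "k + n = 0" by linarith
    then have "z' = 0 + (of_int (2 * m) * pi) * \<i>" unfolding eq by simp
    then show "exp z' = 1" using exp_eq[of z' 0] by auto
  qed
  ultimately show ?thesis by simp
qed

lemma exp_in_range_qpar: "Im \<tau> > 0 \<Longrightarrow> exp z \<in> range (\<lambda>m::int. qpar \<tau> powi m) \<longleftrightarrow> z \<in> period_lattice \<tau>"
proof -
  assume im: "Im \<tau> > 0"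
  have q: "qpar \<tau> powi n = exp (tau_period \<tau> * of_int n)" for n
    by (simp add: qpar_def exp_power_int mult_ac)
  show ?thesis
  proof
    assume "exp z \<in> range (\<lambda>m::int. qpar \<tau> powi m)"
    then obtain n where "exp z = exp (tau_period \<tau> * of_int n)" by (auto simp: q)
    then obtain m :: int where "z = tau_period \<tau> * of_int n + (of_int (2 * m) * pi) * \<i>"
      unfolding exp_eq by auto
    then have "z = period \<tau> m n" by (simp add: period_def)
    then show "z \<in> period_lattice \<tau>" by (auto simp: period_lattice_def)
  next
    assume "z \<in> period_lattice \<tau>"
    then obtain m n where z: "z = period \<tau> m n" by (auto simp: period_lattice_def)
    have "exp z = qpar \<tau> powi n"
      unfolding q exp_eq by (rule exI[of _ m]) (simp add: z period_def)
    then show "exp z \<in> range (\<lambda>m::int. qpar \<tau> powi m)" by blast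
  qed
qed

section \<open>Derivatives of theta from the product formula\<close>

lemma deriv_log_sigma:
  assumes im: "Im \<tau> > 0" and z: "\<bar>Re z\<bar> < 2 * pi * Im \<tau>"
  shows "((\<lambda>k. (exp (of_nat k * z) - exp (- (of_nat k * z))) * (qpar \<tau> ^ k / (1 - qpar \<tau> ^ k)))
    has_sum deriv (log_sigma \<tau>) z) UNIV"
proof -
  have "deriv (log_sigma_term \<tau> k) z
      = (exp (of_nat k * z) - exp (- (of_nat k * z))) * (qpar \<tau> ^ k / (1 - qpar \<tau> ^ k))" for k
  proof (rule DERIV_imp_deriv)
    have "(log_sigma_term \<tau> k has_field_derivative
        (of_nat k * exp (of_nat k * z) - of_nat k * exp (- (of_nat k * z))) * (qpar \<tau> ^ k / (of_nat k * (1 - qpar \<tau> ^ k)))) (at z)"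
      unfolding log_sigma_term_def by (rule derivative_eq_intros refl | simp)+
    then show "(log_sigma_term \<tau> k has_field_derivative
        (exp (of_nat k * z) - exp (- (of_nat k * z))) * (qpar \<tau> ^ k / (1 - qpar \<tau> ^ k))) (at z)"
      by (cases "k = 0") (simp_all flip: right_diff_distrib)
  qed
  moreover have "((\<lambda>k. (deriv ^^ 1) (log_sigma_term \<tau> k) z) has_sum (deriv ^^ 1) (log_sigma \<tau>) z) UNIV"
    unfolding log_sigma_def
    by (rule higher_deriv_sum_series[OF log_sigma_locally_absolutely_convergent[OF im] open_strip])
       (use z in \<open>auto intro: log_sigma_term_holomorphic\<close>)
  ultimately show ?thesis by simp
qed

lemma deriv2_log_sigma_0:
  assumes im: "Im \<tau> > 0"
  shows "((\<lambda>k. 2 * of_nat k * (qpar \<tau> ^ k / (1 - qpar \<tau> ^ k))) has_sum deriv (deriv (log_sigma \<tau>)) 0) UNIV"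
proof -
  have d: "deriv (log_sigma_term \<tau> k) = (\<lambda>z. (of_nat k * exp (of_nat k * z) - of_nat k * exp (- (of_nat k * z))) * (qpar \<tau> ^ k / (of_nat k * (1 - qpar \<tau> ^ k))))" for k
    unfolding log_sigma_term_def
    by (intro ext DERIV_imp_deriv) (rule derivative_eq_intros refl | simp)+
  have "deriv (deriv (log_sigma_term \<tau> k)) 0 = 2 * of_nat k * (qpar \<tau> ^ k / (1 - qpar \<tau> ^ k))" for k
  proof (rule DERIV_imp_deriv)
    have "(deriv (log_sigma_term \<tau> k) has_field_derivative
        (of_nat k * of_nat k + of_nat k * of_nat k) * (qpar \<tau> ^ k / (of_nat k * (1 - qpar \<tau> ^ k)))) (at 0)"
      unfolding d by (rule derivative_eq_intros refl | simp)+
    then show "(deriv (log_sigma_term \<tau> k) has_field_derivative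
        2 * of_nat k * (qpar \<tau> ^ k / (1 - qpar \<tau> ^ k))) (at 0)"
      by (cases "k = 0") (simp_all add: mult_ac flip: distrib_left)
  qed
  moreover have "((\<lambda>k. (deriv ^^ 2) (log_sigma_term \<tau> k) 0) has_sum (deriv ^^ 2) (log_sigma \<tau>) 0) UNIV"
    unfolding log_sigma_def
    by (rule higher_deriv_sum_series[OF log_sigma_locally_absolutely_convergent[OF im] open_strip])
       (use im in \<open>auto intro: log_sigma_term_holomorphic\<close>)
  ultimately show ?thesis by (simp add: numeral_2_eq_2)
qed

lemma deriv_theta_strip:
  assumes im: "Im \<tau> > 0" and z: "\<bar>Re z\<bar> < 2 * pi * Im \<tau>"
  shows "deriv (theta \<tau>) z = ((exp (z / 2) + exp (- z / 2)) / 2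
    - deriv (log_sigma \<tau>) z * (exp (z / 2) - exp (- z / 2))) * exp (log_sigma \<tau> 0 - log_sigma \<tau> z)"
proof -
  have "(log_sigma \<tau> has_field_derivative deriv (log_sigma \<tau>) z) (at z)"
    using z by (intro holomorphic_derivI[OF log_sigma_holomorphic[OF im] open_strip]) simp
  then have "((\<lambda>z. (exp (z / 2) - exp (- z / 2)) * exp (log_sigma \<tau> 0 - log_sigma \<tau> z)) has_field_derivative
      ((exp (z / 2) + exp (- z / 2)) / 2 - deriv (log_sigma \<tau>) z * (exp (z / 2) - exp (- z / 2)))
      * exp (log_sigma \<tau> 0 - log_sigma \<tau> z)) (at z)"
    by (auto intro!: derivative_eq_intros simp: algebra_simps)
  then have "(theta \<tau> has_field_derivative
      ((exp (z / 2) + exp (- z / 2)) / 2 - deriv (log_sigma \<tau>) z * (exp (z / 2) - exp (- z / 2)))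
      * exp (log_sigma \<tau> 0 - log_sigma \<tau> z)) (at z)"
    by (rule has_field_derivative_transform_within_open[OF _ open_strip[of "2 * pi * Im \<tau>"]])
       (use z theta_eq_log_sigma[OF im] in auto)
  then show ?thesis by (rule DERIV_imp_deriv)
qed

text \<open>The rational function of exp z is the logarithmic derivative of exp (z/2) - exp (-z/2),
  the rest that of the infinite product. This identity links \<theta> to the Lambert series with j =
  0.\<close>

lemma theta_log_deriv:
  assumes im: "Im \<tau> > 0" and z: "\<bar>Re z\<bar> < 2 * pi * Im \<tau>" "exp z \<noteq> 1"
  shows "theta_quot 1 \<tau> z = (exp z + 1) / (2 * (exp z - 1)) - deriv (log_sigma \<tau>) z"
proof -
  have e: "exp (z / 2) + exp (- z / 2) = exp (- z / 2) * (exp z + 1)"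
    by (simp add: algebra_simps flip: exp_add)
  have nz: "exp z - 1 \<noteq> 0" using z by simp
  have "theta_quot 1 \<tau> z = ((x * (exp z + 1)) / 2 - D * (x * (exp z - 1))) * y / (x * (exp z - 1) * y)"
    if "x = exp (- z / 2)" "y = exp (log_sigma \<tau> 0 - log_sigma \<tau> z)" "D = deriv (log_sigma \<tau>) z" for x y D
    unfolding theta_quot_def that
    by (simp only: funpow.simps(2) One_nat_def o_apply funpow_0 deriv_theta_strip[OF im z(1)]
        theta_eq_log_sigma[OF im z(1)] exp_half_diff e)
  from this[OF refl refl refl] have "theta_quot 1 \<tau> z = ((exp (- z / 2) * (exp z + 1)) / 2
      - deriv (log_sigma \<tau>) z * (exp (- z / 2) * (exp z - 1))) * exp (log_sigma \<tau> 0 - log_sigma \<tau> z)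
      / (exp (- z / 2) * (exp z - 1) * exp (log_sigma \<tau> 0 - log_sigma \<tau> z))" .
  moreover have "((x * (exp z + 1)) / 2 - D * (x * (exp z - 1))) * y / (x * (exp z - 1) * y) = (exp z + 1) / (2 * (exp z - 1)) - D"
    if "x \<noteq> 0" "y \<noteq> 0" for x y D
    using nz that by (simp add: divide_simps) (simp add: algebra_simps)
  ultimately show ?thesis by (metis exp_not_eq_zero)
qed

text \<open>Write \<theta> = s E with s = 2 sinh (z/2) and E = exp (M(0) - M(z)). As M'(0) = 0, only
  s'''(0) = 1/4 and 3 s'(0) E''(0) = -3 M''(0) survive at 0.\<close>

lemma deriv3_theta_0:
  assumes im: "Im \<tau> > 0"
  shows "(deriv ^^ 3) (theta \<tau>) 0 = 1 / 4 - 3 * deriv (deriv (log_sigma \<tau>)) 0"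
proof -
  define S where "S = {z. \<bar>Re z\<bar> < 2 * pi * Im \<tau>}"
  have S: "open S" "0 \<in> S" using im by (auto simp: S_def open_strip)
  define M where "M = log_sigma \<tau>"
  define s where "s = (\<lambda>z::complex. exp (z / 2) - exp (- z / 2))"
  define h where "h = (\<lambda>z::complex. (exp (z / 2) + exp (- z / 2)) / 2)"
  define E where "E = (\<lambda>z. exp (M 0 - M z))"
  have M: "M holomorphic_on S" using log_sigma_holomorphic[OF im] by (simp add: M_def S_def)
  have M': "deriv M holomorphic_on S" by (intro holomorphic_deriv M S)
  have M'': "deriv (deriv M) holomorphic_on S" by (intro holomorphic_deriv M' S)
  note dM = holomorphic_derivI[OF M S(1)] holomorphic_derivI[OF M' S(1)] holomorphic_derivI[OF M'' S(1)]
  have ds: "(s has_field_derivative h z) (at z)" and dh: "(h has_field_derivative s z / 4) (at z)" for z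
    unfolding s_def h_def by (rule derivative_eq_intros refl | simp)+
  have dE: "(E has_field_derivative - deriv M z * E z) (at z)" if "z \<in> S" for z
    unfolding E_def using dM(1)[OF that] by (auto intro!: derivative_eq_intros)
  have M0: "deriv M 0 = 0"
    using has_sum_unique[OF deriv_log_sigma[OF im, of 0]] im unfolding M_def by (simp add: has_sum_0)
  have d1: "deriv (theta \<tau>) z = (h z - deriv M z * s z) * E z" if "z \<in> S" for z
    using deriv_theta_strip[OF im, of z] that by (simp add: h_def s_def E_def M_def S_def)
  define F where "F = (\<lambda>z. (s z / 4 - 2 * deriv M z * h z - deriv (deriv M) z * s z + deriv M z ^ 2 * s z) * E z)"
  have d2: "deriv (deriv (theta \<tau>)) z = F z" if z: "z \<in> S" for z
  proof -
    have "((\<lambda>z. (h z - deriv M z * s z) * E z) has_field_derivative F z) (at z)"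
      unfolding F_def
      by (rule derivative_eq_intros refl ds dh dE[OF z] dM(2)[OF z])+ (simp add: algebra_simps power2_eq_square)
    then have "(deriv (theta \<tau>) has_field_derivative F z) (at z)"
      by (rule has_field_derivative_transform_within_open[OF _ S(1) z]) (simp add: d1)
    then show ?thesis by (rule DERIV_imp_deriv)
  qed
  have "(F has_field_derivative 1 / 4 - 3 * deriv (deriv M) 0) (at 0)"
    unfolding F_def power2_eq_square
    by (rule derivative_eq_intros refl zero_neq_numeral[THEN not_sym] ds dh dE[OF S(2)] dM(2)[OF S(2)] dM(3)[OF S(2)])+
       (simp add: M0 s_def h_def E_def)
  then have "(deriv (deriv (theta \<tau>)) has_field_derivative 1 / 4 - 3 * deriv (deriv M) 0) (at 0)"
    by (rule has_field_derivative_transform_within_open[OF _ S]) (simp add: d2)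
  then show ?thesis using DERIV_imp_deriv by (simp add: numeral_3_eq_3 M_def)
qed

section \<open>Taylor expansion of the Kronecker function\<close>

lemma fps_expansion_unique_shift:
  assumes "f analytic_on {z}" "(\<lambda>w. f (z + w)) has_fps_expansion F"
  shows "fps_expansion f z = F"
  using analytic_at_imp_has_fps_expansion[OF assms(1)] assms(2) fps_expansion_unique_complex by blast

lemma theta_analytic: "Im \<tau> > 0 \<Longrightarrow> theta \<tau> analytic_on A"
  using theta_holomorphic[of \<tau> UNIV] analytic_on_open[of UNIV "theta \<tau>"] analytic_on_subset by blast

abbreviation theta_fps :: "complex \<Rightarrow> complex \<Rightarrow> complex fps" where
  "theta_fps \<tau> \<equiv> fps_expansion (theta \<tau>)"

lemma theta_has_fps_expansion:
  "Im \<tau> > 0 \<Longrightarrow> (\<lambda>w. theta \<tau> (z + w)) has_fps_expansion theta_fps \<tau> z"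
  by (intro analytic_at_imp_has_fps_expansion theta_analytic)

text \<open>The factor exp (-(z + w)) splits into the scalar exp (-z) and the power series exp (-w),
  so all Taylor coefficients are shifted at once.\<close>

lemma fps_expansion_theta_add_tau:
  assumes im: "Im \<tau> > 0"
  shows "theta_fps \<tau> (z + tau_period \<tau>)
    = fps_const (- exp (- of_real pi * \<i> * \<tau>) * exp (- z)) * (fps_exp (- 1) * theta_fps \<tau> z)"
    (is "_ = fps_const ?c * ?F")
proof (rule fps_expansion_unique_shift[OF theta_analytic[OF im]])
  have "(\<lambda>w. ?c * (exp ((- 1) * w) * theta \<tau> (z + w)))
    has_fps_expansion fps_const ?c * ?F"
    by (intro has_fps_expansion_cmult_left has_fps_expansion_mult has_fps_expansion_exp theta_has_fps_expansion im)
  also have "(\<lambda>w. ?c * (exp ((- 1) * w) * theta \<tau> (z + w)))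
    = (\<lambda>w. theta \<tau> (z + tau_period \<tau> + w))"
  proof
    fix w
    show "?c * (exp ((- 1) * w) * theta \<tau> (z + w))
      = theta \<tau> (z + tau_period \<tau> + w)"
      using theta_add_tau[of \<tau> "z + w"] by (simp add: add_ac exp_diff exp_minus field_simps)
  qed
  finally show "(\<lambda>w. theta \<tau> (z + tau_period \<tau> + w)) has_fps_expansion
    fps_const ?c * ?F" .
qed

lemma fps_expansion_theta_add_2pi:
  assumes im: "Im \<tau> > 0"
  shows "theta_fps \<tau> (z + 2 * of_real pi * \<i>) = - theta_fps \<tau> z"
proof (rule fps_expansion_unique_shift[OF theta_analytic[OF im]])
  have "(\<lambda>w. - theta \<tau> (z + w)) = (\<lambda>w. theta \<tau> (z + 2 * of_real pi * \<i> + w))"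
    using theta_add_2pi[of \<tau> "z + _"] by (simp add: add_ac)
  then show "(\<lambda>w. theta \<tau> (z + 2 * of_real pi * \<i> + w)) has_fps_expansion - theta_fps \<tau> z"
    using has_fps_expansion_minus[OF theta_has_fps_expansion[OF im, of z]] by simp
qed

text \<open>The expansion of w / \<theta>(w) at w = 0.\<close>

definition theta_recip_fps :: "complex \<Rightarrow> complex fps" where
  "theta_recip_fps \<tau> = inverse (fps_shift 1 (theta_fps \<tau> 0))"

text \<open>The expansion in \<open>w\<close> of \<open>w\<close> times the Kronecker function \<open>\<theta>(z + w) / (\<theta>(z) \<theta>(w))\<close>.\<close>

definition kronecker_fps :: "complex \<Rightarrow> complex \<Rightarrow> complex fps" where
  "kronecker_fps \<tau> z = fps_const (1 / theta \<tau> z) * (theta_fps \<tau> z * theta_recip_fps \<tau>)"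

lemma fps_X_times_shift_1: "f $ 0 = 0 \<Longrightarrow> fps_X * fps_shift 1 f = f"
  for f :: "'a::comm_ring_1 fps"
  by (simp add: fps_eq_iff)

lemma theta_fps_at_0:
  assumes "Im \<tau> > 0"
  shows "theta_fps \<tau> 0 $ 0 = 0" "theta_fps \<tau> 0 $ 1 = 1"
    "theta_fps \<tau> 0 * theta_recip_fps \<tau> = fps_X" "theta_recip_fps \<tau> $ 0 = 1"
proof -
  show 0: "theta_fps \<tau> 0 $ 0 = 0" and 1: "theta_fps \<tau> 0 $ 1 = 1"
    using deriv_theta_0[OF assms] by (simp_all add: fps_expansion_def)
  have "fps_X * fps_shift 1 (theta_fps \<tau> 0) = theta_fps \<tau> 0"
    by (rule fps_X_times_shift_1[OF 0])
  moreover have "fps_shift 1 (theta_fps \<tau> 0) * inverse (fps_shift 1 (theta_fps \<tau> 0)) = 1"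
    by (rule inverse_mult_eq_1') (use 1 in simp)
  ultimately show "theta_fps \<tau> 0 * theta_recip_fps \<tau> = fps_X"
    unfolding theta_recip_fps_def by (metis mult.assoc mult_1_right)
  show "theta_recip_fps \<tau> $ 0 = 1" using 1 by (simp add: theta_recip_fps_def)
qed

lemma kronecker_fps_0: "Im \<tau> > 0 \<Longrightarrow> z \<notin> period_lattice \<tau> \<Longrightarrow> kronecker_fps \<tau> z $ 0 = 1"
  using theta_fps_at_0[of \<tau>] theta_eq_0_iff[of \<tau> z] by (simp add: kronecker_fps_def fps_expansion_def)

lemma kronecker_fps_add_2pi:
  "Im \<tau> > 0 \<Longrightarrow> kronecker_fps \<tau> (z + 2 * of_real pi * \<i>) = kronecker_fps \<tau> z"
  by (simp add: kronecker_fps_def fps_expansion_theta_add_2pi theta_add_2pi fps_eq_iff)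

text \<open>The scalar multipliers of \<theta>(z + w) and \<theta>(z) cancel; only the part exp (-w)
  survives.\<close>

lemma kronecker_fps_add_tau:
  assumes "Im \<tau> > 0"
  shows "kronecker_fps \<tau> (z + tau_period \<tau>) = fps_exp (- 1) * kronecker_fps \<tau> z"
proof -
  define c where "c = - exp (- of_real pi * \<i> * \<tau>) * exp (- z)"
  have c: "c \<noteq> 0" by (simp add: c_def)
  have "kronecker_fps \<tau> (z + tau_period \<tau>)
    = fps_const (1 / (c * theta \<tau> z)) * (fps_const c * (fps_exp (- 1) * theta_fps \<tau> z) * theta_recip_fps \<tau>)"
    unfolding kronecker_fps_def fps_expansion_theta_add_tau[OF assms] theta_add_tau c_def by simp
  also have "\<dots> = (fps_const (1 / (c * theta \<tau> z)) * fps_const c) * (fps_exp (- 1) * (theta_fps \<tau> z * theta_recip_fps \<tau>))"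
    by (simp only: mult_ac)
  also have "fps_const (1 / (c * theta \<tau> z)) * fps_const c = fps_const (1 / theta \<tau> z)"
    using c by simp
  finally show ?thesis by (simp add: kronecker_fps_def mult_ac)
qed

lemma kronecker_fps_add_int_tau:
  assumes "Im \<tau> > 0"
  shows "kronecker_fps \<tau> (z + of_int n * tau_period \<tau>) = fps_exp (- of_int n) * kronecker_fps \<tau> z"
proof (induction n rule: int_induct[of _ 0])
  case (step1 i)
  have "kronecker_fps \<tau> (z + of_int (i + 1) * tau_period \<tau>)
    = kronecker_fps \<tau> (z + of_int i * tau_period \<tau> + tau_period \<tau>)"
    by (simp add: algebra_simps)
  also have "\<dots> = (fps_exp (- 1) * fps_exp (- of_int i)) * kronecker_fps \<tau> z"
    unfolding kronecker_fps_add_tau[OF assms] step1 by (simp only: mult.assoc)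
  finally show ?case by (simp flip: fps_exp_add_mult)
next
  case (step2 i)
  have "fps_exp (- 1) * kronecker_fps \<tau> (z + of_int (i - 1) * tau_period \<tau>)
    = kronecker_fps \<tau> (z + of_int i * tau_period \<tau>)"
    using kronecker_fps_add_tau[OF assms, of "z + of_int (i - 1) * tau_period \<tau>"]
    by (simp add: algebra_simps)
  then have "(fps_exp 1 * fps_exp (- 1)) * kronecker_fps \<tau> (z + of_int (i - 1) * tau_period \<tau>)
    = (fps_exp 1 * fps_exp (- of_int i)) * kronecker_fps \<tau> z"
    using step2 by (metis mult.assoc)
  then show ?case by (simp add: algebra_simps flip: fps_exp_add_mult)
qed simp

lemma holomorphic_theta_fps_nth:
  assumes im: "Im \<tau> > 0"
  shows "(\<lambda>z. (theta_fps \<tau> z * theta_recip_fps \<tau>) $ n) holomorphic_on A"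
proof -
  have "(deriv ^^ i) (theta \<tau>) holomorphic_on A" for i
    using holomorphic_higher_deriv[OF theta_holomorphic[OF im] open_UNIV, of i] holomorphic_on_subset by blast
  then show ?thesis
    unfolding fps_mult_nth fps_expansion_def fps_nth_Abs_fps
    by (intro holomorphic_on_sum holomorphic_on_mult holomorphic_on_divide holomorphic_on_const) auto
qed

lemma kronecker_fps_nth:
  "kronecker_fps \<tau> z $ n = (theta_fps \<tau> z * theta_recip_fps \<tau>) $ n / theta \<tau> z"
  by (simp add: kronecker_fps_def)

lemma holomorphic_kronecker_fps_nth:
  assumes im: "Im \<tau> > 0" and A: "A \<inter> period_lattice \<tau> = {}"
  shows "(\<lambda>z. kronecker_fps \<tau> z $ n) holomorphic_on A"
  unfolding kronecker_fps_nth
  by (intro holomorphic_on_divide holomorphic_theta_fps_nth theta_holomorphic im)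
     (use A in \<open>auto simp: theta_eq_0_iff[OF im]\<close>)

lemma meromorphic_kronecker_fps_nth:
  assumes im: "Im \<tau> > 0"
  shows "(\<lambda>z. kronecker_fps \<tau> z $ n) meromorphic_on A"
proof -
  have "(\<lambda>z. (theta_fps \<tau> z * theta_recip_fps \<tau>) $ n) analytic_on UNIV"
    using holomorphic_theta_fps_nth[OF im] by (simp add: analytic_on_open)
  then have "(\<lambda>z. kronecker_fps \<tau> z $ n) meromorphic_on UNIV"
    unfolding kronecker_fps_nth
    by (intro meromorphic_on_divide analytic_on_imp_meromorphic_on theta_analytic im)
  then show ?thesis by (rule meromorphic_on_subset) simp
qed

text \<open>As z tends to 0, z \<theta>(z + w) / \<theta>(z) tends coefficientwise to \<theta>(w),
  and \<theta>(w) times w / \<theta>(w) is w. So only the coefficient with n = 1 has a pole at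
  0.\<close>

lemma tendsto_kronecker_fps_nth_0:
  assumes im: "Im \<tau> > 0"
  shows "((\<lambda>z. z * kronecker_fps \<tau> z $ n) \<longlongrightarrow> fps_X $ n) (at 0)"
proof -
  have "(theta \<tau> has_field_derivative 1) (at 0)"
    using holomorphic_derivI[OF theta_holomorphic[OF im] open_UNIV, of 0] deriv_theta_0[OF im] by simp
  then have "((\<lambda>z. inverse (theta \<tau> z / z)) \<longlongrightarrow> inverse 1) (at 0)"
    by (intro tendsto_inverse) (simp_all add: has_field_derivative_iff)
  moreover have "((\<lambda>z. (theta_fps \<tau> z * theta_recip_fps \<tau>) $ n)
      \<longlongrightarrow> (theta_fps \<tau> 0 * theta_recip_fps \<tau>) $ n) (at 0)"
    using holomorphic_on_imp_continuous_on[OF holomorphic_theta_fps_nth[OF im, of n UNIV]]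
    by (simp add: continuous_on_eq_continuous_at isCont_def)
  ultimately have "((\<lambda>z. inverse (theta \<tau> z / z) * (theta_fps \<tau> z * theta_recip_fps \<tau>) $ n)
      \<longlongrightarrow> inverse 1 * (theta_fps \<tau> 0 * theta_recip_fps \<tau>) $ n) (at 0)"
    by (rule tendsto_mult)
  then show ?thesis
    unfolding theta_fps_at_0(3)[OF im] kronecker_fps_nth by (simp add: field_simps)
qed

text \<open>The functions \<open>u \<mapsto> \<Sum> u\<^sup>k q\<^bsup>jk\<^esup> / (1 - q\<^sup>k)\<^bsup>j+1\<^esup>\<close> are the Taylor coefficients of the Kronecker function
  with respect to \<open>s = e\<^sup>w - 1\<close>; this is the transition matrix from \<open>w\<close>-coefficients to
  \<open>s\<close>-coefficients of \<open>s / w\<close> times a power series in \<open>w = log (1 + s)\<close>.\<close>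

definition log_coeff :: "nat \<Rightarrow> nat \<Rightarrow> complex" where
  "log_coeff n j = (fps_ln 1 ^ n * inverse (fps_shift 1 (fps_ln 1))) $ j"

text \<open>The coefficient of s^j in s K, where K = \<theta>(z + w) / (\<theta>(z) \<theta>(w)) and
  w = log (1 + s). The extra factor s clears the pole of K at w = 0, so index \<open>Suc j\<close>
  belongs to the Lambert series with parameter j.\<close>

definition kronecker_coeff :: "nat \<Rightarrow> complex \<Rightarrow> complex \<Rightarrow> complex" where
  "kronecker_coeff j \<tau> z = (\<Sum>n\<le>j. kronecker_fps \<tau> z $ n * log_coeff n j)"

text \<open>Since w = s S with S(0) = 1, the series w^j s/w starts with s^j, and for n = 1 it is s
  exactly.\<close>

lemma log_coeff_simps: "log_coeff j j = 1" "log_coeff 1 j = fps_X $ j"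
proof -
  define S where "S = fps_shift 1 (fps_ln (1::complex))"
  have S0: "S $ 0 = 1" by (simp add: S_def fps_ln_def)
  have L: "fps_ln 1 = fps_X * S"
    unfolding S_def by (rule fps_X_times_shift_1[symmetric]) (simp add: fps_ln_def)
  have "log_coeff j j = (fps_ln 1 ^ j * inverse S) $ j" by (simp add: log_coeff_def S_def)
  also have "\<dots> = (fps_X ^ j * (S ^ j * inverse S)) $ j"
    by (simp only: L power_mult_distrib mult.assoc)
  also have "\<dots> = 1" by (simp add: fps_X_power_mult_nth S0 fps_nth_power_0)
  finally show "log_coeff j j = 1" .
  have "S * inverse S = 1" using S0 by (intro inverse_mult_eq_1') simp
  then have "fps_ln 1 * inverse S = fps_X" by (simp add: L mult.assoc)
  then show "log_coeff 1 j = fps_X $ j" by (simp add: log_coeff_def S_def)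
qed

lemma fps_compose_ln_nth:
  "((a oo fps_ln 1) * inverse (fps_shift 1 (fps_ln 1))) $ j = (\<Sum>n\<le>j. a $ n * log_coeff n j)"
proof -
  let ?L = "fps_ln (1::complex)" and ?B = "inverse (fps_shift 1 (fps_ln (1::complex)))"
  have z: "(?L ^ n) $ m = 0" if "m < n" for m n
    using that by (intro startsby_zero_power_prefix[rule_format]) (simp_all add: fps_ln_def)
  have "((a oo ?L) * ?B) $ j = (\<Sum>m\<le>j. (\<Sum>n\<le>j. a $ n * ((?L ^ n) $ m)) * ?B $ (j - m))"
    unfolding fps_mult_nth atLeast0AtMost
  proof (rule sum.cong[OF refl])
    fix m assume m: "m \<in> {..j}"
    have "(a oo ?L) $ m = (\<Sum>n\<le>j. a $ n * ((?L ^ n) $ m))"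
      unfolding fps_compose_nth atLeast0AtMost by (rule sum.mono_neutral_left) (use m z in auto)
    then show "(a oo ?L) $ m * ?B $ (j - m) = (\<Sum>n\<le>j. a $ n * ((?L ^ n) $ m)) * ?B $ (j - m)" by simp
  qed
  also have "\<dots> = (\<Sum>n\<le>j. a $ n * (\<Sum>m\<le>j. (?L ^ n) $ m * ?B $ (j - m)))"
    by (simp add: sum_distrib_left sum_distrib_right mult_ac) (rule sum.swap)
  finally show ?thesis by (simp add: log_coeff_def fps_mult_nth atLeast0AtMost)
qed

lemma fps_exp_compose_ln: "fps_exp (1::complex) oo fps_ln 1 = 1 + fps_X"
proof -
  have "(fps_exp (1::complex) - 1) oo fps_ln 1 = fps_X"
    unfolding fps_ln_fps_exp_inv[OF one_neq_zero] by (rule fps_inv_right) simp_all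
  then show ?thesis by (simp add: fps_compose_sub_distrib algebra_simps)
qed

text \<open>The inverse shift multiplies the Kronecker function by e^w = 1 + s; this compares the
  coefficients of s^(j+1).\<close>

lemma kronecker_coeff_Suc_add_tau:
  assumes im: "Im \<tau> > 0"
  shows "kronecker_coeff (Suc j) \<tau> z = kronecker_coeff (Suc j) \<tau> (z + tau_period \<tau>)
    + kronecker_coeff j \<tau> (z + tau_period \<tau>)"
proof -
  let ?L = "fps_ln (1::complex)" and ?B = "inverse (fps_shift 1 (fps_ln (1::complex)))"
  let ?K = "kronecker_fps \<tau> z" and ?K' = "kronecker_fps \<tau> (z + tau_period \<tau>)"
  have L0: "?L $ 0 = 0" by (simp add: fps_ln_def)
  have "?K = fps_exp 1 * ?K'"
    unfolding kronecker_fps_add_tau[OF im] by (simp flip: mult.assoc fps_exp_add_mult)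
  then have "?K oo ?L = (1 + fps_X) * (?K' oo ?L)"
    by (simp add: fps_compose_mult_distrib[OF L0] fps_exp_compose_ln)
  then have "(?K oo ?L) * ?B = (?K' oo ?L) * ?B + fps_X * ((?K' oo ?L) * ?B)"
    by (simp add: algebra_simps)
  then have "((?K oo ?L) * ?B) $ Suc j = ((?K' oo ?L) * ?B) $ Suc j + ((?K' oo ?L) * ?B) $ j"
    by (simp del: fps_mult_nth)
  then show ?thesis unfolding fps_compose_ln_nth kronecker_coeff_def .
qed

lemma kronecker_coeff_add_2pi:
  "Im \<tau> > 0 \<Longrightarrow> kronecker_coeff j \<tau> (z + 2 * of_real pi * \<i>) = kronecker_coeff j \<tau> z"
  by (simp add: kronecker_coeff_def kronecker_fps_add_2pi)

text \<open>The limit series w, times s/w, is s: only index 1 has a pole at 0, so all higher indices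
  satisfy the growth condition of \<open>strip_additive_const\<close>.\<close>

lemma tendsto_kronecker_coeff_0:
  assumes im: "Im \<tau> > 0"
  shows "((\<lambda>z. z * kronecker_coeff j \<tau> z) \<longlongrightarrow> fps_X $ j) (at 0)"
proof -
  have "((\<lambda>z. \<Sum>n\<le>j. (z * kronecker_fps \<tau> z $ n) * log_coeff n j) \<longlongrightarrow> (\<Sum>n\<le>j. fps_X $ n * log_coeff n j)) (at 0)"
    by (intro tendsto_intros tendsto_kronecker_fps_nth_0 im)
  moreover have "(\<Sum>n\<le>j. fps_X $ n * log_coeff n j) = fps_X $ j"
  proof (cases "j = 0")
    case False
    then have "(\<Sum>n\<le>j. fps_X $ n * log_coeff n j) = (\<Sum>n\<in>{1}. fps_X $ n * log_coeff n j)"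
      by (intro sum.mono_neutral_right) auto
    then show ?thesis using log_coeff_simps(2)[of j] by simp
  qed simp
  ultimately show ?thesis unfolding kronecker_coeff_def by (simp add: sum_distrib_left mult.assoc)
qed

lemma holomorphic_kronecker_coeff:
  assumes "Im \<tau> > 0" "A \<inter> period_lattice \<tau> = {}"
  shows "kronecker_coeff j \<tau> holomorphic_on A"
  unfolding kronecker_coeff_def[abs_def]
  by (intro holomorphic_intros holomorphic_kronecker_fps_nth assms)

lemma meromorphic_kronecker_coeff:
  assumes "Im \<tau> > 0"
  shows "kronecker_coeff j \<tau> meromorphic_on A"
  unfolding kronecker_coeff_def[abs_def]
  by (intro meromorphic_intros meromorphic_kronecker_fps_nth assms)

lemma higher_deriv_theta_0_even:
  assumes "Im \<tau> > 0" "even n"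
  shows "(deriv ^^ n) (theta \<tau>) 0 = 0"
proof -
  have "(deriv ^^ n) (\<lambda>w. theta \<tau> (- 1 * w)) 0 = (- 1) ^ n * (deriv ^^ n) (theta \<tau>) (- 1 * 0)"
    by (rule higher_deriv_compose_linear[OF theta_holomorphic[OF assms(1), of UNIV], of UNIV]) auto
  moreover have "(deriv ^^ n) (\<lambda>w. - theta \<tau> w) 0 = - (deriv ^^ n) (theta \<tau>) 0"
    by (rule higher_deriv_uminus[OF theta_holomorphic[OF assms(1), of UNIV]]) auto
  ultimately show ?thesis using assms by (simp add: theta_uminus)
qed

lemma fps_inverse_nth_1:
  fixes f :: "'a::field fps"
  assumes "f $ 0 = 1"
  shows "inverse f $ 1 = - f $ 1"
proof -
  have "(inverse f * f) $ 1 = (1 :: 'a fps) $ 1" using assms by (subst inverse_mult_eq_1) auto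
  then show ?thesis using assms by (simp add: fps_mult_nth eq_neg_iff_add_eq_0 add.commute)
qed

text \<open>Here s/w = 1 + s/2 + ... contributes the 1/2, and w / \<theta>(w) has no linear term
  because \<theta> is odd.\<close>

lemma kronecker_coeff_1:
  assumes im: "Im \<tau> > 0" and z: "z \<notin> period_lattice \<tau>"
  shows "kronecker_coeff 1 \<tau> z = theta_quot 1 \<tau> z + 1 / 2"
proof -
  have "log_coeff 0 1 = 1 / 2"
    using fps_inverse_nth_1[of "fps_shift 1 (fps_ln (1::complex))"] by (simp add: log_coeff_def fps_ln_def)
  moreover have "theta_recip_fps \<tau> $ 1 = 0"
    using fps_inverse_nth_1[of "fps_shift 1 (theta_fps \<tau> 0)"] theta_fps_at_0(2)[OF im]
      higher_deriv_theta_0_even[OF im, of 2]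
    by (simp add: theta_recip_fps_def fps_expansion_def numeral_2_eq_2)
  moreover have "theta_recip_fps \<tau> $ 0 = 1" by (rule theta_fps_at_0[OF im])
  ultimately show ?thesis
    using kronecker_fps_0[OF im z] z[folded theta_eq_0_iff[OF im]] log_coeff_simps(1)[of 1]
    by (simp add: kronecker_coeff_def kronecker_fps_nth fps_mult_nth fps_expansion_def theta_quot_def)
qed

section \<open>The Lambert series and the Kronecker function\<close>

definition h_term :: "nat \<Rightarrow> complex \<Rightarrow> int \<Rightarrow> complex \<Rightarrow> complex" where
  "h_term j q k u = (if k = 0 then 0 else q powi (int j * k) * u powi k / (1 - q powi k) ^ Suc j)"

definition h_series :: "nat \<Rightarrow> complex \<Rightarrow> complex \<Rightarrow> complex" where
  "h_series j q u = (\<Sum>\<^sub>\<infinity>k. h_term j q k u)"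

definition h_region :: "nat \<Rightarrow> complex \<Rightarrow> complex set" where
  "h_region j q = {u. norm q < norm u \<and> norm u * norm q ^ j < 1}"

lemma h_term_of_nat:
  "n > 0 \<Longrightarrow> h_term j q (int n) u = (q ^ j * u) ^ n / (1 - q ^ n) ^ Suc j"
  by (simp add: h_term_def power_int_mult power_mult_distrib mult.commute flip: power_mult)

text \<open>Writing 1 - q^(-n) = -(1 - q^n) / q^n turns the negative half into a series in q/u with
  the same denominators; this is where |q| < |u| comes from.\<close>

lemma h_term_uminus_of_nat:
  assumes "n > 0" "q \<noteq> 0" "u \<noteq> 0" "q ^ n \<noteq> 1"
  shows "h_term j q (- int n) u = (- 1) ^ Suc j * (q / u) ^ n / (1 - q ^ n) ^ Suc j"
proof -
  define Q where "Q = q ^ n"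
  have Q: "Q \<noteq> 0" "1 - Q \<noteq> 0" using assms by (auto simp: Q_def)
  have "h_term j q (- int n) u = (1 / Q ^ j) * (1 / u ^ n) / (1 - 1 / Q) ^ Suc j"
    using assms by (simp add: h_term_def power_int_minus Q_def inverse_eq_divide power_int_mult flip: power_mult)
      (simp add: mult.commute)
  also have "1 - 1 / Q = (- 1) * (1 - Q) / Q" using Q by (simp add: field_simps)
  also have "((- 1) * (1 - Q) / Q) ^ Suc j = (- 1) ^ Suc j * (1 - Q) ^ Suc j / (Q ^ j * Q)"
    by (simp only: power_divide power_mult_distrib flip: power_Suc2)
  also have "(1 / Q ^ j) * (1 / u ^ n) / ((- 1) ^ Suc j * (1 - Q) ^ Suc j / (Q ^ j * Q))
      = (- 1) ^ Suc j * (Q / u ^ n) / (1 - Q) ^ Suc j"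
  proof -
    have "(1 / A) * (1 / v) / (s * B / (A * Q)) = s * (Q / v) / B"
      if "A \<noteq> 0" "v \<noteq> 0" "s * s = 1" "B \<noteq> 0" for A v s B :: complex
    proof -
      have "s \<noteq> 0" using that by auto
      then show ?thesis using that Q by (simp add: divide_simps)
    qed
    from this[of "Q ^ j" "u ^ n" "(- 1) ^ Suc j" "(1 - Q) ^ Suc j"] show ?thesis
      using Q assms by (simp flip: power_mult_distrib)
  qed
  finally show ?thesis by (simp add: Q_def power_divide)
qed

lemma norm_h_term_le:
  assumes q: "q \<noteq> 0" "norm q < 1" and u: "u \<noteq> 0" "norm u * norm q ^ j \<le> \<rho>" "norm q / norm u \<le> \<rho>"
  shows "norm (h_term j q k u) \<le> 1 / (1 - norm q) ^ Suc j * \<rho> ^ nat \<bar>k\<bar>"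
proof (cases "k = 0")
  case True
  then show ?thesis using q by (simp add: h_term_def)
next
  case False
  define n where "n = nat \<bar>k\<bar>"
  have n: "n > 0" using False by (simp add: n_def)
  note le = one_minus_power_bound(1)[OF q(2) n] and qn = one_minus_power_bound(2)[OF q(2) n]
  have bound: "norm (s * x ^ n / (1 - q ^ n) ^ Suc j) \<le> 1 / (1 - norm q) ^ Suc j * \<rho> ^ n"
    if "norm x \<le> \<rho>" "norm s = 1" for x s
  proof -
    have "norm (s * x ^ n / (1 - q ^ n) ^ Suc j) = norm x ^ n / norm (1 - q ^ n) ^ Suc j"
      using that by (simp only: norm_divide norm_mult norm_power mult_1)
    also have "\<dots> \<le> \<rho> ^ n / (1 - norm q) ^ Suc j"
      using le that q order_trans[OF norm_ge_zero that(1)] by (intro frac_le power_mono zero_less_power) auto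
    finally show ?thesis by simp
  qed
  consider "k = int n" | "k = - int n" using False by (cases "k > 0") (auto simp: n_def)
  then show ?thesis
  proof cases
    case 1
    then show ?thesis using bound[of "q ^ j * u" 1] n u
      by (simp add: h_term_of_nat n_def[symmetric] norm_mult norm_power mult.commute del: power_Suc)
  next
    case 2
    then show ?thesis using bound[of "q / u" "(- 1) ^ Suc j"] n u q qn
      by (simp add: h_term_uminus_of_nat n_def[symmetric] norm_divide norm_power del: power_Suc)
  qed
qed

lemma h_term_bound:
  assumes q: "q \<noteq> 0" "norm q < 1" and x: "x \<in> h_region j q"
  obtains U M where "open U" "x \<in> U" "M summable_on (UNIV :: int set)" "\<And>k u. u \<in> U \<Longrightarrow> norm (h_term j q k u) \<le> M k"
proof -
  have nx: "norm x > 0" using x q by (auto simp: h_region_def)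
  have "max (norm x * norm q ^ j) (norm q / norm x) < 1" using x nx by (simp add: h_region_def)
  then obtain \<rho> where r: "max (norm x * norm q ^ j) (norm q / norm x) < \<rho>" "\<rho> < 1" using dense by blast
  have "0 \<le> norm q / norm x" by simp
  then have r0: "\<rho> > 0" using r by linarith
  define U where "U = {u::complex. norm u * norm q ^ j < \<rho> \<and> norm q < norm u * \<rho>}"
  have "open U" unfolding U_def
    by (intro open_Collect_conj open_Collect_less continuous_intros)
  moreover have "x \<in> U" using r nx by (simp add: U_def divide_less_eq mult.commute)
  moreover have "(\<lambda>k::int. 1 / (1 - norm q) ^ Suc j * \<rho> ^ nat \<bar>k\<bar>) summable_on UNIV"
    using r r0 by (intro summable_on_cmult_right summable_on_power_abs_int) auto
  moreover have "norm (h_term j q k u) \<le> 1 / (1 - norm q) ^ Suc j * \<rho> ^ nat \<bar>k\<bar>" if "u \<in> U" for k u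
  proof -
    have "norm q < norm u * \<rho>" using that by (simp add: U_def)
    then have "u \<noteq> 0" using q by auto
    then show ?thesis using that by (intro norm_h_term_le q) (auto simp: U_def divide_le_eq mult.commute)
  qed
  ultimately show ?thesis by (rule that)
qed

lemma h_term_locally_absolutely_convergent:
  assumes "q \<noteq> 0" "norm q < 1"
  shows "locally_absolutely_convergent_on (h_term j q) (h_region j q)"
  unfolding locally_absolutely_convergent_on_def
proof
  fix x assume "x \<in> h_region j q"
  from h_term_bound[OF assms this] show "\<exists>U M. open U \<and> x \<in> U \<and> M summable_on UNIV
      \<and> (\<forall>k. \<forall>u\<in>U \<inter> h_region j q. norm (h_term j q k u) \<le> M k)"
    by (metis IntD1)
qed

lemma open_h_region: "open (h_region j q)"
  unfolding h_region_def by (intro open_Collect_conj open_Collect_less continuous_intros)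

lemma h_series_holomorphic:
  assumes "q \<noteq> 0" "norm q < 1"
  shows "h_series j q holomorphic_on h_region j q"
  unfolding h_series_def
proof (rule locally_absolutely_convergent_on_holomorphic[OF h_term_locally_absolutely_convergent[OF assms] open_h_region])
  fix k
  have "u \<noteq> 0" if "u \<in> h_region j q" for u using that assms by (auto simp: h_region_def)
  then show "h_term j q k holomorphic_on h_region j q"
    unfolding h_term_def by (cases "k = 0") (auto intro!: holomorphic_intros)
qed

lemma h_series_has_sum:
  assumes "q \<noteq> 0" "norm q < 1" "u \<in> h_region j q"
  shows "((\<lambda>k. h_term j q k u) has_sum h_series j q u) UNIV"
  unfolding h_series_def
  by (intro has_sum_infsum locally_absolutely_convergent_on_summable[OF h_term_locally_absolutely_convergent] assms)

lemma powi_neq_1: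
  fixes q :: complex
  assumes "norm q < 1" "k \<noteq> 0"
  shows "q powi k \<noteq> 1"
proof -
  note * = one_minus_power_bound(2)[OF assms(1)]
  show ?thesis using assms(2) *[of "nat k"] *[of "nat (- k)"]
    by (cases "k > 0") (auto simp: power_int_def power_inverse)
qed

lemma exp_neq_1: "Re z \<noteq> 0 \<Longrightarrow> exp z \<noteq> 1"
  using norm_exp_eq_Re[of z] by (metis exp_eq_one_iff norm_one)

text \<open>Termwise, with X = q^k, this is X^(j+1) (X + (1 - X)) = X^(j+1) over a common
  denominator. It is the same recursion as \<open>kronecker_coeff_Suc_add_tau\<close>.\<close>

lemma h_series_shift:
  assumes q: "q \<noteq> 0" "norm q < 1" and u: "1 < norm u" "norm u * norm q < 1"
  shows "h_series (Suc j) q u = h_series (Suc j) q (q * u) + h_series j q (q * u)"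
proof -
  have q1: "norm q ^ i \<le> 1" for i using q by (simp add: power_le_one)
  have 1: "norm u * norm q ^ Suc j < 1"
    using mult_left_mono[OF q1[of j], of "norm u * norm q"] u by (simp add: mult_ac)
  have 2: "norm (q * u) * norm q ^ i < 1" for i
    using mult_left_mono[OF q1[of i], of "norm u * norm q"] u by (simp add: norm_mult mult_ac)
  have 3: "norm q < norm u" "norm q < norm (q * u)"
    using u q mult_strict_left_mono[OF u(1), of "norm q"] by (auto simp: norm_mult)
  have reg: "u \<in> h_region (Suc j) q" "q * u \<in> h_region (Suc j) q" "q * u \<in> h_region j q"
    using 1 2 3 by (simp_all only: h_region_def mem_Collect_eq simp_thms)
  have "h_term (Suc j) q k (q * u) + h_term j q k (q * u) = h_term (Suc j) q k u" for k
  proof (cases "k = 0")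
    case False
    define X where "X = q powi k"
    have X: "1 - X \<noteq> 0" using powi_neq_1[OF q(2) False] by (simp add: X_def)
    have p: "q powi (int i * k) = X ^ i" for i
      by (simp add: X_def power_int_mult mult.commute[of "int i"])
    have "X ^ Suc j * (X * v) / (1 - X) ^ Suc (Suc j) + X ^ j * (X * v) / (1 - X) ^ Suc j
      = X ^ Suc j * v / (1 - X) ^ Suc (Suc j)" for v
    proof -
      have "X ^ j * (X * v) / (1 - X) ^ Suc j = X ^ j * (X * v) * (1 - X) / (1 - X) ^ Suc (Suc j)"
        using X by simp
      then show ?thesis by (simp only: flip: add_divide_distrib) (simp add: algebra_simps)
    qed
    then show ?thesis using False unfolding h_term_def p
      by (simp add: power_int_mult_distrib X_def[symmetric] del: power_Suc)
  qed (simp add: h_term_def)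
  moreover have "((\<lambda>k. h_term (Suc j) q k (q * u) + h_term j q k (q * u)) has_sum
      (h_series (Suc j) q (q * u) + h_series j q (q * u))) UNIV"
    by (intro has_sum_add h_series_has_sum q reg)
  ultimately show ?thesis using has_sum_unique[OF h_series_has_sum[OF q reg(1)]] by simp
qed

lemma infsum_int_split_symmetric:
  fixes f :: "int \<Rightarrow> complex"
  assumes "f summable_on UNIV" "f 0 = 0"
  shows "(\<Sum>\<^sub>\<infinity>k. f k) = (\<Sum>\<^sub>\<infinity>n::nat. f (int n)) + (\<Sum>\<^sub>\<infinity>n::nat. f (- int n))"
    and "(\<lambda>n::nat. f (- int n)) summable_on UNIV"
proof -
  have *: "(\<lambda>n::nat. f (- int n)) \<circ> Suc = (\<lambda>n. f (- int n - 1))"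
  proof
    fix n
    have "- int (Suc n) = - int n - 1" by simp
    then show "((\<lambda>n. f (- int n)) \<circ> Suc) n = f (- int n - 1)" by (simp only: o_apply)
  qed
  have "f (- int n) = 0" if "n \<notin> range Suc" for n
    using that assms(2) by (cases n) auto
  then have "(\<Sum>\<^sub>\<infinity>n::nat. f (- int n)) = infsum (\<lambda>n::nat. f (- int n)) (range Suc)"
    by (intro infsum_cong_neutral) auto
  also have "\<dots> = (\<Sum>\<^sub>\<infinity>n::nat. f (- int n - 1))"
    by (subst infsum_reindex) (simp_all add: * del: o_apply)
  finally show "(\<Sum>\<^sub>\<infinity>k. f k) = (\<Sum>\<^sub>\<infinity>n::nat. f (int n)) + (\<Sum>\<^sub>\<infinity>n::nat. f (- int n))"
    using infsum_int_split(3)[OF assms(1)] by simp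
  have "f summable_on range (\<lambda>n::nat. - int n)"
    using assms by (auto intro: summable_on_subset_banach)
  then show "(\<lambda>n::nat. f (- int n)) summable_on UNIV"
    by (subst (asm) summable_on_reindex) (auto simp: inj_on_def o_def)
qed

text \<open>For positive k split 1/(1 - q^k) = 1 + q^k/(1 - q^k). The first part sums to u/(1 - u),
  which needs |u| < 1; the second, paired with the term at -k, is the derivative of
  \<open>log_sigma\<close>.\<close>

lemma h_series_0:
  assumes im: "Im \<tau> > 0" and z: "- (2 * pi * Im \<tau>) < Re z" "Re z < 0"
  shows "h_series 0 (qpar \<tau>) (exp z) = - (theta_quot 1 \<tau> z + 1 / 2)"
proof -
  let ?q = "qpar \<tau>" and ?u = "exp z"
  have q: "?q \<noteq> 0" "norm ?q < 1" using qpar_nontrivial[OF im, of 1] by auto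
  have u1: "norm ?u < 1" using z by simp
  have une: "?u \<noteq> 1" using u1 by (metis norm_one less_irrefl)
  have reg: "?u \<in> h_region 0 ?q" using z by (simp add: h_region_def norm_qpar)
  have s: "(\<lambda>k. h_term 0 ?q k ?u) summable_on UNIV"
    using h_series_has_sum[OF q reg] by (rule has_sum_imp_summable)
  have "h_series 0 ?q ?u = (\<Sum>\<^sub>\<infinity>n::nat. h_term 0 ?q (int n) ?u) + (\<Sum>\<^sub>\<infinity>n::nat. h_term 0 ?q (- int n) ?u)"
    unfolding h_series_def by (rule infsum_int_split_symmetric[OF s]) (simp add: h_term_def)
  then have "((\<lambda>n. h_term 0 ?q (int n) ?u + h_term 0 ?q (- int n) ?u) has_sum h_series 0 ?q ?u) UNIV"
    using has_sum_add[OF has_sum_infsum[OF infsum_int_split(1)[OF s]]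
        has_sum_infsum[OF infsum_int_split_symmetric(2)[OF s]]]
    by (simp add: h_term_def)
  moreover have "((\<lambda>n. (if n = 0 then 0 else ?u ^ n) + (exp (of_nat n * z) - exp (- (of_nat n * z))) * (?q ^ n / (1 - ?q ^ n)))
      has_sum (?u / (1 - ?u) + deriv (log_sigma \<tau>) z)) UNIV"
  proof (rule has_sum_add[OF _ deriv_log_sigma[OF im]])
    show "((\<lambda>n. if n = 0 then 0 else ?u ^ n) has_sum (?u / (1 - ?u))) UNIV"
      by (rule has_sum_geometric_from_1[OF u1])
  qed (use z in auto)
  moreover have "h_term 0 ?q (int n) ?u + h_term 0 ?q (- int n) ?u
      = (if n = 0 then 0 else ?u ^ n) + (exp (of_nat n * z) - exp (- (of_nat n * z))) * (?q ^ n / (1 - ?q ^ n))" for n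
  proof (cases "n = 0")
    case False
    define X where "X = ?q ^ n"
    define Y where "Y = ?u ^ n"
    have nz: "1 - X \<noteq> 0" "Y \<noteq> 0" using qpar_nontrivial[OF im, of n] False by (auto simp: X_def Y_def)
    have e: "exp (of_nat n * z) = Y" "exp (- (of_nat n * z)) = 1 / Y"
      by (simp_all add: Y_def exp_of_nat_mult exp_minus inverse_eq_divide)
    have t: "h_term 0 ?q (int n) ?u = Y / (1 - X)" "h_term 0 ?q (- int n) ?u = - (X / Y) / (1 - X)"
      using False q qpar_nontrivial[OF im, of n]
      by (simp_all add: h_term_of_nat h_term_uminus_of_nat X_def Y_def power_divide)
    show ?thesis unfolding t e using nz False
      by (simp add: X_def[symmetric] Y_def[symmetric] divide_simps) (simp add: algebra_simps)
  qed (simp add: h_term_def)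
  ultimately have "h_series 0 ?q ?u = ?u / (1 - ?u) + deriv (log_sigma \<tau>) z"
    by (simp add: has_sum_unique)
  moreover have "theta_quot 1 \<tau> z = (?u + 1) / (2 * (?u - 1)) - deriv (log_sigma \<tau>) z"
    by (rule theta_log_deriv[OF im]) (use z une in auto)
  moreover have "?u / (1 - ?u) = - ((?u + 1) / (2 * (?u - 1)) + 1 / 2)"
  proof -
    have "1 - ?u \<noteq> 0" "?u - 1 \<noteq> 0" using une by auto
    then show ?thesis by (simp add: divide_simps) (simp add: algebra_simps)
  qed
  ultimately show ?thesis by simp
qed

lemma not_in_period_lattice_strip:
  assumes im: "Im \<tau> > 0" and z: "\<bar>Re z\<bar> < 2 * pi * Im \<tau>" "exp z \<noteq> 1"
  shows "z \<notin> period_lattice \<tau>"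
  using theta_eq_log_sigma[OF im z(1), unfolded exp_half_diff] z(2)
  by (simp flip: theta_eq_0_iff[OF im])

lemma not_in_period_lattice_left_strip:
  "Im \<tau> > 0 \<Longrightarrow> - (2 * pi * Im \<tau>) < Re z \<Longrightarrow> Re z < 0 \<Longrightarrow> z \<notin> period_lattice \<tau>"
  by (intro not_in_period_lattice_strip exp_neq_1) auto

text \<open>By induction on \<open>j\<close> the sum of the two functions is constant: the shift by \<open>2 \<pi> \<i> \<tau>\<close> changes it
  by the constant of the previous step, and by Liouville's theorem such an additive shift
  constant must vanish.\<close>

lemma h_series_eq_kronecker_coeff_strip:
  assumes im: "Im \<tau> > 0"
  defines "W \<equiv> 2 * pi * Im \<tau>"
  assumes z: "- W < Re z" "Re z < 0"
  shows "h_series j (qpar \<tau>) (exp z) = - kronecker_coeff (Suc j) \<tau> z"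
proof -
  let ?q = "qpar \<tau>" and ?p = "tau_period \<tau>"
  have W: "W > 0" using im by (simp add: W_def)
  have q: "?q \<noteq> 0" "norm ?q < 1" using qpar_nontrivial[OF im, of 1] by auto
  have nq: "norm ?q = exp (- W)" by (simp add: norm_qpar W_def)
  define f where "f = (\<lambda>j z. h_series j ?q (exp z) + kronecker_coeff (Suc j) \<tau> z)"
  have step: "\<beta> = 0 \<and> (\<exists>\<gamma>. \<forall>z. - W < Re z \<and> Re z < 0 \<longrightarrow> f (Suc j) z = \<gamma>)"
    if \<beta>: "\<And>z. - W < Re z \<Longrightarrow> Re z < 0 \<Longrightarrow> f j z = \<beta>" for j \<beta>
  proof -
    \<comment> \<open>From level 1 on, the annulus of convergence contains the whole image of the
      strip, including u = 1. At level 0 it stops at |u| = 1, so the base case uses the explicit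
      formula.\<close>
    have reg: "exp z \<in> h_region (Suc j) ?q" if "\<bar>Re z\<bar> < W" for z
    proof -
      have "exp (Re z) * exp (- W) < 1" using that by (simp flip: exp_add)
      moreover have "exp (- W) ^ j \<le> 1" using W by (intro power_le_one) auto
      ultimately have "exp (Re z) * exp (- W) * exp (- W) ^ j < 1 * 1"
        by (intro mult_less_le_imp_less) auto
      then show ?thesis using that by (simp add: h_region_def nq mult_ac)
    qed
    have hol: "(\<lambda>z. h_series (Suc j) ?q (exp z)) holomorphic_on {z. \<bar>Re z\<bar> < W}"
      using holomorphic_on_compose_gen[OF holomorphic_on_exp h_series_holomorphic[OF q, of "Suc j"], of "{z. \<bar>Re z\<bar> < W}"] reg
      by (auto simp: o_def)
    have 1: "f (Suc j) holomorphic_on {z. \<bar>Re z\<bar> < 2 * pi * Im \<tau> \<and> exp z \<noteq> 1}"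
      unfolding f_def
      by (intro holomorphic_on_add holomorphic_on_subset[OF hol] holomorphic_kronecker_coeff im)
         (use not_in_period_lattice_strip[OF im] in \<open>auto simp: W_def\<close>)
    have 2: "f (Suc j) (z + 2 * of_real pi * \<i>) = f (Suc j) z" for z
      by (simp add: f_def kronecker_coeff_add_2pi[OF im] exp_add)
    have "isCont (\<lambda>z. h_series (Suc j) ?q (exp z)) 0"
      using holomorphic_on_imp_continuous_on[OF hol] W
      by (simp add: continuous_on_eq_continuous_at[OF open_strip])
    then have "((\<lambda>z. z * h_series (Suc j) ?q (exp z)) \<longlongrightarrow> 0 * h_series (Suc j) ?q (exp 0)) (at 0)"
      unfolding isCont_def by (intro tendsto_mult tendsto_ident_at)
    \<comment> \<open>The index is at least 2, where \<open>kronecker_coeff\<close> has no pole at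
      0.\<close>
    from tendsto_add[OF this tendsto_kronecker_coeff_0[OF im, of "Suc (Suc j)"]]
    have 3: "((\<lambda>z. z * f (Suc j) z) \<longlongrightarrow> 0) (at 0)" by (simp add: f_def distrib_left)
    have 4: "f (Suc j) (z + ?p) = f (Suc j) z + (- \<beta>)" if z: "0 < Re z" "Re z < 2 * pi * Im \<tau>" for z
    proof -
      have e: "exp (z + ?p) = ?q * exp z" by (simp add: exp_add qpar_def)
      have "h_series (Suc j) ?q (exp z) = h_series (Suc j) ?q (?q * exp z) + h_series j ?q (?q * exp z)"
        using z by (intro h_series_shift q) (simp_all add: nq W_def flip: exp_add)
      moreover have "f j (z + ?p) = \<beta>" using z by (intro \<beta>) (auto simp: W_def)
      ultimately show ?thesis
        using kronecker_coeff_Suc_add_tau[OF im, of "Suc j" z] unfolding f_def e by algebra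
    qed
    obtain \<gamma> where "- \<beta> = 0" and \<gamma>: "\<And>z. \<bar>Re z\<bar> < W \<Longrightarrow> exp z \<noteq> 1 \<Longrightarrow> f (Suc j) z = \<gamma>"
      using strip_additive_const[OF im 1 2 3 4] unfolding W_def by blast
    moreover have "exp z \<noteq> 1" if "Re z < 0" for z :: complex
      using that by (intro exp_neq_1) simp
    ultimately show ?thesis using W by (auto intro!: exI[of _ \<gamma>])
  qed
  have ex: "\<exists>\<beta>. \<forall>z. - W < Re z \<and> Re z < 0 \<longrightarrow> f j z = \<beta>" for j
  proof (induction j)
    case 0
    have "f 0 z = 0" if z: "- W < Re z" "Re z < 0" for z
    proof -
      have "z \<notin> period_lattice \<tau>"
        using not_in_period_lattice_left_strip[OF im] z by (simp add: W_def)
      then show ?thesis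
        using h_series_0[OF im, of z] z kronecker_coeff_1[OF im, of z] by (simp add: f_def W_def)
    qed
    then show ?case by blast
  next
    case (Suc j)
    then show ?case using step by blast
  qed
  then obtain \<beta> where "\<forall>z. - W < Re z \<and> Re z < 0 \<longrightarrow> f j z = \<beta>" by blast
  \<comment> \<open>The constant at level j is identified as 0 only by going once more to level
    \<open>Suc j\<close>.\<close>
  then have "f j z = 0" using step[of j \<beta>] z by blast
  then show ?thesis by (simp add: f_def eq_neg_iff_add_eq_0)
qed

section \<open>Extension to the full annulus of convergence\<close>

lemma countable_period_lattice: "countable (period_lattice \<tau>)"
proof -
  have "period_lattice \<tau> = (\<lambda>(m, n). period \<tau> m n) ` UNIV" by (auto simp: period_lattice_def)
  then show ?thesis by simp
qed

lemma open_Diff_period_lattice: "Im \<tau> > 0 \<Longrightarrow> open S \<Longrightarrow> open (S - period_lattice \<tau>)"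
proof -
  assume im: "Im \<tau> > 0" and S: "open S"
  have "open {z. theta \<tau> z \<noteq> 0}"
    using holomorphic_on_imp_continuous_on[OF theta_holomorphic[OF im]]
    by (intro open_Collect_neq continuous_on_const) auto
  then have "open (S \<inter> {z. theta \<tau> z \<noteq> 0})" using S by (rule open_Int[rotated])
  also have "S \<inter> {z. theta \<tau> z \<noteq> 0} = S - period_lattice \<tau>" by (auto simp: theta_eq_0_iff[OF im])
  finally show ?thesis .
qed

text \<open>The identity theorem carries the equality from the left half strip to the full region:
  removing a countable set from the open convex strip \<open>S\<close> keeps it connected.\<close>

lemma h_series_eq_kronecker_coeff:
  assumes im: "Im \<tau> > 0"
    and z: "exp z \<in> h_region j (qpar \<tau>)" "z \<notin> period_lattice \<tau>"
  shows "h_series j (qpar \<tau>) (exp z) = - kronecker_coeff (Suc j) \<tau> z"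
proof -
  define W where "W = 2 * pi * Im \<tau>"
  let ?q = "qpar \<tau>"
  have W: "W > 0" using im by (simp add: W_def)
  have q: "?q \<noteq> 0" "norm ?q < 1" using qpar_nontrivial[OF im, of 1] by auto
  have nq: "norm ?q = exp (- W)" by (simp add: norm_qpar W_def)
  have reg: "exp z \<in> h_region j ?q \<longleftrightarrow> - W < Re z \<and> Re z < of_nat j * W" for z
    by (simp add: h_region_def nq flip: exp_of_nat_mult exp_add)
  define S where "S = {z. - W < Re z \<and> Re z < of_nat j * W}"
  have oS: "open S" unfolding S_def
    by (intro open_Collect_conj open_Collect_less continuous_intros)
  have "S = {z. Re z > - W} \<inter> {z. Re z < of_nat j * W}" by (auto simp: S_def)
  then have "convex S" by (simp add: convex_Int convex_halfspace_Re_gt convex_halfspace_Re_lt)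
  then have cS: "connected (S - period_lattice \<tau>)"
    by (intro connected_open_diff_countable oS countable_period_lattice convex_connected) simp
  define T where "T = {z. - W < Re z \<and> Re z < 0}"
  have TS: "T \<subseteq> S - period_lattice \<tau>"
  proof
    fix z assume "z \<in> T"
    then have z: "- W < Re z" "Re z < 0" by (auto simp: T_def)
    have "z \<notin> period_lattice \<tau>"
      using not_in_period_lattice_left_strip[OF im] z by (simp add: W_def)
    moreover have "0 \<le> of_nat j * W" using W by simp
    then have "Re z < of_nat j * W" using z by linarith
    ultimately show "z \<in> S - period_lattice \<tau>" using z by (simp add: S_def)
  qed
  show ?thesis
  proof (rule analytic_continuation_open[where s = T and s' = "S - period_lattice \<tau>"
        and f = "\<lambda>z. h_series j ?q (exp z)" and g = "\<lambda>z. - kronecker_coeff (Suc j) \<tau> z"])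
    show "open T" unfolding T_def by (intro open_Collect_conj open_Collect_less continuous_intros)
    show "T \<noteq> {}" using W by (auto simp: T_def intro!: exI[of _ "of_real (- W / 2)"])
    have "(\<lambda>z. h_series j ?q (exp z)) holomorphic_on S"
      using holomorphic_on_compose_gen[OF holomorphic_on_exp h_series_holomorphic[OF q, of j], of S] reg
      by (auto simp: o_def S_def)
    then show "(\<lambda>z. h_series j ?q (exp z)) holomorphic_on S - period_lattice \<tau>"
      by (rule holomorphic_on_subset) auto
    show "(\<lambda>z. - kronecker_coeff (Suc j) \<tau> z) holomorphic_on S - period_lattice \<tau>"
      by (intro holomorphic_on_minus holomorphic_kronecker_coeff im) auto
    show "h_series j ?q (exp z) = - kronecker_coeff (Suc j) \<tau> z" if "z \<in> T" for z
      using that h_series_eq_kronecker_coeff_strip[OF im, of z j] by (simp add: T_def W_def)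
    show "z \<in> S - period_lattice \<tau>" using z reg by (simp add: S_def)
  qed (use oS cS TS im open_Diff_period_lattice in auto)
qed

section \<open>The Eisenstein series of weight 2\<close>

text \<open>The logarithmic derivative of Gamma(w) Gamma(1 - w) = pi / sin (pi w) gives a cotangent,
  whose derivative is the squared cosecant.\<close>

lemma Polygamma_1_reflection:
  fixes z :: complex
  assumes "z \<notin> \<int>"
  shows "Polygamma 1 z + Polygamma 1 (1 - z) = (of_real pi / sin (of_real pi * z)) ^ 2"
proof -
  define S where "S = - (\<int> :: complex set)"
  have S: "open S" "z \<in> S" using assms by (auto simp: S_def open_Compl closed_Ints)
  have ni: "w \<notin> \<int>\<^sub>\<le>\<^sub>0" "1 - w \<notin> \<int>\<^sub>\<le>\<^sub>0" "sin (of_real pi * w) \<noteq> 0" if "w \<in> S" for w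
  proof -
    have w: "w \<notin> \<int>" using that by (simp add: S_def)
    then have "1 - w \<notin> \<int>" by (metis Ints_1 Ints_diff diff_diff_eq2 add_diff_cancel_left')
    with w show "w \<notin> \<int>\<^sub>\<le>\<^sub>0" "1 - w \<notin> \<int>\<^sub>\<le>\<^sub>0" using nonpos_Ints_Int by blast+
    show "sin (of_real pi * w) \<noteq> 0"
    proof
      assume "sin (of_real pi * w) = 0"
      then obtain n :: int where "of_real pi * w = of_int n * of_real pi" by (auto simp: sin_eq_0)
      then have "w = of_int n" by simp
      then show False using w by simp
    qed
  qed
  have 1: "Digamma w - Digamma (1 - w) = - (of_real pi * cos (of_real pi * w) / sin (of_real pi * w))" if w: "w \<in> S" for w
  proof -
    have "((\<lambda>w. Gamma w * Gamma (1 - w)) has_field_derivative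
        Gamma w * Gamma (1 - w) * (Digamma w - Digamma (1 - w))) (at w)"
      using ni[OF w] by (auto intro!: derivative_eq_intros simp: algebra_simps)
    moreover have "((\<lambda>w. of_real pi / sin (of_real pi * w)) has_field_derivative
        - (of_real pi * (of_real pi * cos (of_real pi * w)) / (sin (of_real pi * w))\<^sup>2)) (at w)"
      using ni[OF w] by (auto intro!: derivative_eq_intros simp: power2_eq_square)
    ultimately have "Gamma w * Gamma (1 - w) * (Digamma w - Digamma (1 - w))
        = - (of_real pi * (of_real pi * cos (of_real pi * w)) / (sin (of_real pi * w))\<^sup>2)"
      unfolding Gamma_reflection_complex by (rule DERIV_unique)
    then have "of_real pi / sin (of_real pi * w) * (Digamma w - Digamma (1 - w))
        = of_real pi / sin (of_real pi * w) * (- (of_real pi * cos (of_real pi * w) / sin (of_real pi * w)))"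
      unfolding Gamma_reflection_complex by (simp add: power2_eq_square)
    then show ?thesis using ni[OF w] by (subst (asm) mult_left_cancel) auto
  qed
  have "((\<lambda>w. Digamma w - Digamma (1 - w)) has_field_derivative Polygamma 1 z + Polygamma 1 (1 - z)) (at z)"
    using ni[OF S(2)] by (auto intro!: derivative_eq_intros)
  moreover have "((\<lambda>w. Digamma w - Digamma (1 - w)) has_field_derivative (of_real pi / sin (of_real pi * z)) ^ 2) (at z)"
  proof (rule has_field_derivative_transform_within_open[OF _ S])
    have eq: "- ((- (p * (p * (s * s))) - p * (p * (c * c))) / (s * s)) = (p / s) ^ 2"
      if "s * s + c * c = 1" for p s c :: complex
    proof -
      have "- (- (p * (p * (s * s))) - p * (p * (c * c))) = p * p * (s * s + c * c)"
        by (simp add: algebra_simps)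
      then show ?thesis
        unfolding that by (simp only: minus_divide_left) (simp add: power2_eq_square)
    qed
    let ?s = "sin (of_real pi * z)" and ?c = "cos (of_real pi * z)"
    have "((\<lambda>w. - (of_real pi * cos (of_real pi * w) / sin (of_real pi * w))) has_field_derivative
        - ((- (of_real pi * (of_real pi * (?s * ?s))) - of_real pi * (of_real pi * (?c * ?c))) / (?s * ?s))) (at z)"
      using ni[OF S(2)] by (auto intro!: derivative_eq_intros simp: algebra_simps)
    moreover have "?s * ?s + ?c * ?c = 1"
      using sin_cos_squared_add[of "of_real pi * z"] by (simp add: power2_eq_square)
    ultimately show "((\<lambda>w. - (of_real pi * cos (of_real pi * w) / sin (of_real pi * w))) has_field_derivative (of_real pi / ?s) ^ 2) (at z)"
      using eq[of ?s ?c "of_real pi"] by (simp only: simp_thms)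
  qed (use 1 in simp)
  ultimately show ?thesis by (rule DERIV_unique)
qed

lemma has_sum_Polygamma_1:
  fixes z :: complex
  assumes "z \<noteq> 0"
  shows "((\<lambda>n. 1 / (of_nat n + z) ^ 2) has_sum Polygamma 1 z) UNIV"
proof (rule norm_summable_imp_has_sum)
  have "summable (\<lambda>n. inverse ((z + of_nat n) ^ 2))" by (rule Polygamma_converges'[OF assms]) simp
  from summable_sums[OF this] show "(\<lambda>n. 1 / (of_nat n + z) ^ 2) sums Polygamma 1 z"
    by (simp add: Polygamma_def inverse_eq_divide add.commute numeral_2_eq_2)
  show "summable (\<lambda>n. norm (1 / (of_nat n + z) ^ 2))"
  proof (rule summable_comparison_test_ev)
    show "summable (\<lambda>n. 4 * inverse (of_nat n ^ 2) :: real)"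
      by (intro summable_mult inverse_power_summable) simp
    show "\<forall>\<^sub>F n in sequentially. norm (norm (1 / (of_nat n + z) ^ 2)) \<le> 4 * inverse (of_nat n ^ 2)"
    proof (rule eventually_sequentiallyI)
      \<comment> \<open>Once n \<ge> 2 |z| one has |n + z| \<ge> n/2, whence the factor 4.\<close>
      fix n :: nat assume n: "n \<ge> nat \<lceil>2 * norm z\<rceil> + 1"
      have "norm (of_nat n :: complex) - norm (- z) \<le> norm (of_nat n - (- z))" by (rule norm_triangle_ineq2)
      moreover have "real n \<ge> 2 * norm z" "n > 0" using n by linarith+
      ultimately have "real n / 2 \<le> norm (of_nat n + z)" "n > 0" by simp_all
      then have "(real n / 2) ^ 2 \<le> norm (of_nat n + z) ^ 2" by (intro power_mono) auto
      then have "1 / norm (of_nat n + z) ^ 2 \<le> 1 / (real n / 2) ^ 2" using \<open>n > 0\<close> by (intro divide_left_mono mult_pos_pos) auto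
      then show "norm (norm (1 / (of_nat n + z) ^ 2)) \<le> 4 * inverse (of_nat n ^ 2)"
        by (simp add: norm_divide norm_power power_divide inverse_eq_divide)
    qed
  qed
qed

lemma has_sum_inverse_squares_int:
  fixes z :: complex
  assumes "z \<notin> \<int>"
  shows "((\<lambda>m::int. 1 / (of_int m + z) ^ 2) has_sum (of_real pi / sin (of_real pi * z)) ^ 2) UNIV"
proof -
  have nz: "z \<noteq> 0" "1 - z \<noteq> 0" using assms by auto
  have "(of_int (- int n - 1) + z) ^ 2 = (of_nat n + (1 - z)) ^ 2" for n
    by (simp add: power2_eq_square algebra_simps)
  then have "((\<lambda>n::nat. 1 / (of_int (- int n - 1) + z) ^ 2) has_sum Polygamma 1 (1 - z)) UNIV"
    using has_sum_Polygamma_1[OF nz(2)] by simp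
  from has_sum_int_splitI[OF _ this] has_sum_Polygamma_1[OF nz(1)]
  show ?thesis by (simp add: Polygamma_1_reflection[OF assms, symmetric])
qed

text \<open>With Q = q^n the squared cosecant over (2 pi i)^2 is Q / (1 - Q)^2. This is invariant
  under Q \<mapsto> 1/Q, so only |n| matters.\<close>

lemma eisenstein_inner_sum:
  assumes im: "Im \<tau> > 0" and n: "n \<noteq> 0"
  shows "(\<Sum>\<^sub>\<infinity>m. 1 / period \<tau> m n ^ 2) = qpar \<tau> ^ nat \<bar>n\<bar> / (1 - qpar \<tau> ^ nat \<bar>n\<bar>) ^ 2"
proof -
  define x where "x = of_int n * \<tau>"
  define Q where "Q = exp (2 * of_real pi * \<i> * x)"
  have "Im x \<noteq> 0" using assms by (simp add: x_def)
  then have x: "x \<notin> \<int>" by (auto elim!: Ints_cases)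
  have "1 / period \<tau> m n ^ 2 = (1 / (2 * of_real pi * \<i>) ^ 2) * (1 / (of_int m + x) ^ 2)" for m
  proof -
    have "period \<tau> m n = (2 * of_real pi * \<i>) * (of_int m + x)"
      by (simp add: period_def x_def algebra_simps)
    then show ?thesis by (simp only: power_mult_distrib) simp
  qed
  then have "(\<Sum>\<^sub>\<infinity>m. 1 / period \<tau> m n ^ 2) = (1 / (2 * of_real pi * \<i>) ^ 2) * (\<Sum>\<^sub>\<infinity>m. 1 / (of_int m + x) ^ 2)"
    by (simp only: infsum_cmult_right')
  also have "\<dots> = (1 / (2 * of_real pi * \<i>) ^ 2) * (of_real pi / sin (of_real pi * x)) ^ 2"
    using infsumI[OF has_sum_inverse_squares_int[OF x]] by simp
  also have "\<dots> = - 1 / (4 * sin (of_real pi * x) ^ 2)"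
    by (simp add: power_mult_distrib power_divide)
  also have "4 * sin (of_real pi * x) ^ 2 = - ((1 - Q) ^ 2) / Q"
  proof -
    define e where "e = exp (\<i> * (of_real pi * x))"
    have e: "e \<noteq> 0" "Q = e ^ 2" "exp (- (\<i> * (of_real pi * x))) = 1 / e"
      by (simp_all add: e_def Q_def exp_minus inverse_eq_divide mult_ac flip: exp_double)
    show ?thesis
      unfolding sin_exp_eq e(2) e_def[symmetric] e(3) using e(1)
      by (simp add: field_simps power2_eq_square)
  qed
  also have "- 1 / (- ((1 - Q) ^ 2) / Q) = Q / (1 - Q) ^ 2" by simp
  also have "Q / (1 - Q) ^ 2 = qpar \<tau> ^ nat \<bar>n\<bar> / (1 - qpar \<tau> ^ nat \<bar>n\<bar>) ^ 2"
  proof (cases "n > 0")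
    case True
    then have "Q = qpar \<tau> ^ nat \<bar>n\<bar>"
      by (simp add: Q_def qpar_def x_def mult_ac flip: exp_of_nat_mult)
    then show ?thesis by simp
  next
    case False
    have "Q * qpar \<tau> ^ nat \<bar>n\<bar> = 1"
      using False by (simp add: Q_def qpar_def x_def mult_ac flip: exp_of_nat_mult exp_add)
    then have "qpar \<tau> ^ nat \<bar>n\<bar> = 1 / Q" by (simp add: Q_def field_simps)
    moreover have "Q \<noteq> 0" by (simp add: Q_def)
    moreover have "Q / (1 - Q) ^ 2 = (1 / Q) / (1 - 1 / Q) ^ 2"
    proof -
      have "(1 - 1 / Q) ^ 2 = (1 - Q) ^ 2 / Q ^ 2"
        using \<open>Q \<noteq> 0\<close> by (simp add: power2_eq_square divide_simps) (simp add: algebra_simps)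
      then show ?thesis using \<open>Q \<noteq> 0\<close> by (simp add: power2_eq_square)
    qed
    ultimately show ?thesis by simp
  qed
  finally show ?thesis .
qed

text \<open>Twice pi^2/6 divided by (2 pi i)^2; the summand m = 0 is 1 / 0 = 0.\<close>

lemma eisenstein_inner_sum_0: "(\<Sum>\<^sub>\<infinity>m. 1 / period \<tau> m 0 ^ 2) = - 1 / 12"
proof -
  have p: "1 / period \<tau> m 0 ^ 2 = (1 / (2 * of_real pi * \<i>) ^ 2) * (1 / of_int m ^ 2)" for m
    by (simp add: period_def power_mult_distrib)
  have s: "((\<lambda>n::nat. 1 / of_nat (Suc n) ^ 2 :: complex) has_sum of_real (pi\<^sup>2 / 6)) UNIV"
  proof -
    have "((\<lambda>n::nat. 1 / (real n + 1) ^ 2) has_sum (pi\<^sup>2 / 6)) UNIV"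
      by (rule norm_summable_imp_has_sum) (use inverse_squares_sums in \<open>auto simp: sums_iff add.commute\<close>)
    from has_sum_of_real[OF this, where ?'a = complex] show ?thesis by (simp add: add.commute)
  qed
  have "((\<lambda>n::nat. 1 / of_nat n ^ 2 :: complex) has_sum of_real (pi\<^sup>2 / 6)) UNIV"
  proof -
    have r: "((\<lambda>n::nat. 1 / of_nat n ^ 2 :: complex) has_sum of_real (pi\<^sup>2 / 6)) (range Suc)"
      using s by (subst has_sum_reindex) (auto simp: o_def)
    have "1 / of_nat n ^ 2 = (0::complex)" if "n \<notin> range Suc" for n
      using that by (cases n) auto
    then show ?thesis
      by (intro has_sum_cong_neutral[THEN iffD1, OF _ _ _ r]) auto
  qed
  moreover have "((\<lambda>n::nat. 1 / of_int (- int n - 1) ^ 2 :: complex) has_sum of_real (pi\<^sup>2 / 6)) UNIV"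
  proof -
    have "of_int (- int n - 1) ^ 2 = (of_nat (Suc n) ^ 2 :: complex)" for n
      by (simp add: power2_eq_square algebra_simps)
    then show ?thesis using s by simp
  qed
  ultimately have "((\<lambda>m::int. 1 / of_int m ^ 2 :: complex) has_sum (of_real (pi\<^sup>2 / 6) + of_real (pi\<^sup>2 / 6))) UNIV"
    by (intro has_sum_int_splitI) simp_all
  from infsumI[OF this] show ?thesis
    unfolding p infsum_cmult_right' by (simp add: power_mult_distrib mult.commute)
qed

lemma has_sum_nat_times_power:
  fixes x :: "'a :: {real_normed_field, banach}"
  assumes "norm x < 1"
  shows "((\<lambda>k. of_nat k * x ^ k) has_sum (x / (1 - x) ^ 2)) UNIV"
proof -
  have sums: "(\<lambda>k. of_nat k * y ^ k) sums (y / (1 - y) ^ 2)"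
    if "norm y < 1" for y :: "'b :: {real_normed_field, banach}"
  proof -
    have "(\<lambda>k. y * (of_nat (Suc k) * y ^ k)) sums (y * (1 / (1 - y) ^ 2))"
      by (intro sums_mult geometric_deriv_sums that)
    then have "(\<lambda>k. of_nat (Suc k) * y ^ Suc k) sums (y / (1 - y) ^ 2 - of_nat 0 * y ^ 0)"
      by (simp add: mult_ac)
    then show ?thesis by (subst (asm) sums_Suc_iff) simp
  qed
  show ?thesis
  proof (rule norm_summable_imp_has_sum[OF _ sums[OF assms]])
    show "summable (\<lambda>k. norm (of_nat k * x ^ k))"
      using sums_summable[OF sums[of "norm x"]] assms by (simp add: norm_mult norm_power)
  qed
qed

text \<open>Both sides are iterated sums of k q^(n k), by rows and by columns. Absolute summability
  comes from the row formula applied to |q|.\<close>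

lemma lambert_series_swap:
  fixes q :: complex
  assumes q: "norm q < 1"
  shows "(\<Sum>\<^sub>\<infinity>n::nat. q ^ n / (1 - q ^ n) ^ 2) = (\<Sum>\<^sub>\<infinity>k::nat. of_nat k * (q ^ k / (1 - q ^ k)))"
    and "(\<lambda>n::nat. q ^ n / (1 - q ^ n) ^ 2) summable_on UNIV"
proof -
  \<comment> \<open>Index 0 must be left out of the double sum, since the row n = 0 would diverge.
    In the single sums its term is 0.\<close>
  define A where "A = {1::nat..}"
  define r where "r = norm q"
  have r: "0 \<le> r" "r < 1" using q by (auto simp: r_def)
  have rn: "r ^ n \<le> r" if "n \<in> A" for n
    using power_decreasing[of 1 n r] that r by (auto simp: A_def)
  have UA: "UNIV - A = {0}" by (auto simp: A_def)
  have row: "((\<lambda>k. of_nat k * y ^ (n * k)) has_sum (y ^ n / (1 - y ^ n) ^ 2)) A"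
    if "norm y < 1" "n \<in> A" for n and y :: "'b :: {real_normed_field, banach}"
  proof -
    have "norm (y ^ n) < 1" using that by (auto simp: A_def norm_power power_less_one_iff)
    from has_sum_nat_times_power[OF this]
    show ?thesis by (rule has_sum_cong_neutral[THEN iffD1, rotated 3]) (auto simp: A_def power_mult)
  qed
  have summ: "(\<lambda>n. r ^ n / (1 - r ^ n) ^ 2) summable_on A"
  proof (rule summable_on_comparison_test)
    have "(\<lambda>n. r ^ n * (1 / (1 - r) ^ 2)) summable_on UNIV"
      using r by (intro summable_on_cmult_left norm_summable_imp_summable_on) (simp add: norm_power summable_geometric)
    then show "(\<lambda>n. r ^ n * (1 / (1 - r) ^ 2)) summable_on A"
      by (rule summable_on_subset_banach) simp
    fix n assume n: "n \<in> A"
    have "(1 - r) ^ 2 \<le> (1 - r ^ n) ^ 2" using rn[OF n] r by (intro power_mono) auto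
    then have "1 / (1 - r ^ n) ^ 2 \<le> 1 / (1 - r) ^ 2" using r rn[OF n] by (intro divide_left_mono mult_pos_pos) auto
    then show "r ^ n / (1 - r ^ n) ^ 2 \<le> r ^ n * (1 / (1 - r) ^ 2)"
      using r mult_left_mono[of "1 / (1 - r ^ n) ^ 2" "1 / (1 - r) ^ 2" "r ^ n"] by simp
    show "0 \<le> r ^ n / (1 - r ^ n) ^ 2" using r by simp
  qed
  have "(\<lambda>(n, k). of_nat k * r ^ (n * k)) summable_on (A \<times> A)"
    by (rule summable_on_SigmaI[where g = "\<lambda>n. r ^ n / (1 - r ^ n) ^ 2"])
       (use row[of r] r summ in auto)
  then have "(\<lambda>x. norm (case x of (n, k) \<Rightarrow> of_nat k * q ^ (n * k))) summable_on (A \<times> A)"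
    by (simp add: case_prod_unfold norm_mult norm_power r_def)
  then have dbl: "(\<lambda>(n, k). of_nat k * q ^ (n * k)) summable_on (A \<times> A)"
    by (rule abs_summable_summable)
  have "(\<Sum>\<^sub>\<infinity>n\<in>A. \<Sum>\<^sub>\<infinity>k\<in>A. of_nat k * q ^ (n * k)) = (\<Sum>\<^sub>\<infinity>k\<in>A. \<Sum>\<^sub>\<infinity>n\<in>A. of_nat k * q ^ (n * k))"
    by (rule infsum_swap_banach[OF dbl])
  also have "(\<Sum>\<^sub>\<infinity>n\<in>A. \<Sum>\<^sub>\<infinity>k\<in>A. of_nat k * q ^ (n * k)) = (\<Sum>\<^sub>\<infinity>n\<in>A. q ^ n / (1 - q ^ n) ^ 2)"
    by (rule infsum_cong) (use row[OF q] infsumI in blast)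
  also have "\<dots> = (\<Sum>\<^sub>\<infinity>n. q ^ n / (1 - q ^ n) ^ 2)"
    by (rule infsum_cong_neutral) (auto simp: UA)
  also have "(\<Sum>\<^sub>\<infinity>k\<in>A. \<Sum>\<^sub>\<infinity>n\<in>A. of_nat k * q ^ (n * k)) = (\<Sum>\<^sub>\<infinity>k\<in>A. of_nat k * (q ^ k / (1 - q ^ k)))"
  proof (rule infsum_cong)
    fix k assume k: "k \<in> A"
    have n1: "norm (q ^ k) < 1" using k q by (auto simp: A_def norm_power power_less_one_iff)
    have "((\<lambda>n. if n = 0 then 0 else (q ^ k) ^ n) has_sum (q ^ k / (1 - q ^ k))) UNIV"
      by (rule has_sum_geometric_from_1[OF n1])
    then have "((\<lambda>n. q ^ (n * k)) has_sum (q ^ k / (1 - q ^ k))) A"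
      by (rule has_sum_cong_neutral[THEN iffD1, rotated 3]) (auto simp: A_def mult.commute simp flip: power_mult)
    from infsumI[OF has_sum_cmult_right[OF this]]
    show "(\<Sum>\<^sub>\<infinity>n\<in>A. of_nat k * q ^ (n * k)) = of_nat k * (q ^ k / (1 - q ^ k))" .
  qed
  also have "\<dots> = (\<Sum>\<^sub>\<infinity>k. of_nat k * (q ^ k / (1 - q ^ k)))"
    by (rule infsum_cong_neutral) (auto simp: UA)
  finally show "(\<Sum>\<^sub>\<infinity>n::nat. q ^ n / (1 - q ^ n) ^ 2) = (\<Sum>\<^sub>\<infinity>k::nat. of_nat k * (q ^ k / (1 - q ^ k)))" .
  have "(\<lambda>n. \<Sum>\<^sub>\<infinity>k\<in>A. of_nat k * q ^ (n * k)) summable_on A"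
    using summable_on_Sigma_banach[OF dbl] by simp
  also have "?this \<longleftrightarrow> (\<lambda>n. q ^ n / (1 - q ^ n) ^ 2) summable_on A"
    by (rule summable_on_cong) (use row[OF q] infsumI in blast)
  also have "\<dots> \<longleftrightarrow> (\<lambda>n. q ^ n / (1 - q ^ n) ^ 2) summable_on UNIV"
    by (rule summable_on_cong_neutral) (auto simp: UA)
  finally show "(\<lambda>n::nat. q ^ n / (1 - q ^ n) ^ 2) summable_on UNIV" .
qed

text \<open>The row n = 0 gives -1/12 and the rows n and -n are equal, so the lattice sum is -1/12 +
  2 S with S the Lambert series, while the second derivative of \<open>log_sigma\<close> at 0 is 2
  S.\<close>

lemma eisenstein_G_2:
  assumes im: "Im \<tau> > 0"
  shows "eisenstein_G 2 \<tau> = - 1 / 24 + deriv (deriv (log_sigma \<tau>)) 0 / 2"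
proof -
  let ?q = "qpar \<tau>"
  let ?S = "\<Sum>\<^sub>\<infinity>k::nat. of_nat k * (?q ^ k / (1 - ?q ^ k))"
  define a where "a = (\<lambda>n::nat. ?q ^ n / (1 - ?q ^ n) ^ 2)"
  have q: "norm ?q < 1" using qpar_nontrivial[OF im, of 1] by auto
  \<comment> \<open>Including the excluded origin changes nothing, as its summand is 1 / 0 =
    0.\<close>
  have inner: "(\<Sum>\<^sub>\<infinity>m\<in>{m::int. (m, n) \<noteq> (0, 0)}. 1 / period \<tau> m n ^ 2) = (\<Sum>\<^sub>\<infinity>m. 1 / period \<tau> m n ^ 2)" for n
    by (rule infsum_cong_neutral) (auto simp: period_def)
  have s: "(a has_sum ?S) UNIV"
    using has_sum_infsum[OF lambert_series_swap(2)[OF q]] by (simp add: lambert_series_swap(1)[OF q] a_def)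
  have s': "((\<lambda>n. a (Suc n)) has_sum ?S) UNIV"
  proof -
    have "a n = 0" if "n \<notin> range Suc" for n using that by (cases n) (auto simp: a_def)
    then have "(a has_sum ?S) (range Suc)"
      by (intro has_sum_cong_neutral[THEN iffD1, OF _ _ _ s]) auto
    then show ?thesis by (subst (asm) has_sum_reindex) (auto simp: o_def)
  qed
  have "((\<lambda>n::int. if n = 0 then - 1 / 12 else a (nat \<bar>n\<bar>)) has_sum
      (?S + (- 1 / 12) + ?S)) UNIV"
  proof (rule has_sum_int_splitI)
    have "((\<lambda>n::nat. if n = 0 then - 1 / 12 else 0) has_sum (- 1 / 12 :: complex)) UNIV"
      using has_sum_finite_neutralI[of "{0::nat}" UNIV "\<lambda>n. if n = 0 then - 1 / 12 else (0::complex)"] by simp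
    from has_sum_add[OF s this]
    show "((\<lambda>n. if int n = 0 then - 1 / 12 else a (nat \<bar>int n\<bar>)) has_sum
        (?S + (- 1 / 12))) UNIV"
      by (rule has_sum_cong[THEN iffD1, rotated]) (auto simp: a_def)
    have "nat \<bar>- int n - 1\<bar> = Suc n" "- int n - 1 \<noteq> 0" for n by auto
    then show "((\<lambda>n. if - int n - 1 = 0 then - 1 / 12 else a (nat \<bar>- int n - 1\<bar>)) has_sum
        ?S) UNIV"
      using s' by simp
  qed
  moreover have "(if n = 0 then - 1 / 12 else a (nat \<bar>n\<bar>)) = (\<Sum>\<^sub>\<infinity>m. 1 / period \<tau> m n ^ 2)" for n
    using eisenstein_inner_sum[OF im, of n] eisenstein_inner_sum_0[of \<tau>] by (auto simp: a_def)
  ultimately have "(\<Sum>\<^sub>\<infinity>n. \<Sum>\<^sub>\<infinity>m. 1 / period \<tau> m n ^ 2)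
      = ?S + (- 1 / 12) + ?S"
    using infsumI by simp
  moreover have "deriv (deriv (log_sigma \<tau>)) 0 = 2 * ?S"
    using infsumI[OF deriv2_log_sigma_0[OF im]] by (simp only: mult.assoc infsum_cmult_right')
  ultimately show ?thesis unfolding eisenstein_G_def inner by (simp add: field_simps)
qed

text \<open>1/4 - 3 x = -6 (-1/24 + x/2) with x the second derivative of \<open>log_sigma\<close> at
  0; the 6 is cancelled by 3!.\<close>

lemma theta_fps_at_0_nth_3:
  assumes "Im \<tau> > 0"
  shows "theta_fps \<tau> 0 $ 3 = - eisenstein_G 2 \<tau>"
proof -
  have "(deriv ^^ 3) (theta \<tau>) 0 = - 6 * eisenstein_G 2 \<tau>"
    unfolding deriv3_theta_0[OF assms] eisenstein_G_2[OF assms] by (simp add: algebra_simps)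
  then show ?thesis by (simp add: fps_expansion_def fact_numeral)
qed

section \<open>Homogeneity of the Taylor coefficients\<close>

lemma higher_deriv_theta_add_2pi:
  assumes "Im \<tau> > 0"
  shows "(deriv ^^ n) (theta \<tau>) (z + 2 * of_real pi * \<i>) = - (deriv ^^ n) (theta \<tau>) z"
  using arg_cong[OF fps_expansion_theta_add_2pi[OF assms, of z], of "\<lambda>f. fps_nth f n"]
  by (simp add: fps_expansion_def field_simps)

lemma deriv_theta_add_tau:
  assumes "Im \<tau> > 0"
  defines "c \<equiv> \<lambda>z. - exp (- of_real pi * \<i> * \<tau>) * exp (- z)"
  shows "deriv (theta \<tau>) (z + tau_period \<tau>) = c z * (deriv (theta \<tau>) z - theta \<tau> z)"
    and "deriv (deriv (theta \<tau>)) (z + tau_period \<tau>)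
      = c z * (deriv (deriv (theta \<tau>)) z - 2 * deriv (theta \<tau>) z + theta \<tau> z)"
proof -
  note eq = fps_expansion_theta_add_tau[OF assms(1), of z]
  show "deriv (theta \<tau>) (z + tau_period \<tau>) = c z * (deriv (theta \<tau>) z - theta \<tau> z)"
    using arg_cong[OF eq, of "\<lambda>f. fps_nth f 1"] by (simp add: fps_mult_nth fps_expansion_def c_def)
  show "deriv (deriv (theta \<tau>)) (z + tau_period \<tau>)
      = c z * (deriv (deriv (theta \<tau>)) z - 2 * deriv (theta \<tau>) z + theta \<tau> z)"
    using arg_cong[OF eq, of "\<lambda>f. 2 * fps_nth f 2"]
    by (simp add: fps_mult_nth fps_expansion_def numeral_2_eq_2 c_def)
qed

text \<open>As a function of \<open>w\<close>, the quotient of the left-hand side by \<open>\<theta>(w)\<^sup>2\<close> minus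
  \<open>-(log \<theta>)''(w)\<close> is elliptic and has no pole, so it is constant.\<close>

lemma theta_addition:
  assumes im: "Im \<tau> > 0" and z: "z \<notin> period_lattice \<tau>"
  obtains e where "\<And>w. theta \<tau> (z + w) * theta \<tau> (z - w) / (theta \<tau> z)\<^sup>2
    = (deriv (theta \<tau>) w)\<^sup>2 - theta \<tau> w * deriv (deriv (theta \<tau>)) w - e * (theta \<tau> w)\<^sup>2"
proof -
  let ?t = "theta \<tau>" and ?t' = "deriv (theta \<tau>)" and ?t'' = "deriv (deriv (theta \<tau>))"
  define W where "W = 2 * pi * Im \<tau>"
  have W: "W > 0" using im by (simp add: W_def)
  have tz: "?t z \<noteq> 0" using z by (simp add: theta_eq_0_iff[OF im])
  have hol: "?t holomorphic_on A" "?t' holomorphic_on A" "?t'' holomorphic_on A" for A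
  proof -
    have 0: "?t holomorphic_on UNIV" by (rule theta_holomorphic[OF im])
    have 1: "?t' holomorphic_on UNIV" by (rule holomorphic_deriv[OF 0]) simp
    have 2: "?t'' holomorphic_on UNIV" by (rule holomorphic_deriv[OF 1]) simp
    show "?t holomorphic_on A" "?t' holomorphic_on A" "?t'' holomorphic_on A"
      by (rule holomorphic_on_subset[OF 0] holomorphic_on_subset[OF 1] holomorphic_on_subset[OF 2], simp)+
  qed
  have holc: "(\<lambda>w. ?t (z + w)) holomorphic_on A" "(\<lambda>w. ?t (z - w)) holomorphic_on A" for A
    by (rule holomorphic_on_compose[of "\<lambda>w. z + w" A ?t, unfolded o_def]
          holomorphic_on_compose[of "\<lambda>w. z - w" A ?t, unfolded o_def];
        (rule hol | intro holomorphic_intros))+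
  define N where "N = (\<lambda>w. ?t (z + w) * ?t (z - w) / (?t z)\<^sup>2 - ((?t' w)\<^sup>2 - ?t w * ?t'' w))"
  have holN: "N holomorphic_on A" for A
    unfolding N_def using tz by (intro holomorphic_intros hol holc) auto
  have 1: "(\<lambda>w. N w / (?t w)\<^sup>2) holomorphic_on {w. \<bar>Re w\<bar> < 2 * pi * Im \<tau> \<and> exp w \<noteq> 1}"
    using not_in_period_lattice_strip[OF im]
    by (intro holomorphic_intros holN hol) (auto simp: theta_eq_0_iff[OF im])
  have 2: "N (w + 2 * of_real pi * \<i>) / (?t (w + 2 * of_real pi * \<i>))\<^sup>2 = N w / (?t w)\<^sup>2" for w
  proof -
    have "?t (z + (w + 2 * of_real pi * \<i>)) = - ?t (z + w)"
      using theta_add_2pi[of \<tau> "z + w"] by (simp add: add_ac)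
    moreover have "?t (z - (w + 2 * of_real pi * \<i>)) = - ?t (z - w)"
      using theta_add_2pi[of \<tau> "z - (w + 2 * of_real pi * \<i>)"] by simp
    ultimately show ?thesis
      using higher_deriv_theta_add_2pi[OF im, of 1 w] higher_deriv_theta_add_2pi[OF im, of 2 w]
      by (simp add: N_def theta_add_2pi numeral_2_eq_2)
  qed
  have 4: "N (w + tau_period \<tau>) / (?t (w + tau_period \<tau>))\<^sup>2 = N w / (?t w)\<^sup>2 + 0" for w
  proof -
    let ?p = "tau_period \<tau>"
    \<comment> \<open>The multipliers of \<theta>(z + w) and \<theta>(z - w) are c exp (-z) and c
      exp z; their product c^2 is the multiplier of \<theta>(w)^2.\<close>
    define c where "c = - exp (- of_real pi * \<i> * \<tau>) * exp (- w)"
    have c0: "c \<noteq> 0" by (simp add: c_def)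
    have a: "?t (z + (w + ?p)) = c * exp (- z) * ?t (z + w)"
      using theta_add_tau[of \<tau> "z + w"] by (simp add: c_def add_ac exp_add exp_diff exp_minus field_simps)
    have b: "?t (z - (w + ?p)) = c * exp z * ?t (z - w)"
    proof -
      have "?t (z - w) = - exp (- of_real pi * \<i> * \<tau>) * exp (- (z - (w + ?p))) * ?t (z - (w + ?p))"
        using theta_add_tau[of \<tau> "z - (w + ?p)"] by simp
      then have "c * exp z * ?t (z - w) = (exp (- of_real pi * \<i> * \<tau>) * exp (- w) * exp z * exp (- of_real pi * \<i> * \<tau>) * exp (- (z - (w + ?p)))) * ?t (z - (w + ?p))"
        by (simp add: c_def)
      also have "exp (- of_real pi * \<i> * \<tau>) * exp (- w) * exp z * exp (- of_real pi * \<i> * \<tau>) * exp (- (z - (w + ?p))) = 1"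
        by (simp flip: exp_add)
      finally show ?thesis by simp
    qed
    have "N (w + ?p) = c\<^sup>2 * N w"
      unfolding N_def a b theta_add_tau[of \<tau> w, folded c_def] deriv_theta_add_tau[OF im, of w, folded c_def]
    proof -
      have e: "c * exp (- z) * ?t (z + w) * (c * exp z * ?t (z - w)) = c\<^sup>2 * (?t (z + w) * ?t (z - w))"
        by (simp add: exp_minus power2_eq_square)
      show "c * exp (- z) * ?t (z + w) * (c * exp z * ?t (z - w)) / (?t z)\<^sup>2 -
          ((c * (?t' w - ?t w))\<^sup>2 - c * ?t w * (c * (?t'' w - 2 * ?t' w + ?t w)))
        = c\<^sup>2 * (?t (z + w) * ?t (z - w) / (?t z)\<^sup>2 - ((?t' w)\<^sup>2 - ?t w * ?t'' w))"
        unfolding e by (simp add: power2_eq_square algebra_simps)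
    qed
    then show ?thesis using c0 by (simp add: theta_add_tau[of \<tau> w, folded c_def] power_mult_distrib)
  qed
  have t0: "(?t has_field_derivative ?t' w) (at w)" "(?t' has_field_derivative ?t'' w) (at w)"
    "(?t'' has_field_derivative deriv ?t'' w) (at w)" for w
    using holomorphic_derivI[OF hol(1) open_UNIV] holomorphic_derivI[OF hol(2) open_UNIV] holomorphic_derivI[OF hol(3) open_UNIV]
    by auto
  have v0: "?t 0 = 0" "?t' 0 = 1" "?t'' 0 = 0"
    using deriv_theta_0[OF im] higher_deriv_theta_0_even[OF im, of 2] by (simp_all add: numeral_2_eq_2)
  have N0: "N 0 = 0" using tz by (simp add: N_def v0 power2_eq_square)
  have dN: "(N has_field_derivative 0) (at 0)"
  proof -
    have d1: "((\<lambda>w. ?t (z + w)) has_field_derivative ?t' z * 1) (at 0)"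
      by (rule DERIV_chain2[where f = ?t and g = "\<lambda>w. z + w"]) (auto intro!: derivative_eq_intros t0)
    have d2: "((\<lambda>w. ?t (z - w)) has_field_derivative ?t' z * (- 1)) (at 0)"
      by (rule DERIV_chain2[where f = ?t and g = "\<lambda>w. z - w"]) (auto intro!: derivative_eq_intros t0)
    show ?thesis
      unfolding N_def power2_eq_square using tz
      by (auto intro!: derivative_eq_intros d1 d2 t0[of 0] simp: v0)
  qed
  \<comment> \<open>N and N' vanish at 0, the linear terms of \<theta>(z + w) \<theta>(z - w)
    cancelling. So the quotient by \<theta>(w)^2 has at most a simple pole with residue 0, which is
    the growth condition.\<close>
  have 3: "((\<lambda>w. w * (N w / (?t w)\<^sup>2)) \<longlongrightarrow> 0) (at 0)"
  proof -
    have "((\<lambda>w. inverse (?t w / w)) \<longlongrightarrow> inverse 1) (at 0)"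
      using t0(1)[of 0] v0 by (intro tendsto_inverse) (simp_all add: has_field_derivative_iff)
    moreover have "((\<lambda>w. N w / w) \<longlongrightarrow> 0) (at 0)"
      using dN N0 by (simp add: has_field_derivative_iff)
    ultimately have "((\<lambda>w. (N w / w) * (inverse (?t w / w) * inverse (?t w / w))) \<longlongrightarrow> 0 * (inverse 1 * inverse 1)) (at 0)"
      by (intro tendsto_mult)
    moreover have "\<forall>\<^sub>F w in at 0. N w / w * (inverse (?t w / w) * inverse (?t w / w)) = w * (N w / (?t w)\<^sup>2)"
      using eventually_neq_at_within[of "0::complex" 0 UNIV]
      by eventually_elim (simp add: power2_eq_square)
    ultimately show ?thesis by (auto elim: Lim_transform_eventually)
  qed
  obtain \<beta> where \<beta>: "\<And>w. \<bar>Re w\<bar> < W \<Longrightarrow> exp w \<noteq> 1 \<Longrightarrow> N w / (?t w)\<^sup>2 = \<beta>"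
    using strip_additive_const[OF im 1 2 3 4] unfolding W_def by blast
  have "N w = \<beta> * (?t w)\<^sup>2" for w
  proof (rule analytic_continuation_open[where s = "{w. \<bar>Re w\<bar> < W} - period_lattice \<tau>" and s' = UNIV
        and f = N and g = "\<lambda>w. \<beta> * (?t w)\<^sup>2"])
    show "open ({w. \<bar>Re w\<bar> < W} - period_lattice \<tau>)"
      by (rule open_Diff_period_lattice[OF im open_strip])
    have "of_real (W / 2) \<in> {w. \<bar>Re w\<bar> < W} - period_lattice \<tau>"
      using W not_in_period_lattice_strip[OF im, of "of_real (W / 2)"] exp_neq_1[of "of_real (W / 2)"] im
      by (simp add: W_def)
    then show "{w. \<bar>Re w\<bar> < W} - period_lattice \<tau> \<noteq> {}" by blast
    fix w assume w: "w \<in> {w. \<bar>Re w\<bar> < W} - period_lattice \<tau>"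
    then have nz: "?t w \<noteq> 0" by (simp add: theta_eq_0_iff[OF im])
    have "exp w \<noteq> 1"
      using w theta_eq_log_sigma[OF im, of w, unfolded exp_half_diff] nz by (auto simp: W_def)
    then show "N w = \<beta> * (?t w)\<^sup>2" using \<beta>[of w] w nz by (simp add: field_simps)
  qed (auto intro!: holN holomorphic_intros hol)
  then show ?thesis by (intro that[of "- \<beta>"]) (simp add: N_def algebra_simps)
qed

text \<open>The coefficient of w^n in the addition formula: T n are the Taylor coefficients of
  \<theta>(z + w) / \<theta>(z), and the signs come from \<theta>(z - w).\<close>

lemma theta_addition_fps:
  assumes im: "Im \<tau> > 0" and z: "z \<notin> period_lattice \<tau>"
  defines "T \<equiv> \<lambda>n. theta_quot n \<tau> z / fact n" and "t \<equiv> \<lambda>n. theta_fps \<tau> 0 $ n"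
  shows "(\<Sum>i\<le>n. T i * ((- 1) ^ (n - i) * T (n - i)))
    = (\<Sum>i\<le>n. of_nat (Suc i) * t (Suc i) * (of_nat (Suc (n - i)) * t (Suc (n - i))))
      - (\<Sum>i\<le>n. t i * (of_nat (Suc (n - i)) * of_nat (Suc (Suc (n - i))) * t (Suc (Suc (n - i)))))
      - ((theta_quot 1 \<tau> z)\<^sup>2 - theta_quot 2 \<tau> z) * (\<Sum>i\<le>n. t i * t (n - i))"
proof -
  let ?t = "theta \<tau>" and ?Th = "theta_fps \<tau> 0"
  have tz: "?t z \<noteq> 0" using z by (simp add: theta_eq_0_iff[OF im])
  obtain e where e: "\<And>w. ?t (z + w) * ?t (z - w) / (?t z)\<^sup>2
    = (deriv ?t w)\<^sup>2 - ?t w * deriv (deriv ?t) w - e * (?t w)\<^sup>2"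
    using theta_addition[OF im z] by blast
  define P where "P = fps_const (1 / ?t z) * fps_expansion ?t z"
  define M where "M = fps_const (1 / ?t z) * Abs_fps (\<lambda>n. (- 1) ^ n * (fps_expansion ?t z $ n))"
  have hol: "?t holomorphic_on A" for A by (rule theta_holomorphic[OF im])
  have m: "(\<lambda>w. ?t (z - w)) has_fps_expansion Abs_fps (\<lambda>n. (- 1) ^ n * (fps_expansion ?t z $ n))"
  proof -
    have "(\<lambda>w. ?t (z - w)) holomorphic_on UNIV"
      by (rule holomorphic_on_compose[of "\<lambda>w. z - w" UNIV ?t, unfolded o_def])
         (intro holomorphic_intros, rule hol)
    then have "(\<lambda>w. ?t (z - w)) analytic_on {0}"
      using analytic_on_open[of UNIV "\<lambda>w. ?t (z - w)"] analytic_on_subset[of _ UNIV "{0}"] by auto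
    then have "(\<lambda>w. ?t (z - w)) has_fps_expansion fps_expansion (\<lambda>w. ?t (z - w)) 0"
      by (rule analytic_at_imp_has_fps_expansion_0)
    moreover have "(deriv ^^ n) (\<lambda>w. ?t (- 1 * w + z)) 0 = (- 1) ^ n * (deriv ^^ n) ?t (- 1 * 0 + z)" for n
      by (rule higher_deriv_compose_linear'[OF hol[of UNIV], of UNIV]) auto
    then have "fps_expansion (\<lambda>w. ?t (z - w)) 0 = Abs_fps (\<lambda>n. (- 1) ^ n * (fps_expansion ?t z $ n))"
      by (simp add: fps_eq_iff fps_expansion_def)
    ultimately show ?thesis by simp
  qed
  have h0: "?t has_fps_expansion ?Th" using theta_has_fps_expansion[OF im, of 0] by simp
  have "(\<lambda>w. (1 / ?t z * ?t (z + w)) * (1 / ?t z * ?t (z - w))) has_fps_expansion P * M"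
    unfolding P_def M_def
    by (intro has_fps_expansion_mult has_fps_expansion_cmult_left theta_has_fps_expansion im m)
  moreover have "(\<lambda>w. (deriv ?t w) ^ 2 - ?t w * deriv (deriv ?t) w - e * (?t w) ^ 2) has_fps_expansion
      fps_deriv ?Th ^ 2 - ?Th * fps_deriv (fps_deriv ?Th) - fps_const e * ?Th ^ 2"
    by (intro has_fps_expansion_diff has_fps_expansion_power has_fps_expansion_mult
        has_fps_expansion_cmult_left has_fps_expansion_deriv h0)
  moreover have "(1 / ?t z * ?t (z + w)) * (1 / ?t z * ?t (z - w))
      = (deriv ?t w) ^ 2 - ?t w * deriv (deriv ?t) w - e * (?t w) ^ 2" for w
    unfolding e[symmetric] by (simp add: power2_eq_square)
  ultimately have eq: "P * M = fps_deriv ?Th ^ 2 - ?Th * fps_deriv (fps_deriv ?Th) - fps_const e * ?Th ^ 2"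
    using fps_expansion_unique_complex by simp
  have Pn: "P $ n = T n" "M $ n = (- 1) ^ n * T n" for n
    by (simp_all add: P_def M_def T_def theta_quot_def fps_expansion_def)
  have coeff: "(\<Sum>i\<le>n. T i * ((- 1) ^ (n - i) * T (n - i)))
    = (\<Sum>i\<le>n. of_nat (Suc i) * t (Suc i) * (of_nat (Suc (n - i)) * t (Suc (n - i))))
      - (\<Sum>i\<le>n. t i * (of_nat (Suc (n - i)) * of_nat (Suc (Suc (n - i))) * t (Suc (Suc (n - i)))))
      - e * (\<Sum>i\<le>n. t i * t (n - i))" for n
    using arg_cong[OF eq, of "\<lambda>f. fps_nth f n"]
    unfolding fps_sub_nth fps_mult_left_const_nth
    by (simp only: power2_eq_square fps_mult_nth Pn fps_deriv_nth
        atLeast0AtMost t_def mult.assoc Suc_eq_plus1)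
  have t012: "t 0 = 0" "t 1 = 1" "t 2 = 0"
    using theta_fps_at_0[OF im] higher_deriv_theta_0_even[OF im, of 2] by (simp_all add: t_def fps_expansion_def)
  have T0: "T 0 = 1" using tz by (simp add: T_def theta_quot_def)
  \<comment> \<open>At n = 2 the contributions 6 t_3 of the first two sums cancel, so this equation
    determines e; it carries no information about the third coefficient of \<theta>.\<close>
  have "e = (theta_quot 1 \<tau> z)\<^sup>2 - theta_quot 2 \<tau> z"
  proof -
    have "2 * T 2 - T 1 ^ 2 = - e"
      using coeff[of 2] t012 T0
      by (simp add: numeral_2_eq_2 atMost_Suc)
    then show ?thesis by (simp add: T_def algebra_simps)
  qed
  with coeff show ?thesis by simp
qed

text \<open>\<open>homogeneous\<close> concerns total functions, whose values at lattice points are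
  arbitrary. Agreement with such a function is asked only off the lattice, so identities between
  meromorphic functions may be used for rewriting.\<close>

definition quasi_homogeneous :: "nat \<Rightarrow> (complex \<Rightarrow> complex \<Rightarrow> complex) \<Rightarrow> bool" where
  "quasi_homogeneous d f \<longleftrightarrow>
     (\<exists>c. homogeneous qe_gens d c \<and> (\<forall>z \<tau>. Im \<tau> > 0 \<longrightarrow> z \<notin> period_lattice \<tau> \<longrightarrow> f z \<tau> = c (z, \<tau>)))"

lemma quasi_homogeneous_cong:
  assumes "quasi_homogeneous d f"
    "\<And>z \<tau>. Im \<tau> > 0 \<Longrightarrow> z \<notin> period_lattice \<tau> \<Longrightarrow> g z \<tau> = f z \<tau>"
  shows "quasi_homogeneous d g"
  using assms unfolding quasi_homogeneous_def by metis

lemma quasi_homogeneous_const: "quasi_homogeneous 0 (\<lambda>_ _. c)"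
  unfolding quasi_homogeneous_def by (intro exI[of _ "\<lambda>_. c"]) (auto intro: homogeneous.const)

lemma quasi_homogeneous_theta_quot: "k \<ge> 1 \<Longrightarrow> quasi_homogeneous k (\<lambda>z \<tau>. theta_quot k \<tau> z)"
  unfolding quasi_homogeneous_def
  by (intro exI[of _ "\<lambda>(z, \<tau>). theta_quot k \<tau> z"]) (auto intro!: homogeneous.gen simp: qe_gens_def)

lemma quasi_homogeneous_G2: "quasi_homogeneous 2 (\<lambda>z \<tau>. eisenstein_G 2 \<tau>)"
  unfolding quasi_homogeneous_def
  by (intro exI[of _ "\<lambda>(z, \<tau>). eisenstein_G 2 \<tau>"]) (auto intro!: homogeneous.gen simp: qe_gens_def)

lemma quasi_homogeneous_add:
  "quasi_homogeneous d f \<Longrightarrow> quasi_homogeneous d g \<Longrightarrow> quasi_homogeneous d (\<lambda>z \<tau>. f z \<tau> + g z \<tau>)"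
  unfolding quasi_homogeneous_def by (metis (mono_tags, lifting) homogeneous.add)

lemma quasi_homogeneous_mult:
  "quasi_homogeneous d f \<Longrightarrow> quasi_homogeneous e g \<Longrightarrow> quasi_homogeneous (d + e) (\<lambda>z \<tau>. f z \<tau> * g z \<tau>)"
  unfolding quasi_homogeneous_def by (metis (mono_tags, lifting) homogeneous.mult)

lemma quasi_homogeneous_mult':
  "quasi_homogeneous d f \<Longrightarrow> quasi_homogeneous e g \<Longrightarrow> n = d + e \<Longrightarrow> quasi_homogeneous n (\<lambda>z \<tau>. f z \<tau> * g z \<tau>)"
  using quasi_homogeneous_mult by blast

lemma quasi_homogeneous_cmult: "quasi_homogeneous d f \<Longrightarrow> quasi_homogeneous d (\<lambda>z \<tau>. c * f z \<tau>)"
  using quasi_homogeneous_mult[OF quasi_homogeneous_const, of d f c] by simp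

text \<open>Constants are homogeneous of degree 0 only; in degree d > 0 the zero function is 0 times
  a generator of that degree.\<close>

lemma quasi_homogeneous_0: "quasi_homogeneous d (\<lambda>_ _. 0)"
proof (cases "d = 0")
  case False
  then show ?thesis using quasi_homogeneous_cmult[OF quasi_homogeneous_theta_quot[of d], of 0] by simp
qed (auto intro: quasi_homogeneous_const)

lemma quasi_homogeneous_sum:
  "(\<And>i. i \<in> A \<Longrightarrow> quasi_homogeneous d (f i)) \<Longrightarrow> quasi_homogeneous d (\<lambda>z \<tau>. \<Sum>i\<in>A. f i z \<tau>)"
  by (induction A rule: infinite_finite_induct) (auto intro: quasi_homogeneous_0 quasi_homogeneous_add)

lemma quasi_homogeneous_diff:
  "quasi_homogeneous d f \<Longrightarrow> quasi_homogeneous d g \<Longrightarrow> quasi_homogeneous d (\<lambda>z \<tau>. f z \<tau> - g z \<tau>)"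
  using quasi_homogeneous_add[OF _ quasi_homogeneous_cmult[of d g "- 1"], of f] by simp

lemma quasi_homogeneous_theta_quot_fact:
  "quasi_homogeneous k (\<lambda>z \<tau>. theta_quot k \<tau> z / fact k)"
proof (cases "k = 0")
  case True
  show ?thesis
    by (rule quasi_homogeneous_cong[OF quasi_homogeneous_const[of 1, folded True]])
       (simp add: True theta_quot_def theta_eq_0_iff)
next
  case False
  then show ?thesis
    using quasi_homogeneous_cmult[OF quasi_homogeneous_theta_quot[of k], of "1 / fact k"] by simp
qed

text \<open>With t_n the coefficients of \<theta> at 0, the addition formula at w^k is linear in
  t_(k+1) with factor (k + 1)(2 - k). All its other terms are products of lower t_n and theta
  quotients of total weight k. The left side does not depend on z although the expression found for
  it does. The exceptional k = 2 is G_2.\<close>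

lemma quasi_homogeneous_theta_fps_0:
  "quasi_homogeneous k (\<lambda>z \<tau>. theta_fps \<tau> 0 $ Suc k)"
proof (induction k rule: less_induct)
  case (less k)
  define t where "t = (\<lambda>\<tau> n. theta_fps \<tau> 0 $ n)"
  have t0: "t \<tau> 0 = 0" "t \<tau> (Suc 0) = 1" if "Im \<tau> > 0" for \<tau>
    using theta_fps_at_0[OF that] by (simp_all add: t_def)
  have IH: "quasi_homogeneous i (\<lambda>z \<tau>. t \<tau> (Suc i))" if "i < k" for i
    using less[OF that] by (simp add: t_def)
  consider "k = 0" | "k = 2" | "k \<ge> 1" "k \<noteq> 2" by linarith
  then have "quasi_homogeneous k (\<lambda>z \<tau>. t \<tau> (Suc k))"
  proof cases
    case 1
    then show ?thesis
      by (intro quasi_homogeneous_cong[OF quasi_homogeneous_const[of 1, folded 1]]) (simp add: t0)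
  next
    case 2
    show ?thesis unfolding 2
      by (rule quasi_homogeneous_cong[OF quasi_homogeneous_cmult[OF quasi_homogeneous_G2, of "- 1"]])
         (simp add: t_def theta_fps_at_0_nth_3 flip: numeral_3_eq_3)
  next
    case 3
    \<comment> \<open>A to D are the four sums of the addition formula at w^k, with the terms
      containing t_(k+1) taken out: i = 0 and i = k in B, i = 1 in C. Terms with the factor t_0 = 0
      are dropped from C and D.\<close>
    define A where "A = (\<lambda>z \<tau>. \<Sum>i\<le>k. theta_quot i \<tau> z / fact i * ((- 1) ^ (k - i) * (theta_quot (k - i) \<tau> z / fact (k - i))))"
    define B where "B = (\<lambda>z::complex. \<lambda>\<tau>. \<Sum>i\<in>{1..<k}. of_nat (Suc i) * t \<tau> (Suc i) * (of_nat (Suc (k - i)) * t \<tau> (Suc (k - i))))"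
    define C where "C = (\<lambda>z::complex. \<lambda>\<tau>. \<Sum>i\<in>{2..k}. t \<tau> i * (of_nat (Suc (k - i)) * of_nat (Suc (Suc (k - i))) * t \<tau> (Suc (Suc (k - i)))))"
    define D where "D = (\<lambda>z \<tau>. ((theta_quot 1 \<tau> z)\<^sup>2 - theta_quot 2 \<tau> z) * (\<Sum>i\<in>{1..<k}. t \<tau> i * t \<tau> (k - i)))"
    have hA: "quasi_homogeneous k A" unfolding A_def
      by (intro quasi_homogeneous_sum quasi_homogeneous_mult'[OF quasi_homogeneous_theta_quot_fact
            quasi_homogeneous_cmult[OF quasi_homogeneous_theta_quot_fact]]) auto
    have hB: "quasi_homogeneous k B" unfolding B_def
      by (intro quasi_homogeneous_sum quasi_homogeneous_mult'[OF quasi_homogeneous_cmult[OF IH]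
            quasi_homogeneous_cmult[OF IH]]) auto
    have hC: "quasi_homogeneous k C" unfolding C_def
    proof (rule quasi_homogeneous_sum)
      fix i assume i: "i \<in> {2..k}"
      have "quasi_homogeneous (i - 1) (\<lambda>z \<tau>. t \<tau> i)"
      proof -
        have "i - 1 < k" "Suc (i - 1) = i" using i by auto
        then show ?thesis using IH[of "i - 1"] by simp
      qed
      moreover have "quasi_homogeneous (Suc (k - i)) (\<lambda>z \<tau>. t \<tau> (Suc (Suc (k - i))))"
      proof -
        have "Suc (k - i) < k" using i by auto
        then show ?thesis by (rule IH)
      qed
      ultimately show "quasi_homogeneous k (\<lambda>z \<tau>. t \<tau> i * (of_nat (Suc (k - i)) * of_nat (Suc (Suc (k - i))) * t \<tau> (Suc (Suc (k - i)))))"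
        by (rule quasi_homogeneous_mult'[OF _ quasi_homogeneous_cmult]) (use i in auto)
    qed
    \<comment> \<open>The product t_i t_(k-i) has weight (i - 1) + (k - i - 1) = k - 2, and the
      factor in front has weight 2; for k = 1 the sum is empty.\<close>
    have hD: "quasi_homogeneous k D"
    proof (cases "k \<ge> 2")
      case True
      have "quasi_homogeneous (k - 2) (\<lambda>z \<tau>. \<Sum>i\<in>{1..<k}. t \<tau> i * t \<tau> (k - i))"
      proof (rule quasi_homogeneous_sum)
        fix i assume i: "i \<in> {1..<k}"
        have "quasi_homogeneous (i - 1) (\<lambda>z \<tau>. t \<tau> i)" "quasi_homogeneous (k - i - 1) (\<lambda>z \<tau>. t \<tau> (k - i))"
        proof -
          have "i - 1 < k" "Suc (i - 1) = i" "k - i - 1 < k" "Suc (k - i - 1) = k - i" using i by auto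
          then show "quasi_homogeneous (i - 1) (\<lambda>z \<tau>. t \<tau> i)" "quasi_homogeneous (k - i - 1) (\<lambda>z \<tau>. t \<tau> (k - i))"
            using IH[of "i - 1"] IH[of "k - i - 1"] by simp_all
        qed
        then show "quasi_homogeneous (k - 2) (\<lambda>z \<tau>. t \<tau> i * t \<tau> (k - i))"
          by (rule quasi_homogeneous_mult') (use i in auto)
      qed
      moreover have "quasi_homogeneous 2 (\<lambda>z \<tau>. (theta_quot 1 \<tau> z)\<^sup>2 - theta_quot 2 \<tau> z)"
        unfolding power2_eq_square
        by (intro quasi_homogeneous_diff quasi_homogeneous_mult'[OF quasi_homogeneous_theta_quot quasi_homogeneous_theta_quot]
            quasi_homogeneous_theta_quot) auto
      ultimately show ?thesis unfolding D_def
        by (intro quasi_homogeneous_mult'[of 2 _ "k - 2"]) (use True in auto)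
    next
      case False
      then have "k = 1" using 3 by simp
      then show ?thesis by (simp add: D_def quasi_homogeneous_0)
    qed
    \<comment> \<open>2 (k + 1) from the two end terms of the first sum, minus k (k + 1) from the
      second.\<close>
    define c where "c = (of_nat (Suc k) * (2 - of_nat k) :: complex)"
    have "of_nat k \<noteq> (of_nat 2 :: complex)" using 3 unfolding of_nat_eq_iff by simp
    moreover have "of_nat (Suc k) \<noteq> (0 :: complex)" by (simp only: of_nat_eq_0_iff)
    ultimately have c: "c \<noteq> 0" by (simp add: c_def del: of_nat_Suc)
    have eq: "t \<tau> (Suc k) = 1 / c * (A z \<tau> + D z \<tau> - B z \<tau> + C z \<tau>)"
      if im: "Im \<tau> > 0" and z: "z \<notin> period_lattice \<tau>" for z \<tau>
    proof -
      have s1: "(\<Sum>i\<le>k. f i) = f 0 + (\<Sum>i\<in>{1..<k}. f i) + f k" for f :: "nat \<Rightarrow> complex"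
      proof -
        have "{..k} = insert 0 (insert k {1..<k})" using 3 by auto
        then show ?thesis using 3 by (simp add: add_ac)
      qed
      have s2: "(\<Sum>i\<le>k. f i) = f 0 + f 1 + (\<Sum>i\<in>{2..k}. f i)" for f :: "nat \<Rightarrow> complex"
      proof -
        have "{..k} = insert 0 (insert 1 {2..k})" using 3 by auto
        then show ?thesis by (simp add: add_ac)
      qed
      have "A z \<tau> = (2 * of_nat (Suc k) * t \<tau> (Suc k) + B z \<tau>)
          - (of_nat k * of_nat (Suc k) * t \<tau> (Suc k) + C z \<tau>) - D z \<tau>"
      proof -
        have b: "(\<Sum>i\<le>k. of_nat (Suc i) * t \<tau> (Suc i) * (of_nat (Suc (k - i)) * t \<tau> (Suc (k - i))))
            = 2 * of_nat (Suc k) * t \<tau> (Suc k) + B z \<tau>" (is "?B = _")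
          unfolding s1 B_def using t0[OF im] by simp
        have cc: "(\<Sum>i\<le>k. t \<tau> i * (of_nat (Suc (k - i)) * of_nat (Suc (Suc (k - i))) * t \<tau> (Suc (Suc (k - i)))))
            = of_nat k * of_nat (Suc k) * t \<tau> (Suc k) + C z \<tau>" (is "?C = _")
        proof -
          have "Suc (k - 1) = k" using 3 by simp
          then show ?thesis unfolding s2 C_def using t0[OF im] by simp
        qed
        have d: "((theta_quot 1 \<tau> z)\<^sup>2 - theta_quot 2 \<tau> z) * (\<Sum>i\<le>k. t \<tau> i * t \<tau> (k - i)) = D z \<tau>" (is "?D = _")
          unfolding s1 D_def using t0[OF im] by simp
        have "A z \<tau> = ?B - ?C - ?D"
          unfolding A_def t_def by (rule theta_addition_fps[OF im z])
        then show ?thesis unfolding b cc d .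
      qed
      then have "c * t \<tau> (Suc k) = A z \<tau> + D z \<tau> - B z \<tau> + C z \<tau>"
        by (simp add: c_def algebra_simps)
      then show ?thesis using c by (simp add: field_simps)
    qed
    show ?thesis
      by (rule quasi_homogeneous_cong[OF quasi_homogeneous_cmult[OF quasi_homogeneous_add[OF
              quasi_homogeneous_diff[OF quasi_homogeneous_add[OF hA hD] hB] hC], of "1 / c"] eq])
  qed
  then show ?case by (simp add: t_def)
qed

text \<open>Comparing coefficients in \<theta>(w) (w / \<theta>(w)) = w expresses each coefficient
  through earlier ones, and the recursion respects weights.\<close>

lemma quasi_homogeneous_theta_recip:
  "quasi_homogeneous n (\<lambda>z \<tau>. theta_recip_fps \<tau> $ n)"
proof (induction n rule: less_induct)
  case (less n)
  show ?case
  proof (cases "n = 0")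
    case True
    then show ?thesis
      by (intro quasi_homogeneous_cong[OF quasi_homogeneous_const[of 1, folded True]]) (simp add: theta_fps_at_0)
  next
    case False
    have eq: "theta_recip_fps \<tau> $ n = - 1 * (\<Sum>i\<in>{1..n}. theta_fps \<tau> 0 $ Suc i * theta_recip_fps \<tau> $ (n - i))"
      if im: "Im \<tau> > 0" for \<tau>
    proof -
      have "0 = (theta_fps \<tau> 0 * theta_recip_fps \<tau>) $ Suc n"
        unfolding theta_fps_at_0(3)[OF im] using False by simp
      also have "\<dots> = (\<Sum>i\<le>Suc n. theta_fps \<tau> 0 $ i * theta_recip_fps \<tau> $ (Suc n - i))"
        by (simp add: fps_mult_nth atLeast0AtMost)
      also have "\<dots> = (\<Sum>i\<le>n. theta_fps \<tau> 0 $ Suc i * theta_recip_fps \<tau> $ (n - i))"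
        unfolding sum.atMost_Suc_shift using theta_fps_at_0(1)[OF im] by simp
      also have "{..n} = insert 0 {1..n}" by auto
      finally show ?thesis using theta_fps_at_0(2)[OF im] by (simp add: eq_neg_iff_add_eq_0)
    qed
    have "quasi_homogeneous n (\<lambda>z \<tau>. \<Sum>i\<in>{1..n}. theta_fps \<tau> 0 $ Suc i * theta_recip_fps \<tau> $ (n - i))"
      by (intro quasi_homogeneous_sum quasi_homogeneous_mult'[OF quasi_homogeneous_theta_fps_0 less]) auto
    then show ?thesis
      by (intro quasi_homogeneous_cong[OF quasi_homogeneous_cmult[where c = "- 1"] eq])
  qed
qed

lemma kronecker_fps_nth_eq_sum:
  "kronecker_fps \<tau> z $ n = (\<Sum>i\<le>n. theta_quot i \<tau> z / fact i * theta_recip_fps \<tau> $ (n - i))"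
  unfolding kronecker_fps_nth fps_mult_nth sum_divide_distrib atLeast0AtMost
  by (intro sum.cong refl) (simp add: fps_expansion_def theta_quot_def)

lemma quasi_homogeneous_kronecker: "quasi_homogeneous n (\<lambda>z \<tau>. kronecker_fps \<tau> z $ n)"
  unfolding kronecker_fps_nth_eq_sum
  by (intro quasi_homogeneous_sum quasi_homogeneous_mult'[OF quasi_homogeneous_theta_quot_fact
        quasi_homogeneous_theta_recip]) auto

section \<open>Analytic continuation and weights\<close>

lemma g_term_eq_h_term:
  assumes "q \<noteq> 0"
  shows "g_term (Suc j) a q k u = (if k = 0 then (- 1) ^ a * (1 / 2) ^ Suc j else 0)
    + (- 1) ^ Suc j * h_term j q k (q powi (1 - int a) * u)"
proof (cases "k = 0")
  case False
  have "(int (Suc j) - int a) * k = int j * k + (1 - int a) * k" by (simp add: algebra_simps)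
  then have "q powi ((int (Suc j) - int a) * k) * u powi k = q powi (int j * k) * (q powi (1 - int a) * u) powi k"
    using assms by (simp add: power_int_add power_int_mult_distrib power_int_mult)
  then show ?thesis using False by (simp add: g_term_def h_term_def mult.assoc del: power_Suc)
qed (simp add: g_term_def h_term_def)

lemma h_region_g_region:
  assumes q: "q \<noteq> 0" "norm q < 1"
  shows "q powi (1 - int a) * u \<in> h_region j q \<longleftrightarrow> u \<in> g_region (Suc j) a q"
proof -
  define r where "r = norm q"
  have r: "r > 0" using q by (simp add: r_def)
  define s where "s = r powi (1 - int a)"
  have s: "s > 0" using r by (simp add: s_def)
  have 1: "s * r ^ a = r"
    unfolding s_def using r by (simp add: power_int_diff power_int_of_nat)
  have 2: "s * r powi (int a - int (Suc j)) * r ^ j = 1"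
    unfolding s_def using r by (simp add: power_int_diff power_int_of_nat power_int_add)
  have "q powi (1 - int a) * u \<in> h_region j q \<longleftrightarrow> r < s * norm u \<and> s * norm u * r ^ j < 1"
    by (simp add: h_region_def norm_mult norm_power_int r_def s_def)
  also have "r < s * norm u \<longleftrightarrow> s * r ^ a < s * norm u" using 1 by simp
  also have "\<dots> \<longleftrightarrow> r ^ a < norm u" using s by simp
  also have "s * norm u * r ^ j < 1 \<longleftrightarrow> norm u * (s * r ^ j) < r powi (int a - int (Suc j)) * (s * r ^ j)"
    using 2 by (simp add: mult_ac)
  also have "\<dots> \<longleftrightarrow> norm u < r powi (int a - int (Suc j))"
    using s r by (intro mult_less_cancel_right_pos) simp
  finally show ?thesis by (simp add: g_region_def r_def)
qed

lemma g_region_0_left: "a \<le> 0 \<Longrightarrow> g_region 0 a q = {}"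
  by (auto simp: g_region_def)

lemma open_g_region: "open (g_region b a q)"
  unfolding g_region_def by (intro open_Collect_conj open_Collect_less continuous_intros)

lemma g_term_locally_absolutely_convergent:
  assumes q: "q \<noteq> 0" "norm q < 1"
  shows "locally_absolutely_convergent_on (g_term (Suc j) a q) (g_region (Suc j) a q)"
  unfolding locally_absolutely_convergent_on_def
proof
  let ?h = "\<lambda>u. q powi (1 - int a) * u"
  fix x assume x: "x \<in> g_region (Suc j) a q"
  obtain U M where U: "open U" "?h x \<in> U" and M: "M summable_on (UNIV :: int set)"
    and le: "\<And>k u. u \<in> U \<Longrightarrow> norm (h_term j q k u) \<le> M k"
    using h_term_bound[OF q, of "?h x" j] x h_region_g_region[OF q] by metis
  define d where "d = (\<lambda>k::int. if k = 0 then norm ((- 1) ^ a * (1 / 2) ^ Suc j :: complex) else 0)"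
  have "d summable_on {0}" by simp
  then have "d summable_on UNIV"
    by (rule summable_on_cong_neutral[THEN iffD1, rotated 3]) (auto simp: d_def)
  with M have sum: "(\<lambda>k. d k + M k) summable_on UNIV" by (intro summable_on_add)
  have "norm (g_term (Suc j) a q k u) \<le> d k + M k" if "?h u \<in> U" for k u
  proof -
    have "norm (g_term (Suc j) a q k u) \<le> norm (if k = 0 then (- 1) ^ a * (1 / 2) ^ Suc j else 0 :: complex)
        + norm ((- 1) ^ Suc j * h_term j q k (?h u))"
      unfolding g_term_eq_h_term[OF q(1)] by (rule norm_triangle_ineq)
    moreover have "norm ((- 1) ^ Suc j * h_term j q k (?h u)) \<le> M k"
      using le[OF that, of k] by (simp add: norm_mult norm_power)
    moreover have "norm (if k = 0 then (- 1) ^ a * (1 / 2) ^ Suc j else 0 :: complex) = d k"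
      by (simp add: d_def)
    ultimately show ?thesis by linarith
  qed
  moreover have "open (?h -` U)" by (intro open_vimage U continuous_intros)
  ultimately show "\<exists>U M. open U \<and> x \<in> U \<and> M summable_on UNIV
      \<and> (\<forall>k. \<forall>u\<in>U \<inter> g_region (Suc j) a q. norm (g_term (Suc j) a q k u) \<le> M k)"
    using sum U(2) by (intro exI[of _ "?h -` U"] exI[of _ "\<lambda>k. d k + M k"]) auto
qed

lemma g_series_holomorphic:
  assumes q: "q \<noteq> 0" "norm q < 1"
  shows "g_series (Suc j) a q holomorphic_on g_region (Suc j) a q"
  unfolding g_series_def
proof (rule locally_absolutely_convergent_on_holomorphic[OF g_term_locally_absolutely_convergent[OF q] open_g_region])
  fix k
  have "u \<noteq> 0" if "u \<in> g_region (Suc j) a q" for u using that by (auto simp: g_region_def not_less_iff_gr_or_eq)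
  then show "g_term (Suc j) a q k holomorphic_on g_region (Suc j) a q"
    unfolding g_term_def by (cases "k = 0") (auto intro!: holomorphic_intros)
qed

lemma g_series_eq_h_series:
  assumes q: "q \<noteq> 0" "norm q < 1" and u: "u \<in> g_region (Suc j) a q"
  shows "g_series (Suc j) a q u
    = (- 1) ^ a * (1 / 2) ^ Suc j + (- 1) ^ Suc j * h_series j q (q powi (1 - int a) * u)"
proof -
  have "((\<lambda>k::int. if k = 0 then (- 1) ^ a * (1 / 2) ^ Suc j else 0) has_sum ((- 1) ^ a * (1 / 2) ^ Suc j :: complex)) UNIV"
    using has_sum_finite_neutralI[of "{0::int}" UNIV "\<lambda>k. if k = 0 then (- 1) ^ a * (1 / 2) ^ Suc j else (0::complex)"]
    by simp
  moreover have "((\<lambda>k. (- 1) ^ Suc j * h_term j q k (q powi (1 - int a) * u)) has_sum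
      ((- 1) ^ Suc j * h_series j q (q powi (1 - int a) * u))) UNIV"
    using u h_region_g_region[OF q] by (intro has_sum_cmult_right h_series_has_sum q) simp
  ultimately show ?thesis
    unfolding g_series_def g_term_eq_h_term[OF q(1)] by (intro infsumI has_sum_add)
qed

text \<open>The analytic continuation of \<open>g\<^bsub>j+1,a\<^esub>(e\<^sup>z)\<close>.\<close>

definition g_closed_form :: "nat \<Rightarrow> nat \<Rightarrow> complex \<Rightarrow> complex \<Rightarrow> complex" where
  "g_closed_form j a \<tau> z = (- 1) ^ a * (1 / 2) ^ Suc j
     + (- 1) ^ j * kronecker_coeff (Suc j) \<tau> (z + of_int (1 - int a) * tau_period \<tau>)"

lemma add_int_tau_in_period_lattice:
  assumes "Im \<tau> > 0"
  shows "z + of_int n * tau_period \<tau> \<in> period_lattice \<tau> \<longleftrightarrow> z \<in> period_lattice \<tau>"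
  using periodic_int_shift[of "\<lambda>z. theta \<tau> z = 0" "tau_period \<tau>" z n]
  by (simp add: theta_add_tau theta_eq_0_iff[OF assms])

lemma exp_add_int_tau:
  "exp (z + of_int n * tau_period \<tau>) = qpar \<tau> powi n * exp z"
  by (simp add: qpar_def exp_add exp_power_int mult_ac)

lemma g_series_eq_closed_form:
  assumes im: "Im \<tau> > 0" and z: "z \<notin> period_lattice \<tau>" "exp z \<in> g_region (Suc j) a (qpar \<tau>)"
  shows "g_series (Suc j) a (qpar \<tau>) (exp z) = g_closed_form j a \<tau> z"
proof -
  have q: "qpar \<tau> \<noteq> 0" "norm (qpar \<tau>) < 1" using qpar_nontrivial[OF im, of 1] by auto
  let ?z = "z + of_int (1 - int a) * tau_period \<tau>"
  have "h_series j (qpar \<tau>) (exp ?z) = - kronecker_coeff (Suc j) \<tau> ?z"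
    using z h_region_g_region[OF q, of a "exp z" j]
    by (intro h_series_eq_kronecker_coeff im)
       (simp_all only: add_int_tau_in_period_lattice[OF im] exp_add_int_tau simp_thms)
  then show ?thesis
    unfolding g_series_eq_h_series[OF q z(2)] exp_add_int_tau[symmetric] g_closed_form_def by simp
qed

lemma g_closed_form_add_2pi:
  "Im \<tau> > 0 \<Longrightarrow> g_closed_form j a \<tau> (z + 2 * of_real pi * \<i>) = g_closed_form j a \<tau> z"
  using kronecker_coeff_add_2pi[of \<tau> "Suc j" "z + of_int (1 - int a) * tau_period \<tau>"]
  by (simp add: g_closed_form_def add_ac)

lemma holomorphic_g_closed_form:
  assumes im: "Im \<tau> > 0"
  shows "g_closed_form j a \<tau> holomorphic_on - period_lattice \<tau>"
proof -
  let ?s = "\<lambda>z. z + of_int (1 - int a) * tau_period \<tau>"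
  have "(kronecker_coeff (Suc j) \<tau> \<circ> ?s) holomorphic_on - period_lattice \<tau>"
    by (rule holomorphic_on_compose_gen[of _ _ _ "- period_lattice \<tau>"])
       (auto intro!: holomorphic_intros holomorphic_kronecker_coeff im simp: add_int_tau_in_period_lattice[OF im] simp del: of_int_diff)
  then show ?thesis
    unfolding g_closed_form_def[abs_def] o_def by (intro holomorphic_intros)
qed

lemma meromorphic_g_closed_form:
  assumes im: "Im \<tau> > 0"
  shows "g_closed_form j a \<tau> meromorphic_on UNIV"
proof -
  have "(\<lambda>z. kronecker_coeff (Suc j) \<tau> (z + of_int (1 - int a) * tau_period \<tau>)) meromorphic_on UNIV"
    by (rule meromorphic_on_compose[OF meromorphic_kronecker_coeff[OF im, of _ UNIV]]) (auto intro!: analytic_intros)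
  then show ?thesis
    unfolding g_closed_form_def[abs_def] by (intro meromorphic_intros)
qed

text \<open>A base point halfway between the imaginary axis and the edge of the strip, used as a
  witness off the lattice.\<close>

lemma pi_Im_not_in_period_lattice:
  assumes im: "Im \<tau> > 0"
  shows "of_real (pi * Im \<tau>) \<notin> period_lattice \<tau>"
proof -
  have "exp (complex_of_real (pi * Im \<tau>)) \<noteq> 1" using im by (intro exp_neq_1) simp
  then show "of_real (pi * Im \<tau>) \<notin> period_lattice \<tau>"
    using im by (intro not_in_period_lattice_strip) simp_all
qed

text \<open>The region is the image under \<open>exp\<close> of the plane minus the countable
  lattice: connectedness passes to the image by continuity, openness by the open mapping
  theorem.\<close>

lemma regular_region:
  assumes im: "Im \<tau> > 0"
  defines "U \<equiv> - {0} - range (\<lambda>m::int. qpar \<tau> powi m)"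
  shows "open U" "connected U" "exp -` U = - period_lattice \<tau>" "0 \<notin> U"
proof -
  show pre: "exp -` U = - period_lattice \<tau>"
    using exp_in_range_qpar[OF im] by (auto simp: U_def)
  have img: "U = exp ` (UNIV - period_lattice \<tau>)"
  proof
    show "U \<subseteq> exp ` (UNIV - period_lattice \<tau>)"
    proof
      fix u assume u: "u \<in> U"
      then have "exp (Ln u) = u" by (simp add: U_def)
      with u pre show "u \<in> exp ` (UNIV - period_lattice \<tau>)" by (metis ComplI DiffI UNIV_I Compl_iff imageI vimageI)
    qed
    show "exp ` (UNIV - period_lattice \<tau>) \<subseteq> U" using pre by auto
  qed
  have "connected (UNIV - period_lattice \<tau>)"
    by (intro connected_open_diff_countable countable_period_lattice) auto
  then show "connected U" unfolding img by (intro connected_continuous_image continuous_intros)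
  have "\<not> exp constant_on (UNIV :: complex set)"
  proof
    assume "exp constant_on (UNIV :: complex set)"
    then have "exp (1 :: complex) = exp 0" unfolding constant_on_def by (metis UNIV_I)
    then show False using exp_neq_1[of 1] by simp
  qed
  then show "open U"
    unfolding img by (intro open_mapping_thm[of exp UNIV] open_Diff_period_lattice im holomorphic_on_exp) auto
  show "0 \<notin> U" by (simp add: U_def)
qed

lemma holomorphic_g_closed_form_Ln:
  assumes im: "Im \<tau> > 0"
  shows "(\<lambda>u. g_closed_form j a \<tau> (Ln u)) holomorphic_on - {0} - range (\<lambda>m::int. qpar \<tau> powi m)"
proof (rule holomorphic_on_comp_Ln)
  show "g_closed_form j a \<tau> holomorphic_on exp -` (- {0} - range (\<lambda>m::int. qpar \<tau> powi m))"
    unfolding regular_region(3)[OF im] by (rule holomorphic_g_closed_form[OF im])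
  show "g_closed_form j a \<tau> z = g_closed_form j a \<tau> w" if "exp z = exp w" for z w
    using exp_eq_imp_periodic_eq[of "g_closed_form j a \<tau>", OF g_closed_form_add_2pi[OF im] that] .
qed (use regular_region(1)[OF im] in auto)

text \<open>As in \<open>holomorphic_on_comp_Ln\<close>, a local branch of the logarithm replaces
  \<open>Ln\<close>; what remains is a meromorphic function composed with an analytic one.\<close>

lemma meromorphic_on_comp_Ln:
  assumes mero: "f meromorphic_on UNIV" and per: "\<And>z w. exp z = exp w \<Longrightarrow> f z = f w"
  shows "(\<lambda>u. f (Ln u)) meromorphic_on - {0}"
proof (subst meromorphic_on_meromorphic_at, rule ballI)
  fix u0 :: complex assume "u0 \<in> - {0}"
  then have nz: "u0 \<noteq> 0" by simp
  define g where "g = (\<lambda>u. Ln (u / u0) + Ln u0)"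
  have "g analytic_on {u0}"
    unfolding g_def using nz by (intro analytic_intros) auto
  then have "(\<lambda>u. f (g u)) meromorphic_on {u0}"
    by (intro meromorphic_on_compose[OF mero]) auto
  also have "?this \<longleftrightarrow> (\<lambda>u. f (Ln u)) meromorphic_on {u0}"
  proof (rule meromorphic_on_cong)
    fix z assume "z \<in> {u0}"
    then have "\<forall>\<^sub>F u in at z. u \<in> - {0}" using nz by (intro eventually_at_in_open') (auto simp: open_Compl)
    then show "\<forall>\<^sub>F u in at z. f (g u) = f (Ln u)"
    proof eventually_elim
      case (elim u)
      then have "u \<noteq> 0" by simp
      then have "exp (g u) = exp (Ln u)" using nz by (simp add: g_def exp_add)
      then show ?case by (rule per)
    qed
  qed simp
  finally show "(\<lambda>u. f (Ln u)) meromorphic_on {u0}" .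
qed

text \<open>The powers of q do not accumulate in the punctured plane: they are the images under
  \<open>exp\<close> of the zeros of \<theta>, which are isolated, and a local logarithm carries the
  isolation over to u.\<close>

lemma eventually_regular_point:
  assumes im: "Im \<tau> > 0" and u0: "u0 \<noteq> 0"
  shows "\<forall>\<^sub>F u in at u0. u \<in> - {0} - range (\<lambda>m::int. qpar \<tau> powi m)"
proof -
  have mero: "(\<lambda>u. (theta \<tau> (Ln u))\<^sup>2) meromorphic_on - {0}"
  proof (rule meromorphic_on_comp_Ln)
    show "(\<lambda>z. (theta \<tau> z)\<^sup>2) meromorphic_on UNIV"
      by (intro meromorphic_intros analytic_on_imp_meromorphic_on theta_analytic im)
    show "(theta \<tau> z)\<^sup>2 = (theta \<tau> w)\<^sup>2" if "exp z = exp w" for z w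
      by (rule exp_eq_imp_periodic_eq[OF _ that, of "\<lambda>z. (theta \<tau> z)\<^sup>2"]) (simp add: theta_add_2pi)
  qed
  define g where "g = (\<lambda>u. Ln (u / u0) + Ln u0)"
  have eg: "exp (g u) = u" if "u \<noteq> 0" for u using that u0 by (simp add: g_def exp_add)
  obtain r where r: "r > 0" "\<And>z. z \<in> ball (Ln u0) r - {Ln u0} \<Longrightarrow> theta \<tau> z \<noteq> 0"
  proof (cases "theta \<tau> (Ln u0) = 0")
    case True
    have "theta \<tau> (of_real (pi * Im \<tau>)) \<noteq> 0"
      using pi_Im_not_in_period_lattice[OF im] by (simp only: theta_eq_0_iff[OF im] not_False_eq_True)
    from isolated_zeros[OF theta_holomorphic[OF im, of UNIV] open_UNIV connected_UNIV UNIV_I True UNIV_I this]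
    show ?thesis using that by metis
  next
    case False
    have "open (UNIV - period_lattice \<tau>)" by (intro open_Diff_period_lattice im) auto
    moreover have "Ln u0 \<in> UNIV - period_lattice \<tau>" using False by (simp add: theta_eq_0_iff[OF im])
    ultimately obtain r where "r > 0" "ball (Ln u0) r \<subseteq> UNIV - period_lattice \<tau>"
      using open_contains_ball by blast
    then show ?thesis by (intro that[of r]) (auto simp: theta_eq_0_iff[OF im])
  qed
  have "isCont g u0" unfolding g_def using u0 by (intro continuous_intros) auto
  then have "(g \<longlongrightarrow> g u0) (at u0)" by (simp add: isCont_def)
  moreover have "g u0 = Ln u0" using u0 by (simp add: g_def)
  ultimately have "\<forall>\<^sub>F u in at u0. dist (g u) (Ln u0) < r" using r(1) by (simp add: tendsto_iff)
  moreover have "\<forall>\<^sub>F u in at u0. u \<in> - {0} - {u0}"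
    using u0 by (intro eventually_at_in_open) (auto simp: open_Compl)
  ultimately show ?thesis
  proof eventually_elim
    case (elim u)
    then have u: "u \<noteq> 0" "u \<noteq> u0" by auto
    then have "g u \<noteq> Ln u0" using eg[OF u(1)] u0 by (metis exp_Ln)
    then have "theta \<tau> (g u) \<noteq> 0" using elim by (intro r(2)) (simp add: dist_commute)
    then have "g u \<notin> period_lattice \<tau>" by (simp add: theta_eq_0_iff[OF im])
    then have "exp (g u) \<notin> range (\<lambda>m::int. qpar \<tau> powi m)" by (simp add: exp_in_range_qpar[OF im])
    then show ?case using eg[OF u(1)] u(1) by simp
  qed
qed

lemma g_continuation_exists:
  assumes im: "Im \<tau> > 0"
  shows "\<exists>F. g_continuation (Suc j) a (qpar \<tau>) F"
proof -
  let ?q = "qpar \<tau>"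
  define U where "U = - {0} - range (\<lambda>m::int. ?q powi m)"
  \<comment> \<open>The region may contain powers of q, where the series is regular but the closed
    form divides by 0. Using the series there makes F agree with it on the whole region.\<close>
  define F where "F = (\<lambda>u. if u \<in> g_region (Suc j) a ?q then g_series (Suc j) a ?q u else g_closed_form j a \<tau> (Ln u))"
  have eq: "F u = g_closed_form j a \<tau> (Ln u)" if "u \<in> U" for u
  proof -
    have u: "exp (Ln u) = u" using that by (simp add: U_def)
    then have "Ln u \<notin> period_lattice \<tau>" using that exp_in_range_qpar[OF im, of "Ln u"] by (simp add: U_def)
    then show ?thesis using g_series_eq_closed_form[OF im, of "Ln u" j a] u by (simp add: F_def)
  qed
  have "F holomorphic_on U"
    using holomorphic_g_closed_form_Ln[OF im, of j a, folded U_def] by (rule holomorphic_transform) (simp add: eq)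
  moreover have "F meromorphic_on - {0}"
  proof -
    have "(\<lambda>u. g_closed_form j a \<tau> (Ln u)) meromorphic_on - {0}"
      by (rule meromorphic_on_comp_Ln[OF meromorphic_g_closed_form[OF im] exp_eq_imp_periodic_eq[of "g_closed_form j a \<tau>", OF g_closed_form_add_2pi[OF im]]])
    also have "?this \<longleftrightarrow> F meromorphic_on - {0}"
    proof (rule meromorphic_on_cong)
      fix z :: complex assume "z \<in> - {0}"
      then have "\<forall>\<^sub>F u in at z. u \<in> U" unfolding U_def by (intro eventually_regular_point im) simp
      then show "\<forall>\<^sub>F u in at z. g_closed_form j a \<tau> (Ln u) = F u" by eventually_elim (simp add: eq)
    qed simp
    finally show ?thesis .
  qed
  ultimately show ?thesis unfolding g_continuation_def U_def by (intro exI[of _ F]) (auto simp: F_def)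
qed

text \<open>Any continuation is holomorphic on the connected regular region and agrees with the
  closed form where this meets the region of convergence, so the identity theorem determines it off
  the powers of q.\<close>

lemma g_continuation_eq_closed_form:
  assumes im: "Im \<tau> > 0" and a: "a \<le> Suc j"
    and F: "g_continuation (Suc j) a (qpar \<tau>) F" and z: "z \<notin> period_lattice \<tau>"
  shows "F (exp z) = g_closed_form j a \<tau> z"
proof -
  let ?q = "qpar \<tau>"
  define W where "W = 2 * pi * Im \<tau>"
  have W: "W > 0" using im by (simp add: W_def)
  define U where "U = - {0} - range (\<lambda>m::int. ?q powi m)"
  note U = regular_region[OF im, folded U_def]
  have ln: "Ln (exp z) \<notin> period_lattice \<tau>" "exp (Ln (exp z)) = exp z" if "exp z \<in> U" for z
    using that exp_in_range_qpar[OF im, of "Ln (exp z)"] by (auto simp: U_def)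
  have "F (exp z) = g_closed_form j a \<tau> (Ln (exp z))"
  proof (rule analytic_continuation_open[where s = "g_region (Suc j) a ?q \<inter> U" and s' = U
        and f = F and g = "\<lambda>u. g_closed_form j a \<tau> (Ln u)"])
    show "open (g_region (Suc j) a ?q \<inter> U)" by (intro open_Int open_g_region U)
    \<comment> \<open>The modulus of exp z1 is |q|^(a - 1/2), which lies in the region of
      convergence because b \<ge> 1, and is not that of a power of q.\<close>
    define z1 where "z1 = complex_of_real (pi * Im \<tau>) + of_int (int a) * tau_period \<tau>"
    have "z1 \<notin> period_lattice \<tau>"
      unfolding z1_def add_int_tau_in_period_lattice[OF im] by (rule pi_Im_not_in_period_lattice[OF im])
    then have "exp z1 \<in> U" using U(3) by auto
    moreover have "exp z1 \<in> g_region (Suc j) a ?q"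
    proof -
      have q: "?q \<noteq> 0" "norm ?q < 1" using qpar_nontrivial[OF im, of 1] by auto
      have e: "?q powi (1 - int a) * exp z1 = ?q * exp (of_real (pi * Im \<tau>))"
        unfolding z1_def exp_add_int_tau using q by (simp add: power_int_diff)
      have n: "norm (?q * exp (of_real (pi * Im \<tau>))) = exp (- (pi * Im \<tau>))"
        by (simp add: norm_mult norm_qpar flip: exp_add)
      have "norm ?q ^ j \<le> 1" using q by (intro power_le_one) auto
      moreover have "exp (- (pi * Im \<tau>)) < 1" "norm ?q < exp (- (pi * Im \<tau>))" using im by (simp_all add: norm_qpar)
      moreover have "exp (- (pi * Im \<tau>)) \<ge> 0" by simp
      ultimately have "?q * exp (of_real (pi * Im \<tau>)) \<in> h_region j ?q"
        unfolding h_region_def mem_Collect_eq n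
        using mult_left_mono[of "norm ?q ^ j" 1 "exp (- (pi * Im \<tau>))"] by linarith
      then show ?thesis using h_region_g_region[OF q, of a "exp z1" j] e by simp
    qed
    ultimately show "g_region (Suc j) a ?q \<inter> U \<noteq> {}" by blast
    show "F holomorphic_on U" using F by (simp add: g_continuation_def U_def)
    show "(\<lambda>u. g_closed_form j a \<tau> (Ln u)) holomorphic_on U"
      unfolding U_def by (rule holomorphic_g_closed_form_Ln[OF im])
    show "exp z \<in> U" using z U(3) by auto
    fix u assume u: "u \<in> g_region (Suc j) a ?q \<inter> U"
    then have e: "exp (Ln u) = u" by (simp add: U_def)
    then have "Ln u \<notin> period_lattice \<tau>" using u U(3) by (metis Compl_iff IntD2 vimageI)
    then have "g_series (Suc j) a ?q u = g_closed_form j a \<tau> (Ln u)"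
      using g_series_eq_closed_form[OF im, of "Ln u" j a] u e by simp
    then show "F u = g_closed_form j a \<tau> (Ln u)" using F u by (simp add: g_continuation_def)
  qed (use U in auto)
  also have "\<dots> = g_closed_form j a \<tau> z"
    by (rule exp_eq_imp_periodic_eq[of "g_closed_form j a \<tau>", OF g_closed_form_add_2pi[OF im]]) simp
  finally show ?thesis .
qed

text \<open>The transition matrix after a shift of z by m periods, which multiplies the Kronecker
  function by exp (-m w): the coefficient of s^b in w^i exp (-m w) s/w.\<close>

definition shifted_log_coeff :: "int \<Rightarrow> nat \<Rightarrow> nat \<Rightarrow> complex" where
  "shifted_log_coeff m i b = (\<Sum>n\<in>{i..b}. (- of_int m) ^ (n - i) / fact (n - i) * log_coeff n b)"

text \<open>The diagonal entry does not depend on the shift; with m = 1 - a this makes the leading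
  part independent of a.\<close>

lemma shifted_log_coeff_diag: "shifted_log_coeff m b b = 1"
  by (simp add: shifted_log_coeff_def log_coeff_simps(1))

lemma kronecker_coeff_add_int_tau:
  assumes "Im \<tau> > 0"
  shows "kronecker_coeff b \<tau> (z + of_int m * tau_period \<tau>)
    = (\<Sum>i\<le>b. shifted_log_coeff m i b * kronecker_fps \<tau> z $ i)"
proof -
  let ?c = "\<lambda>i n. (- of_int m) ^ (n - i) / fact (n - i) * kronecker_fps \<tau> z $ i * log_coeff n b"
  have "(fps_exp (- of_int m) * kronecker_fps \<tau> z) $ n
      = (\<Sum>i\<le>n. (- of_int m) ^ (n - i) / fact (n - i) * kronecker_fps \<tau> z $ i)" for n
    by (subst mult.commute) (simp add: fps_mult_nth atLeast0AtMost mult.commute)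
  then have "kronecker_coeff b \<tau> (z + of_int m * tau_period \<tau>) = (\<Sum>n\<le>b. \<Sum>i\<le>n. ?c i n)"
    unfolding kronecker_coeff_def kronecker_fps_add_int_tau[OF assms] by (simp only: sum_distrib_right)
  also have "\<dots> = (\<Sum>i\<le>b. \<Sum>n\<in>{i..b}. ?c i n)"
    by (subst sum.Sigma, simp, simp, subst sum.Sigma, simp, simp,
        rule sum.reindex_bij_witness[of _ "\<lambda>(i, n). (n, i)" "\<lambda>(n, i). (i, n)"]) auto
  finally show ?thesis by (simp add: shifted_log_coeff_def sum_distrib_left sum_distrib_right mult_ac)
qed

text \<open>The decomposition by weight: the d-th summand is the component of degree d, and the
  constant term of the series joins degree 0.\<close>

lemma g_closed_form_eq_sum:
  assumes "Im \<tau> > 0"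
  shows "g_closed_form j a \<tau> z = (\<Sum>d\<le>Suc j. (if d = 0 then (- 1) ^ a * (1 / 2) ^ Suc j else 0)
    + (- 1) ^ j * shifted_log_coeff (1 - int a) d (Suc j) * kronecker_fps \<tau> z $ d)"
  unfolding g_closed_form_def kronecker_coeff_add_int_tau[OF assms] sum.distrib
  by (simp add: sum_distrib_left mult.assoc del: sum.atMost_Suc)

section \<open>Membership in the generated rings and leading parts\<close>

lemma generated_algebra_sum:
  "(\<And>i. i \<in> A \<Longrightarrow> f i \<in> generated_algebra B) \<Longrightarrow> (\<lambda>x. \<Sum>i\<in>A. f i x) \<in> generated_algebra B"
  by (induction A rule: infinite_finite_induct) (auto intro: generated_algebra.intros)

lemma homogeneous_in_generated_algebra:
  "homogeneous B d f \<Longrightarrow> f \<in> generated_algebra (snd ` B)"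
proof (induction rule: homogeneous.induct)
  case (gen d f)
  then show ?case by (intro generated_algebra.gen) force
qed (auto intro: generated_algebra.intros)

text \<open>With \<tau> fixed, the Taylor coefficients of w / \<theta>(w) count as constants, so
  only theta quotients remain as generators.\<close>

lemma g_closed_form_in_generated_algebra:
  assumes "Im \<tau> > 0"
  shows "g_closed_form j a \<tau> \<in> generated_algebra {theta_quot k \<tau> | k. k \<le> Suc j}"
  unfolding g_closed_form_eq_sum[OF assms, abs_def] kronecker_fps_nth_eq_sum divide_inverse
  by (intro generated_algebra_sum generated_algebra.add generated_algebra.mult generated_algebra.const
      generated_algebra.gen) auto

lemma generated_algebra_mono:
  assumes "f \<in> generated_algebra A" "A \<subseteq> B"
  shows "f \<in> generated_algebra B"
  using assms by (induction rule: generated_algebra.induct) (auto intro: generated_algebra.intros)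

lemma has_leading_part_imp_quasi_elliptic:
  assumes "has_leading_part f w L"
  shows "quasi_elliptic f"
proof -
  obtain c where c: "\<And>d. d \<le> w \<Longrightarrow> homogeneous qe_gens d (c d)" "\<And>x. x \<in> qe_domain \<Longrightarrow> f x = (\<Sum>d\<le>w. c d x)"
    using assms unfolding has_leading_part_def by blast
  have "(\<lambda>x. \<Sum>d\<le>w. c d x) \<in> generated_algebra (snd ` qe_gens)"
    by (intro generated_algebra_sum homogeneous_in_generated_algebra[OF c(1)]) simp
  then show ?thesis unfolding quasi_elliptic_def by (rule rev_bexI) (use c(2) in simp)
qed

text \<open>Along \<open>z - 2 \<pi> \<i> \<tau> N\<close> the value is a polynomial in \<open>N\<close> with leading coefficient \<open>1 / n!\<close>.\<close>

lemma kronecker_fps_nth_nonzero: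
  assumes im: "Im \<tau> > 0"
  shows "\<exists>z. z \<notin> period_lattice \<tau> \<and> kronecker_fps \<tau> z $ n \<noteq> 0"
proof (rule ccontr)
  assume "\<not> ?thesis"
  then have 0: "kronecker_fps \<tau> z $ n = 0" if "z \<notin> period_lattice \<tau>" for z using that by blast
  define z where "z = complex_of_real (pi * Im \<tau>)"
  have z: "z \<notin> period_lattice \<tau>" unfolding z_def by (rule pi_Im_not_in_period_lattice[OF im])
  define p where "p = (\<Sum>i\<le>n. monom (kronecker_fps \<tau> z $ (n - i) / fact i) i)"
  have "poly p (of_nat N) = 0" for N
  proof -
    have "kronecker_fps \<tau> (z + of_int (- int N) * tau_period \<tau>) $ n = 0"
      by (intro 0) (simp only: add_int_tau_in_period_lattice[OF im] z not_False_eq_True)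
    then have "(fps_exp (of_nat N) * kronecker_fps \<tau> z) $ n = 0"
      unfolding kronecker_fps_add_int_tau[OF im] by simp
    then show ?thesis
      unfolding p_def poly_sum poly_monom fps_mult_nth atLeast0AtMost by (simp add: mult.commute)
  qed
  then have "range (of_nat :: nat \<Rightarrow> complex) \<subseteq> {x. poly p x = 0}" by auto
  moreover have "infinite (range (of_nat :: nat \<Rightarrow> complex))"
    by (simp add: finite_image_iff inj_of_nat)
  ultimately have "p = 0" using poly_roots_finite finite_subset by blast
  then have "coeff p n = 0" by simp
  moreover have "coeff p n = kronecker_fps \<tau> z $ 0 / fact n"
    by (simp add: p_def coeff_sum if_distrib cong: if_cong)
  ultimately show False using kronecker_fps_0[OF im z] by simp
qed

text \<open>By \<open>shifted_log_coeff_diag\<close> the top component is the Kronecker coefficient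
  itself up to a sign depending on j alone, so the leading part named here is free of a.\<close>

lemma has_leading_part_closed_form:
  assumes f: "\<And>z \<tau>. Im \<tau> > 0 \<Longrightarrow> z \<notin> period_lattice \<tau> \<Longrightarrow> f (z, \<tau>) = g_closed_form j a \<tau> z"
  shows "has_leading_part f (Suc j) (\<lambda>(z, \<tau>). (- 1) ^ j * kronecker_fps \<tau> z $ Suc j)"
proof -
  let ?f = "\<lambda>d z \<tau>. (if d = 0 then (- 1) ^ a * (1 / 2) ^ Suc j else 0)
    + (- 1) ^ j * shifted_log_coeff (1 - int a) d (Suc j) * kronecker_fps \<tau> z $ d"
  have "quasi_homogeneous d (?f d)" for d
  proof (rule quasi_homogeneous_add)
    show "quasi_homogeneous d (\<lambda>z \<tau>. if d = 0 then (- 1) ^ a * (1 / 2) ^ Suc j else 0)"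
      by (cases "d = 0") (auto intro: quasi_homogeneous_const quasi_homogeneous_0)
  qed (intro quasi_homogeneous_cmult quasi_homogeneous_kronecker)
  then obtain c where c: "\<And>d. homogeneous qe_gens d (c d)"
    "\<And>d z \<tau>. Im \<tau> > 0 \<Longrightarrow> z \<notin> period_lattice \<tau> \<Longrightarrow> ?f d z \<tau> = c d (z, \<tau>)"
    unfolding quasi_homogeneous_def by metis
  \<comment> \<open>Nonvanishing of the leading part is shown at one sample value, \<tau> =
    \<i>.\<close>
  obtain z where z: "z \<notin> period_lattice \<i>" "kronecker_fps \<i> z $ Suc j \<noteq> 0"
    using kronecker_fps_nth_nonzero[of \<i> "Suc j"] by auto
  show ?thesis
    unfolding has_leading_part_def
  proof (intro exI[of _ c] conjI allI impI ballI bexI[of _ "(z, \<i>)"])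
    fix x assume "x \<in> qe_domain"
    then obtain z \<tau> where x: "x = (z, \<tau>)" "Im \<tau> > 0" "z \<notin> period_lattice \<tau>"
      by (auto simp: qe_domain_def)
    show "f x = (\<Sum>d\<le>Suc j. c d x)"
      unfolding x(1) f[OF x(2,3)] g_closed_form_eq_sum[OF x(2)]
      by (intro sum.cong refl c(2) x)
    show "(case x of (z, \<tau>) \<Rightarrow> (- 1) ^ j * kronecker_fps \<tau> z $ Suc j) = c (Suc j) x"
      using c(2)[OF x(2,3), of "Suc j"] by (simp add: x(1) shifted_log_coeff_diag)
  qed (use c z in \<open>auto simp: qe_domain_def\<close>)
qed

lemma has_leading_part_1:
  assumes "\<And>x. x \<in> qe_domain \<Longrightarrow> f x = 1"
  shows "has_leading_part f 0 (\<lambda>_. 1)"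
proof -
  have "(of_real pi, \<i>) \<in> qe_domain"
    using pi_Im_not_in_period_lattice[of \<i>] by (simp add: qe_domain_def)
  then show ?thesis
    unfolding has_leading_part_def
    by (intro exI[of _ "\<lambda>_ _. 1"]) (use assms in \<open>auto intro: homogeneous.const\<close>)
qed

theorem theorem3p12:
  fixes b :: nat
  shows "(\<forall>a\<le>b. \<forall>\<tau>. Im \<tau> > 0 \<longrightarrow>
            locally_absolutely_convergent_on (g_term b a (qpar \<tau>)) (g_region b a (qpar \<tau>)) \<and>
            g_series b a (qpar \<tau>) holomorphic_on g_region b a (qpar \<tau>) \<and>
            (\<exists>F. g_continuation b a (qpar \<tau>) F)) \<and>
         (\<forall>F. (\<forall>a\<le>b. \<forall>\<tau>. Im \<tau> > 0 \<longrightarrow> g_continuation b a (qpar \<tau>) (F a \<tau>)) \<longrightarrow>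
            (\<forall>a\<le>b. \<forall>\<tau>. Im \<tau> > 0 \<longrightarrow>
               (\<exists>P \<in> generated_algebra {theta_quot k \<tau> | k. k \<le> b + 1}.
                  \<forall>z. z \<notin> period_lattice \<tau> \<longrightarrow> F a \<tau> (exp z) = P z)) \<and>
            (\<forall>a\<le>b. quasi_elliptic (\<lambda>(z, \<tau>). F a \<tau> (exp z))) \<and>
            (\<exists>L. \<forall>a\<le>b. has_leading_part (\<lambda>(z, \<tau>). F a \<tau> (exp z)) b L))"
proof -
  have q: "qpar \<tau> \<noteq> 0" "norm (qpar \<tau>) < 1" if "Im \<tau> > 0" for \<tau>
    using qpar_nontrivial[OF that, of 1] by auto
  have 1: "locally_absolutely_convergent_on (g_term b a (qpar \<tau>)) (g_region b a (qpar \<tau>))"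
    "g_series b a (qpar \<tau>) holomorphic_on g_region b a (qpar \<tau>)"
    "\<exists>F. g_continuation b a (qpar \<tau>) F" if "a \<le> b" "Im \<tau> > 0" for a \<tau>
    using that g_term_locally_absolutely_convergent[OF q] g_series_holomorphic[OF q] g_continuation_exists
    \<comment> \<open>For b = 0 the region is empty, so the claims about convergence are vacuous,
      and the continuation is the constant 1.\<close>
    by (cases b; auto simp: g_region_0_left locally_absolutely_convergent_on_def
          holomorphic_on_empty g_continuation_def intro!: exI[of _ "\<lambda>_. 1"])+
  have 2: "\<exists>P \<in> generated_algebra {theta_quot k \<tau> | k. k \<le> b + 1}.
      \<forall>z. z \<notin> period_lattice \<tau> \<longrightarrow> F (exp z) = P z"
    if "Im \<tau> > 0" "a \<le> b" "g_continuation b a (qpar \<tau>) F" for F a \<tau>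
  proof (cases b)
    case 0
    then show ?thesis using that
      by (intro bexI[OF _ generated_algebra.const[of 1]]) (simp add: g_continuation_def)
  next
    case (Suc j)
    have "g_closed_form j a \<tau> \<in> generated_algebra {theta_quot k \<tau> | k. k \<le> b + 1}"
      by (rule generated_algebra_mono[OF g_closed_form_in_generated_algebra[OF that(1)]]) (auto simp: Suc)
    then show ?thesis
      by (rule rev_bexI) (use g_continuation_eq_closed_form[OF that(1)] that Suc in blast)
  qed
  \<comment> \<open>The case b = 0 is the convention that the series is 1; for b > 0 the sign is
    (-1)^j with j = b - 1.\<close>
  define L where "L = (\<lambda>(z, \<tau>). if b = 0 then 1 else (- 1) ^ (b - 1) * kronecker_fps \<tau> z $ b)"
  have 3: "has_leading_part (\<lambda>(z, \<tau>). F a \<tau> (exp z)) b L"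
    if "a \<le> b" "\<And>\<tau>. Im \<tau> > 0 \<Longrightarrow> g_continuation b a (qpar \<tau>) (F a \<tau>)" for F a
  proof (cases b)
    case 0
    then have "has_leading_part (\<lambda>(z, \<tau>). F a \<tau> (exp z)) 0 (\<lambda>_. 1)"
      by (intro has_leading_part_1) (use that in \<open>auto simp: qe_domain_def g_continuation_def\<close>)
    then show ?thesis by (simp add: L_def 0 case_prod_unfold)
  next
    case (Suc j)
    have "has_leading_part (\<lambda>(z, \<tau>). F a \<tau> (exp z)) (Suc j) (\<lambda>(z, \<tau>). (- 1) ^ j * kronecker_fps \<tau> z $ Suc j)"
      by (rule has_leading_part_closed_form[where a = a])
         (use g_continuation_eq_closed_form that Suc in simp)
    then show ?thesis by (simp add: L_def Suc)
  qed
  show ?thesis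
  proof (intro conjI allI impI exI[of _ L])
    fix F a
    assume "\<forall>a\<le>b. \<forall>\<tau>. Im \<tau> > 0 \<longrightarrow> g_continuation b a (qpar \<tau>) (F a \<tau>)" "a \<le> b"
    then show "quasi_elliptic (\<lambda>(z, \<tau>). F a \<tau> (exp z))"
      by (intro has_leading_part_imp_quasi_elliptic[OF 3]) auto
  qed (use 1 2 3 in auto)
qed

end
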